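(* Let $n\ge 2$, let $\Omega_1,\ldots,\Omega_n$ be closed subsets of a Banach space $X$, $\omega_i\in\Omega_i$ $(i=1,\ldots,n)$, $\varepsilon>0$ and $\varphi\in\mathcal{C}^1$. Suppose that $\bigcap_{i=1}^n\Omega_i=\emptyset$ and $$\varphi\Big(\max_{1\le i\le n-1}\|\omega_n-\omega_i\|\Big)<\varphi\big(d(\Omega_1,\ldots,\Omega_n)\big)+\varepsilon.$$ Then, for any $\lambda>0$ and $\eta>0$: (i) there exist points $\omega'_i\in\Omega_i\cap\mathbb{B}_\lambda(\omega_i)$ $(i=1,\ldots,n-1)$ and $\omega'_n\in\Omega_n\cap\mathbb{B}_\eta(\omega_n)$ satisfying $$0<\max_{1\le i\le n-1}\|\omega'_n-\omega'_i\|\le\max_{1\le i\le n-1}\|\omega_n-\omega_i\|,$$ and vectors $x_i^*\in X^*$ $(i=1,\ldots,n)$ satisfying $$\sum_{i=1}^n x_i^*=0,\qquad\sum_{i=1}^{n-1}\|x_i^*\|=1,\tag{1}$$ $$\varphi'\Big(\max_{1\le i\le n-1}\|\omega'_n-\omega'_i\|\Big)\Big(\lambda\sum_{i=1}^{n-1}d\big(x_i^*,N_{\Omega_i}(\omega'_i)\big)+\eta\,d\big(x_n^*,N_{\Omega_n}(\omega'_n)\big)\Big)<\varepsilon,\tag{2}$$ $$\sum_{i=1}^{n-1}\langle x_i^*,\omega'_n-\omega'_i\rangle=\max_{1\le i\le n-1}\|\omega'_n-\omega'_i\|,$$ where $N$ stands for the Clarke normal cone ($N=N^C$); (ii) if $X$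 is Asplund, then, for any $\tau\in\,]0,1[$, there exist points $\omega'_i\in\Omega_i\cap\mathbb{B}_\lambda(\omega_i)$ $(i=1,\ldots,n-1)$ and $\omega'_n\in\Omega_n\cap\mathbb{B}_\eta(\omega_n)$ satisfying $$0<\max_{1\le i\le n-1}\|\omega'_n-\omega'_i\|<\varphi^{-1}\big(\varphi(d(\Omega_1,\ldots,\Omega_n))+\varepsilon\big),$$ and vectors $x_i^*\in X^*$ $(i=1,\ldots,n)$ satisfying (1), (2) with $N$ standing for the Fréchet normal cone ($N=N^F$), and $$\sum_{i=1}^{n-1}\langle x_i^*,\omega'_n-\omega'_i\rangle>\tau\max_{1\le i\le n-1}\|\omega'_n-\omega'_i\|.$$
   Context: $\mathbb{B}_\delta(x)$ is the open ball with center $x$ and radius $\delta$; $d(x^*,S)$ is the norm distance from a point to a set. $\mathcal{C}^1$ is the family of all continuous strictly increasing functions $\varphi:\mathbb{R}_+\to\mathbb{R}_+$ with $\varphi(0)=0$, $\lim_{t\to+\infty}\varphi(t)=+\infty$, that are continuously differentiable on $]0,+\infty[$ with $\varphi'(t)>0$ for all $t>0$. For several sets, $$d(\Omega_1,\ldots,\Omega_n):=\inf_{u_i\in\Omega_i\,(i=1,\ldots,n)}\ \max_{1\le i\le n-1}\|u_n-u_i\|.$$ For $\Omega\subset X$ and $\omega\in\Omega$, the Fréchet normal cone is $$N^F_\Omega(\omega):=\Big\{x^*\in X^*\ \Big|\ \limsup_{\Omega\ni x\to\omega,\,x\ne\omega}\frac{\langle x^*,x-\omega\rangle}{\|x-\omega\|}\le0\Big\}$$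 (equal to $X^*$ if $\omega$ is isolated in $\Omega$), and the Clarke normal cone is $N^C_\Omega(\omega):=\{x^*\in X^*\mid\langle x^*,z\rangle\le0\ \text{for all}\ z\in T^C_\Omega(\omega)\}$, where $T^C_\Omega(\omega)$ is the Clarke tangent cone (the set of $z\in X$ such that for all sequences $x_k\to\omega$ in $\Omega$ and $t_k\downarrow0$ there are $z_k\to z$ with $x_k+t_kz_k\in\Omega$ for all $k$). A Banach space is Asplund if every continuous convex function on an open convex set is Fréchet differentiable on a dense subset of it. *)

theory Defs
  imports "HOL-Analysis.Analysis"
begin

text \<open>Functions \<open>\<real>\<^sub>+ \<rightarrow> \<real>\<^sub>+\<close> are functions on \<open>\<real>\<close> of which only the restriction to \<open>{0..}\<close> matters.\<close>

definition class_C1 :: "(real \<Rightarrow> real) set" where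
  "class_C1 = {\<phi>. \<phi> ` {0..} \<subseteq> {0..} \<and> continuous_on {0..} \<phi> \<and> strict_mono_on {0..} \<phi> \<and>
     \<phi> 0 = 0 \<and> filterlim \<phi> at_top at_top \<and>
     (\<forall>t>0. \<phi> differentiable (at t)) \<and> continuous_on {0<..} (deriv \<phi>) \<and>
     (\<forall>t>0. deriv \<phi> t > 0)}"

text \<open>Families of points and sets are indexed by \<open>1, \<dots>, n\<close>; other indices are ignored.\<close>

definition max_dist :: "nat \<Rightarrow> (nat \<Rightarrow> 'a::real_normed_vector) \<Rightarrow> real" where
  "max_dist n u = Max ((\<lambda>i. norm (u n - u i)) ` {1..n - 1})"

text \<open>The infimum is taken in \<open>\<real>\<close>, so it is meaningful only for nonempty sets and \<open>n \<ge> 2\<close>.\<close>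

definition sets_dist :: "nat \<Rightarrow> (nat \<Rightarrow> 'a::real_normed_vector set) \<Rightarrow> real" where
  "sets_dist n \<Omega> = (INF u\<in>{u. \<forall>i\<in>{1..n}. u i \<in> \<Omega> i}. max_dist n u)"

text \<open>At an isolated point of \<open>\<Omega>\<close> the filter is \<open>bot\<close>, where the extended-real \<open>Limsup\<close> is
  \<open>-\<infinity>\<close>; so the cone is the whole dual space there.\<close>

definition frechet_normal_cone :: "'a::real_normed_vector set \<Rightarrow> 'a \<Rightarrow> ('a \<Rightarrow>\<^sub>L real) set" where
  "frechet_normal_cone \<Omega> \<omega> =
     {f. Limsup (at \<omega> within \<Omega>) (\<lambda>x. ereal (blinfun_apply f (x - \<omega>) / norm (x - \<omega>))) \<le> 0}"

definition clarke_tangent_cone :: "'a::real_normed_vector set \<Rightarrow> 'a \<Rightarrow> 'a set" where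
  "clarke_tangent_cone \<Omega> \<omega> =
     {z. \<forall>x t. (\<forall>k::nat. x k \<in> \<Omega>) \<and> x \<longlonglongrightarrow> \<omega> \<and> (\<forall>k. t k > (0::real)) \<and> t \<longlonglongrightarrow> 0 \<longrightarrow>
        (\<exists>y. y \<longlonglongrightarrow> z \<and> (\<forall>k. x k + t k *\<^sub>R y k \<in> \<Omega>))}"

definition clarke_normal_cone :: "'a::real_normed_vector set \<Rightarrow> 'a \<Rightarrow> ('a \<Rightarrow>\<^sub>L real) set" where
  "clarke_normal_cone \<Omega> \<omega> = {f. \<forall>z\<in>clarke_tangent_cone \<Omega> \<omega>. blinfun_apply f z \<le> 0}"

text \<open>Differentiability in the library is Frechet differentiability.\<close>

definition asplund :: "'a::banach itself \<Rightarrow> bool" where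
  "asplund _ \<longleftrightarrow> (\<forall>(U::'a set) (f::'a \<Rightarrow> real).
     open U \<and> convex U \<and> convex_on U f \<and> continuous_on U f \<longrightarrow>
     U \<subseteq> closure {x\<in>U. f differentiable (at x)})"

end

theory Submission
  imports Defs "HOL-Library.Function_Algebras"
begin

text \<open>Ekeland's variational principle for \<open>\<phi> \<circ> max_dist n\<close> on \<open>\<Omega> 1 \<times> \<dots> \<times> \<Omega> n\<close>, with the norm
  \<open>wmax\<close> whose unit ball is \<open>ball 0 lam \<times> \<dots> \<times> ball 0 \<eta>\<close>, gives a tuple \<open>w\<close> that
  minimises \<open>\<phi> \<circ> max_dist n + e * wmax (\<cdot> - w)\<close> with \<open>e < \<epsilon>\<close>. As \<open>\<phi>\<close> is differentiable at
  \<open>max_dist n w > 0\<close>, it may be replaced by its linearisation, at the price of a slightly larger \<open>e\<close>: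
  \<open>w\<close> is a local minimiser of a convex function. For Clarke normals, the Hahn-Banach sandwich theorem
  on the product of the tangent cones splits this first-order condition into multipliers.

  In an Asplund space everything is first moved into a separable closed subspace \<open>V\<close>. The dual ball is peeled
  by removing weak-star slices of small diameter, transfinitely often; choosing one functional for
  each rational weak-star box in the last layer that the box meets yields countably many functionals that
  are norm dense in the dual of \<open>V\<close>, and a closing-off argument makes Frechet normals relative to
  \<open>V\<close> genuine Frechet normals. On \<open>V\<close> the norm is uniformly approximated by the Frechet smooth convex functions
  \<open>x \<mapsto> SUP f. f x - \<theta> f\<close>, where \<open>\<theta>\<close> is a weighted sum of squared distances to a dense sequence of
  functionals. Smoothing the convex function above (with log-sum-exp in place of the maxima) and applying a smooth variational
  principle of Borwein-Preiss type produces a nearby minimiser at which the partial gradients are Frechet normals.\<close>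


subsection \<open>Sublinear functionals and the Hahn-Banach sandwich theorem\<close>

text \<open>An Asplund space need not have an equivalent Frechet smooth norm, which is the obstacle
  to a smooth variational argument on the whole space. The subspace \<open>V\<close> is therefore
  built together with a space \<open>Y\<close> of functionals on the whole space that restricts
  isometrically to \<open>V\<close>; gradients computed on \<open>V\<close> are thus already
  elements of the dual of the whole space. For Clarke normals the Ekeland point itself is the
  answer, so the bound on \<open>max_dist\<close> and the pairing are exact. Smoothing moves the
  point once more, replaces the pairing by an inequality and lets the norms sum to some
  \<open>W \<le> 1\<close>; renormalising by \<open>W\<close> is the reason for
  \<open>\<tau>\<close> and for the weaker bound through the inverse of \<open>\<phi>\<close>, and
  comparing the slopes of \<open>\<phi>\<close> at the two points uses continuity of
  \<open>deriv \<phi>\<close>. Every loss is paid from a strict inequality: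
  \<open>e < e1 < \<epsilon>\<close> and \<open>\<tau> < \<sigma> < 1\<close>. Tuples are functions
  on \<open>nat\<close> whose values outside \<open>1..n\<close> are ignored. Distances between
  tuples are then only pseudometrics, so both variational principles are stated for abstract
  distances.\<close>

definition sublinear :: "('a::real_vector \<Rightarrow> real) \<Rightarrow> bool" where
  "sublinear P \<longleftrightarrow> (\<forall>x y. P (x + y) \<le> P x + P y) \<and> (\<forall>x. \<forall>t\<ge>0. P (t *\<^sub>R x) = t * P x)"

lemma sublinearI:
  assumes "\<And>x y. P (x + y) \<le> P x + P y" "\<And>x t. t > 0 \<Longrightarrow> P (t *\<^sub>R x) \<le> t * P x" "P 0 = 0"
  shows "sublinear P"
proof -
  have "P (t *\<^sub>R x) = t * P x" if "t \<ge> 0" for x t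
  proof (cases "t = 0")
    case False
    with that have t: "t > 0" by simp
    have "P x = P (inverse t *\<^sub>R (t *\<^sub>R x))" using t by simp
    also have "\<dots> \<le> inverse t * P (t *\<^sub>R x)" using assms(2) t by (metis inverse_positive_iff_positive)
    finally have "t * P x \<le> P (t *\<^sub>R x)" using t by (simp add: field_simps)
    then show ?thesis using assms(2)[OF t, of x] by simp
  qed (use assms in auto)
  then show ?thesis using assms by (auto simp: sublinear_def)
qed

lemma sublinear_neg:
  assumes "sublinear P" shows "- P (- x) \<le> P x"
proof -
  have "P (0 *\<^sub>R x) = 0 * P x" using assms unfolding sublinear_def by blast
  then have "P (x + - x) = 0" by simp
  moreover have "P (x + - x) \<le> P x + P (- x)" using assms unfolding sublinear_def by blast
  ultimately show ?thesis by simp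
qed

text \<open>\<open>Q x\<close> is the infimum of \<open>P (x + k) - r\<close> over
  \<open>(k, r)\<close> in \<open>H\<close>. The bound \<open>r \<le> P k\<close> keeps it above
  \<open>- P (- x)\<close>, and the closure properties of \<open>H\<close> make it sublinear. Every
  linear functional below \<open>Q\<close> is automatically at least \<open>r\<close> at
  \<open>k\<close>.\<close>

lemma sublinear_reduce:
  fixes P :: "'a::real_vector \<Rightarrow> real" and H :: "('a \<times> real) set"
  assumes P: "sublinear P" and H0: "(0, 0) \<in> H"
    and Hadd: "\<And>a b. a \<in> H \<Longrightarrow> b \<in> H \<Longrightarrow> a + b \<in> H"
    and Hscale: "\<And>a t. a \<in> H \<Longrightarrow> t > 0 \<Longrightarrow> t *\<^sub>R a \<in> H"
    and Hle: "\<And>k r. (k, r) \<in> H \<Longrightarrow> r \<le> P k"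
  obtains Q where "sublinear Q" "\<And>x. Q x \<le> P x" "\<And>k r. (k, r) \<in> H \<Longrightarrow> Q (- k) \<le> - r"
proof -
  define Q where "Q x = (INF a\<in>H. P (x + fst a) - snd a)" for x
  have Padd: "P (x + y) \<le> P x + P y" for x y using P by (simp add: sublinear_def)
  have Pscale: "P (t *\<^sub>R x) = t * P x" if "t \<ge> 0" for t x using P that by (simp add: sublinear_def)
  have P0: "P 0 = 0" using Pscale[of 0 0] by simp
  have lb: "- P (- x) \<le> P (x + fst a) - snd a" if "a \<in> H" for x a
  proof -
    have "snd a \<le> P (fst a)" using Hle[of "fst a" "snd a"] that by simp
    also have "\<dots> \<le> P (x + fst a) + P (- x)" using Padd[of "x + fst a" "- x"] by simp
    finally show ?thesis by simp
  qed
  have bdd: "bdd_below ((\<lambda>a. P (x + fst a) - snd a) ` H)" for x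
    by (rule bdd_belowI2[of _ "- P (- x)"]) (rule lb)
  have ne: "H \<noteq> {}" using H0 by auto
  have Qle: "Q x \<le> P (x + fst a) - snd a" if "a \<in> H" for x a
    unfolding Q_def by (rule cINF_lower[OF bdd that])
  have Qge: "c \<le> Q x" if "\<And>a. a \<in> H \<Longrightarrow> c \<le> P (x + fst a) - snd a" for c x
    unfolding Q_def by (rule cINF_greatest[OF ne that])
  have "Q (x + y) \<le> Q x + Q y" for x y
  proof -
    have "Q (x + y) - Q y \<le> Q x"
    proof (rule Qge)
      fix a assume a: "a \<in> H"
      have "Q (x + y) - (P (x + fst a) - snd a) \<le> Q y"
      proof (rule Qge)
        fix b assume b: "b \<in> H"
        have "Q (x + y) \<le> P (x + y + fst (a + b)) - snd (a + b)" by (rule Qle[OF Hadd[OF a b]])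
        also have "P (x + y + fst (a + b)) \<le> P (x + fst a) + P (y + fst b)"
          using Padd[of "x + fst a" "y + fst b"] by (simp add: algebra_simps)
        finally show "Q (x + y) - (P (x + fst a) - snd a) \<le> P (y + fst b) - snd b" by simp
      qed
      then show "Q (x + y) - Q y \<le> P (x + fst a) - snd a" by simp
    qed
    then show ?thesis by simp
  qed
  moreover have "Q (t *\<^sub>R x) \<le> t * Q x" if t: "t > 0" for t x
  proof -
    have "Q (t *\<^sub>R x) / t \<le> Q x"
    proof (rule Qge)
      fix a assume a: "a \<in> H"
      have "Q (t *\<^sub>R x) \<le> P (t *\<^sub>R x + fst (t *\<^sub>R a)) - snd (t *\<^sub>R a)" by (rule Qle[OF Hscale[OF a t]])
      also have "\<dots> = t * (P (x + fst a) - snd a)"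
        using Pscale[of t "x + fst a"] t by (simp add: algebra_simps)
      finally show "Q (t *\<^sub>R x) / t \<le> P (x + fst a) - snd a" using t by (simp add: field_simps)
    qed
    then show ?thesis using t by (simp add: field_simps)
  qed
  moreover have "Q 0 = 0"
  proof (rule antisym)
    show "Q 0 \<le> 0" using Qle[OF H0, of 0] P0 by simp
    show "0 \<le> Q 0" by (rule Qge) (use Hle in auto)
  qed
  ultimately have "sublinear Q" by (intro sublinearI) auto
  moreover have "Q x \<le> P x" for x using Qle[OF H0, of x] by simp
  moreover have "Q (- k) \<le> - r" if "(k, r) \<in> H" for k r using Qle[OF that, of "- k"] P0 by simp
  ultimately show ?thesis using that by blast
qed

text \<open>Reducing along the ray through \<open>y\<close> brings the value at \<open>- y\<close>
  down to at most \<open>- Q y\<close>. Minimality says that nothing was lowered, so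
  \<open>Q\<close> is odd, and an odd subadditive function is additive.\<close>

lemma minimal_sublinear_linear:
  fixes Q :: "'a::real_vector \<Rightarrow> real"
  assumes Q: "sublinear Q" and min: "\<And>R. sublinear R \<Longrightarrow> (\<And>x. R x \<le> Q x) \<Longrightarrow> R = Q"
  shows "linear Q"
proof -
  have Qadd: "Q (x + y) \<le> Q x + Q y" for x y using Q by (simp add: sublinear_def)
  have Qscale: "Q (t *\<^sub>R x) = t * Q x" if "t \<ge> 0" for t x using Q that by (simp add: sublinear_def)
  have neg: "Q (- y) = - Q y" for y
  proof -
    define H where "H = (\<lambda>t. (t *\<^sub>R y, t * Q y)) ` {0..}"
    obtain R where R: "sublinear R" "\<And>x. R x \<le> Q x" "\<And>k r. (k, r) \<in> H \<Longrightarrow> R (- k) \<le> - r"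
    proof (rule sublinear_reduce[OF Q, of H])
      show "(0, 0) \<in> H" unfolding H_def by (auto simp: image_iff intro!: bexI[of _ 0])
      show "a + b \<in> H" if ab: "a \<in> H" "b \<in> H" for a b
      proof -
        obtain s t where st: "s \<ge> 0" "t \<ge> 0" "a = (s *\<^sub>R y, s * Q y)" "b = (t *\<^sub>R y, t * Q y)"
          using ab by (auto simp: H_def)
        then have "a + b = ((s + t) *\<^sub>R y, (s + t) * Q y)" by (simp add: algebra_simps)
        then show ?thesis unfolding H_def using st by (intro image_eqI[of _ _ "s + t"]) auto
      qed
      show "t *\<^sub>R a \<in> H" if at: "a \<in> H" "t > 0" for a and t :: real
      proof -
        obtain s where s: "s \<ge> 0" "a = (s *\<^sub>R y, s * Q y)" using at by (auto simp: H_def)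
        then have "t *\<^sub>R a = ((t * s) *\<^sub>R y, (t * s) * Q y)" by simp
        then show ?thesis unfolding H_def using s at by (intro image_eqI[of _ _ "t * s"]) auto
      qed
      show "r \<le> Q k" if "(k, r) \<in> H" for k r using that Qscale by (auto simp: H_def)
    qed blast
    have "R = Q" using min R by blast
    moreover have "(y, Q y) \<in> H" unfolding H_def by (intro image_eqI[of _ _ 1]) auto
    ultimately have "Q (- y) \<le> - Q y" using R(3) by blast
    then show ?thesis using sublinear_neg[OF Q, of y] by linarith
  qed
  show ?thesis
  proof (rule linearI)
    show "Q (x + y) = Q x + Q y" for x y
      using Qadd[of x y] Qadd[of "- x" "- y"] neg[of "x + y"] neg[of x] neg[of y] by simp
    show "Q (r *\<^sub>R x) = r *\<^sub>R Q x" for r x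
      using Qscale[of r x] Qscale[of "- r" x] neg[of "r *\<^sub>R x"] by (cases "r \<ge> 0") auto
  qed
qed

lemma sublinear_dominates_linear:
  fixes P :: "'a::real_vector \<Rightarrow> real"
  assumes P: "sublinear P"
  obtains L where "linear L" "\<And>x. L x \<le> P x"
proof -
  define A where "A = {Q. sublinear Q \<and> (\<forall>x. Q x \<le> P x)}"
  \<comment> \<open>Zorn's lemma for the reversed pointwise order: its maximal elements are the
    minimal sublinear functionals.\<close>
  have "\<exists>m\<in>A. \<forall>a\<in>A. a \<le> m \<longrightarrow> a = m"
  proof (rule predicate_Zorn)
    show "partial_order_on A (relation_of (\<lambda>x y. y \<le> x) A)"
      by (rule partial_order_on_relation_ofI) auto
  next
    fix C assume C: "C \<in> Chains (relation_of (\<lambda>x y :: 'a \<Rightarrow> real. y \<le> x) A)"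
    have CA: "Q \<in> A" if "Q \<in> C" for Q using C that by (auto simp: Chains_def relation_of_def)
    have tot: "Q \<le> R \<or> R \<le> Q" if "Q \<in> C" "R \<in> C" for Q R
      using C that by (auto simp: Chains_def relation_of_def)
    show "\<exists>u\<in>A. \<forall>a\<in>C. u \<le> a"
    proof (cases "C = {}")
      case True then show ?thesis using P by (auto simp: A_def)
    next
      case False
      define u where "u x = (INF Q\<in>C. Q x)" for x
      have lb: "- P (- x) \<le> Q x" if "Q \<in> C" for Q x
      proof -
        have "- Q (- x) \<le> Q x" using CA[OF that] by (auto simp: A_def intro: sublinear_neg)
        moreover have "Q (- x) \<le> P (- x)" using CA[OF that] by (auto simp: A_def)
        ultimately show ?thesis by linarith
      qed
      have bdd: "bdd_below ((\<lambda>Q. Q x) ` C)" for x by (rule bdd_belowI2[of _ "- P (- x)"]) (rule lb)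
      have ule: "u x \<le> Q x" if "Q \<in> C" for Q x unfolding u_def by (rule cINF_lower[OF bdd that])
      have uge: "c \<le> u x" if "\<And>Q. Q \<in> C \<Longrightarrow> c \<le> Q x" for c x
        unfolding u_def by (rule cINF_greatest[OF False that])
      have "sublinear u"
      proof (rule sublinearI)
        fix x y
        have "u (x + y) - u y \<le> u x"
        proof (rule uge)
          fix Q assume Q: "Q \<in> C"
          have "u (x + y) - Q x \<le> u y"
          proof (rule uge)
            fix R assume R: "R \<in> C"
            \<comment> \<open>An infimum of subadditive functions is not subadditive in general;
              here the chain supplies one member below both \<open>Q\<close> and
              \<open>R\<close>.\<close>
            obtain S where S: "S \<in> C" "S \<le> Q" "S \<le> R" using tot[OF Q R] Q R by auto
            have "u (x + y) \<le> S (x + y)" by (rule ule[OF S(1)])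
            also have "\<dots> \<le> S x + S y" using CA[OF S(1)] by (auto simp: A_def sublinear_def)
            also have "\<dots> \<le> Q x + R y" using S by (intro add_mono) (auto simp: le_fun_def)
            finally show "u (x + y) - Q x \<le> R y" by simp
          qed
          then show "u (x + y) - u y \<le> Q x" by simp
        qed
        then show "u (x + y) \<le> u x + u y" by simp
      next
        fix x and t :: real assume t: "t > 0"
        have "u (t *\<^sub>R x) / t \<le> u x"
        proof (rule uge)
          fix Q assume Q: "Q \<in> C"
          have "u (t *\<^sub>R x) \<le> Q (t *\<^sub>R x)" by (rule ule[OF Q])
          also have "\<dots> = t * Q x" using CA[OF Q] t by (auto simp: A_def sublinear_def)
          finally show "u (t *\<^sub>R x) / t \<le> Q x" using t by (simp add: field_simps)
        qed
        then show "u (t *\<^sub>R x) \<le> t * u x" using t by (simp add: field_simps)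
      next
        have "Q 0 = 0" if "Q \<in> C" for Q
          using CA[OF that] by (simp add: A_def sublinear_def) (metis scaleR_zero_left mult_zero_left order_refl)
        then have "u 0 = (INF Q\<in>C. 0)" unfolding u_def by (intro INF_cong) auto
        then show "u 0 = 0" using False by simp
      qed
      moreover obtain Q where "Q \<in> C" using False by auto
      then have "u x \<le> P x" for x using ule[of Q x] CA[of Q] by (auto simp: A_def intro: order_trans)
      ultimately have "u \<in> A" by (simp add: A_def)
      then show ?thesis using ule by (auto simp: le_fun_def)
    qed
  qed
  then obtain m where m: "m \<in> A" "\<And>a. a \<in> A \<Longrightarrow> a \<le> m \<Longrightarrow> a = m" by blast
  have "linear m"
  proof (rule minimal_sublinear_linear)
    show "sublinear m" using m by (simp add: A_def)
    show "R = m" if "sublinear R" "\<And>x. R x \<le> m x" for R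
      using that m by (intro m(2)) (auto simp: A_def le_fun_def intro: order_trans)
  qed
  then show ?thesis using that m by (auto simp: A_def)
qed

text \<open>\<open>H\<close> is a cone of pairs rather than a superlinear function on a cone: it can
  be given by parameters, and one vector \<open>k\<close> may come with several lower bounds
  \<open>r\<close>.\<close>

theorem hahn_banach_sandwich:
  fixes P :: "'a::real_vector \<Rightarrow> real" and H :: "('a \<times> real) set"
  assumes P: "sublinear P" and H0: "(0, 0) \<in> H"
    and Hadd: "\<And>a b. a \<in> H \<Longrightarrow> b \<in> H \<Longrightarrow> a + b \<in> H"
    and Hscale: "\<And>a t. a \<in> H \<Longrightarrow> t > 0 \<Longrightarrow> t *\<^sub>R a \<in> H"
    and Hle: "\<And>k r. (k, r) \<in> H \<Longrightarrow> r \<le> P k"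
  obtains L where "linear L" "\<And>x. L x \<le> P x" "\<And>k r. (k, r) \<in> H \<Longrightarrow> r \<le> L k"
proof -
  obtain Q where Q: "sublinear Q" "\<And>x. Q x \<le> P x" "\<And>k r. (k, r) \<in> H \<Longrightarrow> Q (- k) \<le> - r"
    using sublinear_reduce[OF assms] by blast
  obtain L where L: "linear L" "\<And>x. L x \<le> Q x" using sublinear_dominates_linear[OF Q(1)] by blast
  have "r \<le> L k" if "(k, r) \<in> H" for k r
    using Q(3)[OF that] L(2)[of "- k"] linear_neg[OF L(1), of k] by simp
  then show ?thesis using that[OF L(1)] L(2) Q(2) by (meson order_trans)
qed

lemma norming_functional:
  fixes x :: "'a::real_normed_vector"
  obtains f :: "'a \<Rightarrow> real" where "linear f" "\<And>z. \<bar>f z\<bar> \<le> norm z" "f x = norm x"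
proof -
  define H where "H = (\<lambda>t. (t *\<^sub>R x, t * norm x)) ` {0..}"
  obtain L where L: "linear L" "\<And>z. L z \<le> norm z" "\<And>k r. (k, r) \<in> H \<Longrightarrow> r \<le> L k"
  proof (rule hahn_banach_sandwich[of norm H])
    show "sublinear (norm :: 'a \<Rightarrow> real)" by (intro sublinearI) (auto simp: norm_triangle_ineq)
    show "(0, 0) \<in> H" unfolding H_def by (auto simp: image_iff intro!: bexI[of _ 0])
    show "a + b \<in> H" if ab: "a \<in> H" "b \<in> H" for a b
    proof -
      obtain s t where st: "s \<ge> 0" "t \<ge> 0" "a = (s *\<^sub>R x, s * norm x)" "b = (t *\<^sub>R x, t * norm x)"
        using ab by (auto simp: H_def)
      then have "a + b = ((s + t) *\<^sub>R x, (s + t) * norm x)" by (simp add: algebra_simps)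
      then show ?thesis unfolding H_def using st by (intro image_eqI[of _ _ "s + t"]) auto
    qed
    show "t *\<^sub>R a \<in> H" if at: "a \<in> H" "t > 0" for a and t :: real
    proof -
      obtain s where s: "s \<ge> 0" "a = (s *\<^sub>R x, s * norm x)" using at by (auto simp: H_def)
      then have "t *\<^sub>R a = ((t * s) *\<^sub>R x, (t * s) * norm x)" by simp
      then show ?thesis unfolding H_def using s at by (intro image_eqI[of _ _ "t * s"]) auto
    qed
    show "r \<le> norm k" if "(k, r) \<in> H" for k r using that by (auto simp: H_def)
  qed blast
  have "(x, norm x) \<in> H" unfolding H_def by (intro image_eqI[of _ _ 1]) auto
  then have "L x = norm x" using L(2)[of x] L(3) by force
  moreover have "\<bar>L z\<bar> \<le> norm z" for z
    using L(2)[of z] L(2)[of "- z"] linear_neg[OF L(1), of z] by simp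
  ultimately show ?thesis using that L(1) by blast
qed

text \<open>Makes tuples \<open>nat \<Rightarrow> 'a\<close> a real vector space, so that the
  sandwich theorem, which asks for no topology, applies to pairs of tuples.\<close>

instantiation "fun" :: (type, real_vector) real_vector
begin
definition scaleR_fun_def: "r *\<^sub>R f = (\<lambda>x. r *\<^sub>R f x)"
instance by standard (auto simp: scaleR_fun_def plus_fun_def algebra_simps)
end


subsection \<open>Linearised extremal tuples\<close>

text \<open>Each iterate nearly minimises \<open>F\<close> over the points reachable from the
  previous one. The last hypothesis bundles completeness with lower semicontinuity: a sequence whose
  distances are dominated by its decrease in \<open>F\<close> has a limit that inherits the
  domination. The factor in front of the distance is absorbed into \<open>d\<close>.\<close>

lemma ekeland_variational_principle:
  fixes F :: "'s \<Rightarrow> real" and d :: "'s \<Rightarrow> 's \<Rightarrow> real"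
  assumes x0: "x0 \<in> S" and lb: "\<And>x. x \<in> S \<Longrightarrow> b \<le> F x"
    and d_nonneg: "\<And>x y. 0 \<le> d x y" and d_refl: "\<And>x. d x x = 0"
    and tri: "\<And>x y z. d x z \<le> d x y + d y z"
    and complete: "\<And>\<sigma> :: nat \<Rightarrow> 's. (\<And>k. \<sigma> k \<in> S) \<Longrightarrow>
        (\<And>k m. k \<le> m \<Longrightarrow> d (\<sigma> k) (\<sigma> m) \<le> F (\<sigma> k) - F (\<sigma> m)) \<Longrightarrow>
        \<exists>y\<in>S. \<forall>k. d (\<sigma> k) y \<le> F (\<sigma> k) - F y"
  obtains y where "y \<in> S" "F y + d x0 y \<le> F x0" "\<And>z. z \<in> S \<Longrightarrow> F y \<le> F z + d y z"
proof -
  define R where "R x = {z \<in> S. F z + d x z \<le> F x}" for x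
  have step: "\<exists>y. y \<in> R x \<and> (\<forall>z\<in>R x. F y \<le> F z + (1/2)^k)" if x: "x \<in> S" for x and k :: nat
  proof -
    have xR: "x \<in> R x" using x d_refl by (simp add: R_def)
    have bdd: "bdd_below (F ` R x)" by (rule bdd_belowI2[of _ b]) (auto simp: R_def lb)
    have "(INF z\<in>R x. F z) < (INF z\<in>R x. F z) + (1/2)^k" by simp
    then obtain y where y: "y \<in> R x" "F y < (INF z\<in>R x. F z) + (1/2)^k"
      using cINF_less_iff[OF _ bdd] xR by blast
    have "F y \<le> F z + (1/2)^k" if "z \<in> R x" for z using y cINF_lower[OF bdd that] by linarith
    then show ?thesis using y by blast
  qed
  have "\<exists>\<sigma>. \<forall>k. (\<sigma> k \<in> S \<and> (k = 0 \<longrightarrow> \<sigma> k = x0)) \<and>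
      (\<sigma> (Suc k) \<in> R (\<sigma> k) \<and> (\<forall>z\<in>R (\<sigma> k). F (\<sigma> (Suc k)) \<le> F z + (1/2)^k))"
  proof (rule dependent_nat_choice)
    show "\<exists>x. x \<in> S \<and> (0 = (0::nat) \<longrightarrow> x = x0)" using x0 by blast
    show "\<exists>y. (y \<in> S \<and> (Suc k = 0 \<longrightarrow> y = x0)) \<and> y \<in> R x \<and> (\<forall>z\<in>R x. F y \<le> F z + (1/2)^k)"
      if "x \<in> S \<and> (k = 0 \<longrightarrow> x = x0)" for x k
      using step[of x k] that unfolding R_def by blast
  qed
  then obtain \<sigma> where \<sigma>: "\<And>k. \<sigma> k \<in> S" "\<sigma> 0 = x0" "\<And>k. \<sigma> (Suc k) \<in> R (\<sigma> k)"
    "\<And>k z. z \<in> R (\<sigma> k) \<Longrightarrow> F (\<sigma> (Suc k)) \<le> F z + (1/2)^k" by blast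
  have chain: "d (\<sigma> k) (\<sigma> m) \<le> F (\<sigma> k) - F (\<sigma> m)" if "k \<le> m" for k m
    using that
  proof (induction m rule: dec_induct)
    case (step m)
    have "d (\<sigma> m) (\<sigma> (Suc m)) \<le> F (\<sigma> m) - F (\<sigma> (Suc m))" using \<sigma>(3)[of m] by (simp add: R_def)
    then show ?case using step tri[of "\<sigma> k" "\<sigma> (Suc m)" "\<sigma> m"] by linarith
  qed (simp add: d_refl)
  obtain y where y: "y \<in> S" "\<And>k. d (\<sigma> k) y \<le> F (\<sigma> k) - F y"
    using complete[of \<sigma>, OF \<sigma>(1) chain] by blast
  have "F y \<le> F z + d y z" if z: "z \<in> S" for z
  proof (rule ccontr)
    assume less: "\<not> F y \<le> F z + d y z"
    \<comment> \<open>A point violating minimality at \<open>y\<close> is, by the triangle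
      inequality, reachable from every iterate, so it competed in every choice and
      \<open>F y \<le> F z\<close> follows.\<close>
    have zR: "z \<in> R (\<sigma> k)" for k using y(2)[of k] tri[of "\<sigma> k" z y] less z by (simp add: R_def)
    have "F y \<le> F z + (1/2)^k" for k
      using \<sigma>(4)[OF zR, of k] y(2)[of "Suc k"] d_nonneg[of "\<sigma> (Suc k)" y] by linarith
    moreover have "(\<lambda>k. F z + (1/2)^k) \<longlonglongrightarrow> F z + 0"
      by (intro tendsto_intros LIMSEQ_power_zero) auto
    ultimately have "F y \<le> F z" by (metis LIMSEQ_le_const add.right_neutral)
    then show False using less d_nonneg[of y z] by linarith
  qed
  then show ?thesis using that[of y] y \<sigma>(2) by (metis add.commute le_diff_eq)
qed

section \<open>The weighted maximum seminorm on tuples and Lipschitz bounds for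
  \<open>max_dist\<close>\<close>

definition wmax :: "nat \<Rightarrow> (nat \<Rightarrow> real) \<Rightarrow> (nat \<Rightarrow> 'a::real_normed_vector) \<Rightarrow> real" where
  "wmax n r u = Max ((\<lambda>i. norm (u i) / r i) ` {1..n})"

lemma wmax_le_iff:
  assumes "n \<ge> 1" "\<forall>i. r i > 0"
  shows "wmax n r u \<le> c \<longleftrightarrow> (\<forall>i\<in>{1..n}. norm (u i) \<le> c * r i)"
proof -
  have "wmax n r u \<le> c \<longleftrightarrow> (\<forall>i\<in>{1..n}. norm (u i) / r i \<le> c)"
    unfolding wmax_def using assms(1) by (subst Max_le_iff) auto
  then show ?thesis using assms(2) by (simp add: pos_divide_le_eq)
qed

lemma wmax_less_iff:
  assumes "n \<ge> 1" "\<forall>i. r i > 0"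
  shows "wmax n r u < c \<longleftrightarrow> (\<forall>i\<in>{1..n}. norm (u i) < c * r i)"
proof -
  have "wmax n r u < c \<longleftrightarrow> (\<forall>i\<in>{1..n}. norm (u i) / r i < c)"
    unfolding wmax_def using assms(1) by (subst Max_less_iff) auto
  then show ?thesis using assms(2) by (simp add: pos_divide_less_eq)
qed

lemma norm_le_wmax:
  assumes "\<forall>i. r i > 0" "i \<in> {1..n}"
  shows "norm (u i) \<le> wmax n r u * r i"
proof -
  have "n \<ge> 1" using assms(2) by simp
  then show ?thesis using wmax_le_iff[of n r u "wmax n r u"] assms by blast
qed

lemma wmax_nonneg:
  assumes "n \<ge> 1" "\<forall>i. r i > 0"
  shows "0 \<le> wmax n r u"
proof -
  have "0 \<le> wmax n r u * r n" using norm_le_wmax[OF assms(2), of n n u] norm_ge_zero[of "u n"] assms(1) by (simp del: norm_ge_zero)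
  then show ?thesis using assms(2) by (simp add: zero_le_mult_iff) (meson not_le)
qed

lemma wmax_triangle:
  assumes "n \<ge> 1" "\<forall>i. r i > 0"
  shows "wmax n r (\<lambda>i. u i + v i) \<le> wmax n r u + wmax n r v"
  unfolding wmax_le_iff[OF assms]
proof
  fix i assume i: "i \<in> {1..n}"
  show "norm (u i + v i) \<le> (wmax n r u + wmax n r v) * r i"
    using norm_triangle_ineq[of "u i" "v i"] norm_le_wmax[OF assms(2) i, of u]
      norm_le_wmax[OF assms(2) i, of v] by (simp add: algebra_simps)
qed

lemma wmax_scale:
  assumes "n \<ge> 1" "\<forall>i. r i > 0" "t \<ge> 0"
  shows "wmax n r (\<lambda>i. t *\<^sub>R u i) \<le> t * wmax n r u"
  unfolding wmax_le_iff[OF assms(1,2)]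
proof
  fix i assume "i \<in> {1..n}"
  then have "t * norm (u i) \<le> t * (wmax n r u * r i)"
    using norm_le_wmax[OF assms(2)] assms(3) by (intro mult_left_mono) auto
  then show "norm (t *\<^sub>R u i) \<le> t * wmax n r u * r i" using assms(3) by (simp add: mult.assoc)
qed

lemma wmax_zero: "n \<ge> 1 \<Longrightarrow> wmax n r (\<lambda>i. 0) = 0"
  unfolding wmax_def by (auto simp: image_constant_conv)

lemma max_dist_le_iff:
  assumes "n \<ge> 2"
  shows "max_dist n u \<le> c \<longleftrightarrow> (\<forall>i\<in>{1..n-1}. norm (u n - u i) \<le> c)"
  unfolding max_dist_def using assms by (subst Max_le_iff) auto

lemma norm_le_max_dist:
  assumes "i \<in> {1..n-1}"
  shows "norm (u n - u i) \<le> max_dist n u"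
  unfolding max_dist_def using assms by (intro Max_ge) auto

lemma max_dist_nonneg:
  assumes "n \<ge> 2" shows "0 \<le> max_dist n u"
proof -
  have "norm (u n - u 1) \<le> max_dist n u" using assms by (intro norm_le_max_dist) auto
  then show ?thesis using norm_ge_zero[of "u n - u 1"] by linarith
qed

text \<open>The difference with index \<open>i\<close> changes by at most \<open>r i + r n\<close>
  times the seminorm; the full sum of the weights is a constant that serves every
  \<open>i\<close>.\<close>

lemma max_dist_lipschitz:
  assumes "n \<ge> 2" "\<forall>i. r i > 0"
  shows "max_dist n u \<le> max_dist n v + (\<Sum>i=1..n. r i) * wmax n r (\<lambda>i. u i - v i)"
  unfolding max_dist_le_iff[OF assms(1)]
proof
  fix i assume i: "i \<in> {1..n-1}"
  let ?p = "wmax n r (\<lambda>i. u i - v i)"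
  have "{i, n} \<subseteq> {1..n}" using i by auto
  then have "(\<Sum>j\<in>{i,n}. r j) \<le> (\<Sum>j=1..n. r j)"
    using assms(2) by (intro sum_mono2) (auto simp: less_imp_le)
  moreover have "i \<noteq> n" using i by auto
  ultimately have C: "r i + r n \<le> (\<Sum>j=1..n. r j)" by simp
  have p0: "0 \<le> ?p" using assms by (intro wmax_nonneg) auto
  have "norm (u n - u i) = norm ((v n - v i) + ((u n - v n) - (u i - v i)))" by (simp add: algebra_simps)
  also have "\<dots> \<le> norm (v n - v i) + (norm (u n - v n) + norm (u i - v i))"
    by (intro order_trans[OF norm_triangle_ineq] add_left_mono norm_triangle_ineq4)
  also have "\<dots> \<le> max_dist n v + (?p * r n + ?p * r i)"
    using i assms norm_le_max_dist[OF i, of v] norm_le_wmax[of r n n "\<lambda>i. u i - v i"]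
      norm_le_wmax[of r i n "\<lambda>i. u i - v i"] by (intro add_mono) auto
  also have "\<dots> \<le> max_dist n v + (\<Sum>i=1..n. r i) * ?p"
    using mult_right_mono[OF C p0] by (simp add: algebra_simps)
  finally show "norm (u n - u i) \<le> max_dist n v + (\<Sum>i=1..n. r i) * ?p" .
qed

lemma max_dist_lipschitz_abs:
  assumes "n \<ge> 2" "\<forall>i. r i > 0"
  shows "\<bar>max_dist n u - max_dist n v\<bar> \<le> (\<Sum>i=1..n. r i) * wmax n r (\<lambda>i. u i - v i)"
proof -
  have "wmax n r (\<lambda>i. v i - u i) = wmax n r (\<lambda>i. u i - v i)" by (simp add: wmax_def norm_minus_commute)
  then show ?thesis using max_dist_lipschitz[of n r u v] max_dist_lipschitz[of n r v u] assms by simp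
qed

lemma wmax_diff_tendsto_0:
  assumes "n \<ge> 1" "\<forall>i. r i > 0" "\<And>i. i \<in> {1..n} \<Longrightarrow> (\<lambda>k. \<sigma> k i) \<longlonglongrightarrow> y i"
  shows "(\<lambda>k. wmax n r (\<lambda>i. \<sigma> k i - y i)) \<longlonglongrightarrow> 0"
proof (rule tendstoI)
  fix e :: real assume e: "e > 0"
  have "\<forall>\<^sub>F k in sequentially. norm (\<sigma> k i - y i) < e * r i" if "i \<in> {1..n}" for i
    using tendstoD[OF assms(3)[OF that], of "e * r i"] e assms(2) by (simp add: dist_norm)
  then have "\<forall>\<^sub>F k in sequentially. \<forall>i\<in>{1..n}. norm (\<sigma> k i - y i) < e * r i"
    by (simp add: eventually_ball_finite)
  then show "\<forall>\<^sub>F k in sequentially. dist (wmax n r (\<lambda>i. \<sigma> k i - y i)) 0 < e"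
    proof eventually_elim
    case (elim k)
    then have "wmax n r (\<lambda>i. \<sigma> k i - y i) < e" by (simp only: wmax_less_iff[OF assms(1,2)])
    then show ?case using wmax_nonneg[OF assms(1,2), of "\<lambda>i. \<sigma> k i - y i"] by simp
  qed
qed

lemma max_dist_tendsto:
  assumes "n \<ge> 2" "\<And>i. i \<in> {1..n} \<Longrightarrow> (\<lambda>k. \<sigma> k i) \<longlonglongrightarrow> y i"
  shows "(\<lambda>k. max_dist n (\<sigma> k)) \<longlonglongrightarrow> max_dist n y"
proof -
  have "(\<lambda>k. real n * wmax n (\<lambda>_. 1) (\<lambda>i. \<sigma> k i - y i)) \<longlonglongrightarrow> real n * 0"
    using assms by (intro tendsto_mult_left wmax_diff_tendsto_0) auto
  then have lim: "(\<lambda>k. real n * wmax n (\<lambda>_. 1) (\<lambda>i. \<sigma> k i - y i)) \<longlonglongrightarrow> 0" by simp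
  have "norm (max_dist n (\<sigma> k) - max_dist n y) \<le> real n * wmax n (\<lambda>_. 1) (\<lambda>i. \<sigma> k i - y i)" for k
    using max_dist_lipschitz_abs[OF assms(1), of "\<lambda>_. 1" "\<sigma> k" y] by simp
  then have "(\<lambda>k. max_dist n (\<sigma> k) - max_dist n y) \<longlonglongrightarrow> 0"
    by (intro Lim_null_comparison[OF always_eventually lim]) blast
  then show ?thesis by (simp add: LIM_zero_iff)
qed

text \<open>\<open>b\<close> may be any nonnegative lower bound of \<open>max_dist\<close> on the
  product, not only its infimum. This allows sets \<open>W i\<close> smaller than those for which
  the distance was computed.\<close>

lemma extremal_pair_exists:
  fixes W :: "nat \<Rightarrow> 'a::banach set"
  assumes n: "n \<ge> 2" and W: "\<And>i. i \<in> {1..n} \<Longrightarrow> closed (W i)"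
    and \<omega>: "\<And>i. i \<in> {1..n} \<Longrightarrow> \<omega> i \<in> W i"
    and \<phi>: "\<phi> \<in> class_C1" and empty: "(\<Inter>i\<in>{1..n}. W i) = {}"
    and b: "0 \<le> b" "\<And>u. (\<And>i. i \<in> {1..n} \<Longrightarrow> u i \<in> W i) \<Longrightarrow> b \<le> max_dist n u"
    and less: "\<phi> (max_dist n \<omega>) < \<phi> b + \<epsilon>"
    and r: "\<forall>i. r i > 0"
  obtains w e \<rho> where "\<And>i. i \<in> {1..n} \<Longrightarrow> w i \<in> W i" "wmax n r (\<lambda>i. w i - \<omega> i) < 1"
    "max_dist n w \<le> max_dist n \<omega>" "0 < max_dist n w" "0 < e" "e < \<epsilon>" "0 < \<rho>"
    "\<And>u. (\<And>i. i \<in> {1..n} \<Longrightarrow> u i \<in> W i) \<Longrightarrow> wmax n r (\<lambda>i. u i - w i) \<le> \<rho> \<Longrightarrow>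
       deriv \<phi> (max_dist n w) * max_dist n w \<le>
       deriv \<phi> (max_dist n w) * max_dist n u + e * wmax n r (\<lambda>i. u i - w i)"
proof -
  define S where "S = {u. \<forall>i\<in>{1..n}. u i \<in> W i}"
  let ?g = "max_dist n" and ?C = "\<Sum>i=1..n. r i"
  have n1: "n \<ge> 1" using n by simp
  have mono: "\<phi> s < \<phi> t" if "0 \<le> s" "s < t" for s t
    using \<phi> that by (auto simp: class_C1_def strict_mono_on_def)
  have cont: "continuous_on {0..} \<phi>" using \<phi> by (simp add: class_C1_def)
  have g0: "0 \<le> ?g u" for u :: "nat \<Rightarrow> 'a" by (rule max_dist_nonneg[OF n])
  have C0: "?C > 0" using r n by (intro sum_pos) auto
  have mono_le: "\<phi> s \<le> \<phi> t" if "0 \<le> s" "s \<le> t" for s t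
    using mono[of s t] that by (cases "s = t") auto
  have "b \<le> ?g \<omega>" using b(2) \<omega> by blast
  then have "\<phi> b \<le> \<phi> (?g \<omega>)" using b(1) by (rule mono_le[rotated])
  \<comment> \<open>The midpoint between the gap \<open>\<phi> (?g \<omega>) - \<phi> b\<close> and
    \<open>\<epsilon>\<close>: exceeding the gap keeps the Ekeland point at
    \<open>wmax\<close>-distance less than 1 from \<open>\<omega>\<close>, and staying below
    \<open>\<epsilon>\<close> leaves room for the linearisation.\<close>
  define e0 where "e0 = (\<phi> (?g \<omega>) - \<phi> b + \<epsilon>) / 2"
  have e0: "0 < e0" "\<phi> (?g \<omega>) - \<phi> b < e0" "e0 < \<epsilon>" using \<open>\<phi> b \<le> \<phi> (?g \<omega>)\<close> less by (simp_all add: e0_def field_simps)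
  obtain w where w: "w \<in> S" "\<phi> (?g w) + e0 * wmax n r (\<lambda>i. \<omega> i - w i) \<le> \<phi> (?g \<omega>)"
    "\<And>z. z \<in> S \<Longrightarrow> \<phi> (?g w) \<le> \<phi> (?g z) + e0 * wmax n r (\<lambda>i. w i - z i)"
  proof (rule ekeland_variational_principle[where F = "\<lambda>u. \<phi> (?g u)" and
      d = "\<lambda>u v. e0 * wmax n r (\<lambda>i. u i - v i)" and S = S and b = "\<phi> b" and ?x0.0 = \<omega>])
    show "\<omega> \<in> S" using \<omega> by (simp add: S_def)
    show "\<phi> b \<le> \<phi> (?g u)" if "u \<in> S" for u using that b by (intro mono_le) (auto simp: S_def)
    show "0 \<le> e0 * wmax n r (\<lambda>i. u i - v i)" for u v :: "nat \<Rightarrow> 'a"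
      using e0 by (simp add: wmax_nonneg[OF n1 r])
    show "e0 * wmax n r (\<lambda>i. u i - u i) = 0" for u :: "nat \<Rightarrow> 'a" by (simp add: wmax_zero[OF n1])
    show "e0 * wmax n r (\<lambda>i. u i - v i) \<le> e0 * wmax n r (\<lambda>i. u i - z i) + e0 * wmax n r (\<lambda>i. z i - v i)"
      for u v z :: "nat \<Rightarrow> 'a"
    proof -
      have "wmax n r (\<lambda>i. u i - v i) \<le> wmax n r (\<lambda>i. u i - z i) + wmax n r (\<lambda>i. z i - v i)"
        using wmax_triangle[OF n1 r, where u = "\<lambda>i. u i - z i" and v = "\<lambda>i. z i - v i"] by simp
      then show ?thesis using e0 by (metis distrib_left mult_le_cancel_left_pos)
    qed
    fix \<sigma> :: "nat \<Rightarrow> nat \<Rightarrow> 'a" assume \<sigma>: "\<And>k. \<sigma> k \<in> S" and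
      dec: "\<And>k m. k \<le> m \<Longrightarrow> e0 * wmax n r (\<lambda>i. \<sigma> k i - \<sigma> m i) \<le> \<phi> (?g (\<sigma> k)) - \<phi> (?g (\<sigma> m))"
    have "decseq (\<lambda>k. \<phi> (?g (\<sigma> k)))"
      unfolding decseq_def
    proof (intro allI impI)
      fix k m :: nat assume "k \<le> m"
      from dec[OF this] show "\<phi> (?g (\<sigma> m)) \<le> \<phi> (?g (\<sigma> k))"
        using wmax_nonneg[OF n1 r, of "\<lambda>i. \<sigma> k i - \<sigma> m i"] e0 by (smt (verit) mult_nonneg_nonneg)
    qed
    moreover have "\<phi> b \<le> \<phi> (?g (\<sigma> k))" for k using \<sigma> b by (intro mono_le) (auto simp: S_def)
    ultimately obtain l where l: "(\<lambda>k. \<phi> (?g (\<sigma> k))) \<longlonglongrightarrow> l" using decseq_convergent by blast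
    have coord: "norm (\<sigma> k i - \<sigma> m i) \<le> (\<phi> (?g (\<sigma> k)) - \<phi> (?g (\<sigma> m))) / e0 * r i" if "k \<le> m" "i \<in> {1..n}" for k m i
    proof -
      have "wmax n r (\<lambda>i. \<sigma> k i - \<sigma> m i) \<le> (\<phi> (?g (\<sigma> k)) - \<phi> (?g (\<sigma> m))) / e0"
        using dec[OF that(1)] e0 by (simp add: field_simps)
      then show ?thesis using that(2) unfolding wmax_le_iff[OF n1 r] by blast
    qed
    have "\<exists>y. (\<lambda>k. \<sigma> k i) \<longlonglongrightarrow> y" if i: "i \<in> {1..n}" for i
    proof -
      have "Cauchy (\<lambda>k. \<phi> (?g (\<sigma> k)))" using l by (rule LIMSEQ_imp_Cauchy)
      have "Cauchy (\<lambda>k. \<sigma> k i)"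
      proof (rule CauchyI')
        fix e :: real assume e: "e > 0"
        then have "e * e0 / r i > 0" using r e0 by simp
        then obtain M where M: "\<And>k m. k \<ge> M \<Longrightarrow> m \<ge> M \<Longrightarrow> \<bar>\<phi> (?g (\<sigma> k)) - \<phi> (?g (\<sigma> m))\<bar> < e * e0 / r i"
          using \<open>Cauchy (\<lambda>k. \<phi> (?g (\<sigma> k)))\<close> unfolding Cauchy_def dist_real_def by blast
        show "\<exists>M. \<forall>m\<ge>M. \<forall>n>m. dist (\<sigma> m i) (\<sigma> n i) < e"
        proof (intro exI allI impI)
          fix k m assume km: "M \<le> k" "k < m"
          have "norm (\<sigma> k i - \<sigma> m i) \<le> (\<phi> (?g (\<sigma> k)) - \<phi> (?g (\<sigma> m))) / e0 * r i"
            using coord km i by simp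
          also have "\<dots> < (e * e0 / r i) / e0 * r i"
            using M[of k m] km r e0 by (intro mult_strict_right_mono divide_strict_right_mono) auto
          also have "\<dots> = e" using r e0 by (simp add: less_imp_neq[symmetric])
          finally show "dist (\<sigma> k i) (\<sigma> m i) < e" by (simp add: dist_norm)
        qed
      qed
      then show ?thesis using Cauchy_convergent convergentD by blast
    qed
    then have "\<forall>i. \<exists>y. i \<in> {1..n} \<longrightarrow> (\<lambda>k. \<sigma> k i) \<longlonglongrightarrow> y" by blast
    then obtain y where y: "\<And>i. i \<in> {1..n} \<Longrightarrow> (\<lambda>k. \<sigma> k i) \<longlonglongrightarrow> y i" by metis
    have "y i \<in> W i" if i: "i \<in> {1..n}" for i
    proof (rule closed_sequentially[OF W[OF i] _ y[OF i]])
      show "\<sigma> k i \<in> W i" for k using \<sigma>[of k] i by (simp add: S_def)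
    qed
    then have yS: "y \<in> S" by (simp add: S_def)
    have gy: "(\<lambda>k. \<phi> (?g (\<sigma> k))) \<longlonglongrightarrow> \<phi> (?g y)"
      by (rule continuous_on_tendsto_compose[OF cont max_dist_tendsto[OF n y]]) (auto simp: g0)
    have "e0 * wmax n r (\<lambda>i. \<sigma> k i - y i) \<le> \<phi> (?g (\<sigma> k)) - \<phi> (?g y)" for k
    proof -
      have "norm (\<sigma> k i - y i) \<le> (\<phi> (?g (\<sigma> k)) - \<phi> (?g y)) / e0 * r i" if i: "i \<in> {1..n}" for i
      proof (rule tendsto_le[OF sequentially_bot])
        show "(\<lambda>m. norm (\<sigma> k i - \<sigma> m i)) \<longlonglongrightarrow> norm (\<sigma> k i - y i)" by (intro tendsto_intros y i)
        show "(\<lambda>m. (\<phi> (?g (\<sigma> k)) - \<phi> (?g (\<sigma> m))) / e0 * r i) \<longlonglongrightarrow> (\<phi> (?g (\<sigma> k)) - \<phi> (?g y)) / e0 * r i"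
          using e0 by (intro tendsto_intros gy) auto
        show "\<forall>\<^sub>F m in sequentially. norm (\<sigma> k i - \<sigma> m i) \<le> (\<phi> (?g (\<sigma> k)) - \<phi> (?g (\<sigma> m))) / e0 * r i"
          using eventually_ge_at_top[of k] by eventually_elim (use coord i in auto)
      qed
      then have "wmax n r (\<lambda>i. \<sigma> k i - y i) \<le> (\<phi> (?g (\<sigma> k)) - \<phi> (?g y)) / e0"
        unfolding wmax_le_iff[OF n1 r] by blast
      then show ?thesis using e0 by (simp add: field_simps)
    qed
    then show "\<exists>y\<in>S. \<forall>k. e0 * wmax n r (\<lambda>i. \<sigma> k i - y i) \<le> \<phi> (?g (\<sigma> k)) - \<phi> (?g y)" using yS by blast
  qed blast
  have sym: "wmax n r (\<lambda>i. u i - v i) = wmax n r (\<lambda>i. v i - u i)" for u v :: "nat \<Rightarrow> 'a"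
    by (simp add: wmax_def norm_minus_commute)
  have "\<phi> b \<le> \<phi> (?g w)" using w(1) b by (intro mono_le) (auto simp: S_def)
  then have "e0 * wmax n r (\<lambda>i. \<omega> i - w i) < e0 * 1" using w(2) e0(2) by linarith
  then have w1: "wmax n r (\<lambda>i. w i - \<omega> i) < 1" using e0 sym by (metis mult_less_cancel_left_pos)
  have "0 \<le> e0 * wmax n r (\<lambda>i. \<omega> i - w i)" using e0 by (simp add: wmax_nonneg[OF n1 r])
  then have wle: "?g w \<le> ?g \<omega>" using w(2) mono[of "?g \<omega>" "?g w"] g0 by force
  \<comment> \<open>\<open>max_dist n w = 0\<close> would make all \<open>w i\<close> equal, giving
    a common point of the sets. Positivity is what makes \<open>\<phi>\<close> differentiable at
    \<open>max_dist n w\<close>.\<close>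
  have wpos: "0 < ?g w"
  proof (rule ccontr)
    assume "\<not> 0 < ?g w"
    then have "?g w \<le> 0" by simp
    then have "\<forall>i\<in>{1..n-1}. w i = w n" unfolding max_dist_le_iff[OF n] by simp
    then have "w n \<in> W i" if "i \<in> {1..n}" for i
      using w(1) that n by (cases "i = n") (auto simp: S_def Ball_def)
    then show False using empty by blast
  qed
  define M where "M = ?g w"
  define c where "c = deriv \<phi> M"
  \<comment> \<open>The admissible linearisation error per unit of change in \<open>?g\<close>. As
    \<open>?g\<close> changes by at most \<open>?C\<close> times the displacement,
    \<open>k * ?C = e - e0\<close> is exactly what the slope of the penalty gains.\<close>
  define k where "k = (\<epsilon> - e0) / (2 * ?C)"
  define e where "e = (e0 + \<epsilon>) / 2"
  have k0: "k > 0" "k * ?C = e - e0" using e0 C0 by (auto simp: k_def e_def field_simps)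
  have "(\<phi> has_real_derivative c) (at M)"
    using \<phi> wpos unfolding c_def M_def class_C1_def by (auto intro!: DERIV_deriv_iff_real_differentiable[THEN iffD2])
  then have "(\<phi> has_derivative (\<lambda>h. c * h)) (at M)" by (simp add: has_field_derivative_def mult_commute_abs)
  then obtain \<delta> where \<delta>: "\<delta> > 0" "\<And>t. norm (t - M) < \<delta> \<Longrightarrow> norm (\<phi> t - \<phi> M - c * (t - M)) \<le> k * norm (t - M)"
    using k0 unfolding has_derivative_at_alt by blast
  show ?thesis
  proof (rule that[of w e "\<delta> / (2 * ?C)"])
    show "\<And>i. i \<in> {1..n} \<Longrightarrow> w i \<in> W i" using w(1) by (simp add: S_def)
    show "0 < e" "e < \<epsilon>" using e0 by (auto simp: e_def)
    show "0 < \<delta> / (2 * ?C)" using \<delta> C0 by simp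
    fix u assume u: "\<And>i. i \<in> {1..n} \<Longrightarrow> u i \<in> W i" and near: "wmax n r (\<lambda>i. u i - w i) \<le> \<delta> / (2 * ?C)"
    let ?p = "wmax n r (\<lambda>i. u i - w i)"
    have lip: "\<bar>?g u - M\<bar> \<le> ?C * ?p" unfolding M_def using max_dist_lipschitz_abs[OF n r] .
    also have "\<dots> \<le> \<delta> / 2" using mult_left_mono[OF near, of ?C] C0 by simp
    finally have "norm (?g u - M) < \<delta>" using \<delta>(1) by simp
    then have "\<phi> (?g u) \<le> \<phi> M + c * (?g u - M) + k * \<bar>?g u - M\<bar>" using \<delta>(2)[of "?g u"] by simp
    moreover have "k * \<bar>?g u - M\<bar> \<le> (e - e0) * ?p"
      unfolding k0(2)[symmetric] mult.assoc by (rule mult_left_mono[OF lip]) (use k0 in simp)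
    moreover have "\<phi> M \<le> \<phi> (?g u) + e0 * ?p" using w(3)[of u] u sym[of w u] by (simp add: S_def M_def)
    ultimately show "deriv \<phi> (?g w) * ?g w \<le> deriv \<phi> (?g w) * ?g u + e * ?p"
      unfolding M_def[symmetric] c_def[symmetric] by (simp add: algebra_simps)
  qed (use w1 wle wpos in auto)
qed


subsection \<open>Multipliers in the Clarke normal cones\<close>

lemma clarke_tangent_cone_zero: "0 \<in> clarke_tangent_cone S x"
  unfolding clarke_tangent_cone_def by (auto intro!: exI[of _ "\<lambda>_. 0"])

text \<open>The definition quantifies over all base sequences in the set. Hence the points reached
  with directions tending to \<open>a\<close> serve as base points for the directions tending to
  \<open>b\<close>.\<close>

lemma clarke_tangent_cone_add:
  assumes "a \<in> clarke_tangent_cone S x" "b \<in> clarke_tangent_cone S x"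
  shows "a + b \<in> clarke_tangent_cone S x"
  unfolding clarke_tangent_cone_def
proof (intro CollectI allI impI)
  fix \<sigma> :: "nat \<Rightarrow> 'a" and t :: "nat \<Rightarrow> real"
  assume h: "(\<forall>k. \<sigma> k \<in> S) \<and> \<sigma> \<longlonglongrightarrow> x \<and> (\<forall>k. t k > 0) \<and> t \<longlonglongrightarrow> 0"
  then obtain y where y: "y \<longlonglongrightarrow> a" "\<And>k. \<sigma> k + t k *\<^sub>R y k \<in> S"
    using assms(1) unfolding clarke_tangent_cone_def by blast
  have "(\<lambda>k. \<sigma> k + t k *\<^sub>R y k) \<longlonglongrightarrow> x + 0 *\<^sub>R a" using h y by (intro tendsto_intros) auto
  then have "(\<lambda>k. \<sigma> k + t k *\<^sub>R y k) \<longlonglongrightarrow> x" by simp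
  then obtain z where z: "z \<longlonglongrightarrow> b" "\<And>k. (\<sigma> k + t k *\<^sub>R y k) + t k *\<^sub>R z k \<in> S"
    using assms(2) h y(2) unfolding clarke_tangent_cone_def
    by (smt (verit, del_insts) mem_Collect_eq)
  have "(\<lambda>k. y k + z k) \<longlonglongrightarrow> a + b" using y z by (intro tendsto_intros)
  moreover have "\<sigma> k + t k *\<^sub>R (y k + z k) \<in> S" for k using z(2)[of k] by (simp add: algebra_simps)
  ultimately show "\<exists>y. y \<longlonglongrightarrow> a + b \<and> (\<forall>k. \<sigma> k + t k *\<^sub>R y k \<in> S)" by blast
qed

lemma clarke_tangent_cone_scale:
  assumes a: "a \<in> clarke_tangent_cone S x" and s: "s > 0"
  shows "s *\<^sub>R a \<in> clarke_tangent_cone S x"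
  unfolding clarke_tangent_cone_def
proof (intro CollectI allI impI)
  fix \<sigma> :: "nat \<Rightarrow> 'a" and t :: "nat \<Rightarrow> real"
  assume h: "(\<forall>k. \<sigma> k \<in> S) \<and> \<sigma> \<longlonglongrightarrow> x \<and> (\<forall>k. t k > 0) \<and> t \<longlonglongrightarrow> 0"
  have "(\<lambda>k. t k * s) \<longlonglongrightarrow> 0 * s" using h by (intro tendsto_intros) auto
  then obtain y where y: "y \<longlonglongrightarrow> a" "\<And>k. \<sigma> k + (t k * s) *\<^sub>R y k \<in> S"
    using a h s unfolding clarke_tangent_cone_def
    by (auto dest!: spec[of _ \<sigma>] spec[of _ "\<lambda>k. t k * s"])
  have "(\<lambda>k. s *\<^sub>R y k) \<longlonglongrightarrow> s *\<^sub>R a" using y by (intro tendsto_intros)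
  then show "\<exists>y. y \<longlonglongrightarrow> s *\<^sub>R a \<and> (\<forall>k. \<sigma> k + t k *\<^sub>R y k \<in> S)"
    using y(2) by (intro exI[of _ "\<lambda>k. s *\<^sub>R y k"]) auto
qed

lemma norm_pos_attain:
  fixes f :: "'a::real_normed_vector \<Rightarrow>\<^sub>L real"
  assumes "e > 0"
  obtains x where "norm x \<le> 1" "norm f - e < blinfun_apply f x"
proof -
  have "\<exists>x. norm x \<le> 1 \<and> norm f - e < blinfun_apply f x"
  proof (rule ccontr)
    assume neg: "\<nexists>x. norm x \<le> 1 \<and> norm f - e < blinfun_apply f x"
    have ub: "blinfun_apply f x \<le> norm f - e" if "norm x \<le> 1" for x using neg that by force
    then have nn: "0 \<le> norm f - e" using ub[of 0] by (simp add: blinfun.zero_right)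
    have "norm (blinfun_apply f x) \<le> (norm f - e) * norm x" for x
    proof (cases "x = 0")
      case False
      have "blinfun_apply f (x /\<^sub>R norm x) \<le> norm f - e" "blinfun_apply f (- (x /\<^sub>R norm x)) \<le> norm f - e"
        using ub[of "x /\<^sub>R norm x"] ub[of "- (x /\<^sub>R norm x)"] False by auto
      then show ?thesis using False by (auto simp: blinfun.scaleR_right blinfun.minus_right field_simps abs_le_iff)
    qed (simp add: blinfun.zero_right)
    then have "norm f \<le> norm f - e" using nn by (intro norm_blinfun_bound) auto
    then show False using assms by simp
  qed
  then show ?thesis using that by blast
qed

text \<open>The dual of a weighted maximum of norms is the weighted sum of dual norms. The proof
  tests with \<open>r i\<close> times a nearly norming vector in each coordinate.\<close>

lemma weighted_norm_sum_le:
  fixes f :: "'i \<Rightarrow> 'a::real_normed_vector \<Rightarrow>\<^sub>L real"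
  assumes fin: "finite I" and r: "\<And>i. i \<in> I \<Longrightarrow> 0 \<le> r i"
    and le: "\<And>x. (\<And>i. i \<in> I \<Longrightarrow> norm (x i) \<le> r i) \<Longrightarrow> (\<Sum>i\<in>I. blinfun_apply (f i) (x i)) \<le> c"
  shows "(\<Sum>i\<in>I. r i * norm (f i)) \<le> c"
proof (rule field_le_epsilon)
  fix e :: real assume e: "e > 0"
  \<comment> \<open>The summand 1 keeps \<open>R\<close> positive even when all weights
    vanish.\<close>
  define R where "R = (\<Sum>i\<in>I. r i) + 1"
  have "R > 0" using r by (simp add: R_def add_nonneg_pos sum_nonneg)
  then have "\<exists>x. norm x \<le> 1 \<and> norm (f i) - e / R < blinfun_apply (f i) x" for i
    using norm_pos_attain[of "e / R" "f i"] e by (metis divide_pos_pos)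
  then obtain x where x: "\<And>i. norm (x i) \<le> 1" "\<And>i. norm (f i) - e / R < blinfun_apply (f i) (x i)" by metis
  have "(\<Sum>i\<in>I. r i * norm (f i)) \<le> (\<Sum>i\<in>I. blinfun_apply (f i) (r i *\<^sub>R x i) + r i * (e / R))"
  proof (rule sum_mono)
    fix i assume "i \<in> I"
    then have "r i * norm (f i) \<le> r i * (blinfun_apply (f i) (x i) + e / R)"
      using r x(2)[of i] by (intro mult_left_mono) auto
    then show "r i * norm (f i) \<le> blinfun_apply (f i) (r i *\<^sub>R x i) + r i * (e / R)"
      by (simp add: blinfun.scaleR_right algebra_simps)
  qed
  also have "\<dots> = (\<Sum>i\<in>I. blinfun_apply (f i) (r i *\<^sub>R x i)) + (\<Sum>i\<in>I. r i) * (e / R)"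
    by (simp add: sum.distrib sum_distrib_right sum_divide_distrib)
  also have "\<dots> \<le> c + R * (e / R)"
  proof (intro add_mono le mult_right_mono)
    show "norm (r i *\<^sub>R x i) \<le> r i" if "i \<in> I" for i
      using x(1)[of i] r[OF that] by (simp add: mult_left_le)
  qed (use e \<open>R > 0\<close> in \<open>auto simp: R_def\<close>)
  finally show "(\<Sum>i\<in>I. r i * norm (f i)) \<le> c + e" using \<open>R > 0\<close> by simp
qed

text \<open>A linear functional on pairs (differences, displacements) splits into coordinates: up to
  division by \<open>c\<close>, the difference part gives \<open>v\<close> and the displacement part
  gives \<open>y\<close>. Keeping the two seminorms on separate components takes the place of a sum
  rule for subdifferentials.\<close>

lemma clarke_multipliers:
  fixes W :: "nat \<Rightarrow> 'a::real_normed_vector set"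
  assumes n: "n \<ge> 2" and r: "\<forall>i. r i > 0" and c: "c > 0" and e: "e > 0" and \<rho>: "\<rho> > 0"
    and w: "\<And>i. i \<in> {1..n} \<Longrightarrow> w i \<in> W i"
    and min: "\<And>u. (\<And>i. i \<in> {1..n} \<Longrightarrow> u i \<in> W i) \<Longrightarrow> wmax n r (\<lambda>i. u i - w i) \<le> \<rho> \<Longrightarrow>
       c * max_dist n w \<le> c * max_dist n u + e * wmax n r (\<lambda>i. u i - w i)"
    and pos: "0 < max_dist n w"
  obtains v y :: "nat \<Rightarrow> 'a \<Rightarrow>\<^sub>L real" where
    "(\<Sum>i=1..n-1. norm (v i)) = 1"
    "(\<Sum>i=1..n-1. blinfun_apply (v i) (w n - w i)) = max_dist n w"
    "c * (\<Sum>i=1..n. r i * norm (y i)) \<le> e"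
    "\<And>i. i \<in> {1..n-1} \<Longrightarrow> v i - y i \<in> clarke_normal_cone (W i) (w i)"
    "- (\<Sum>i=1..n-1. v i) - y n \<in> clarke_normal_cone (W n) (w n)"
proof -
  let ?T = "\<lambda>i. clarke_tangent_cone (W i) (w i)"
  let ?g = "max_dist n"
  have n1: "n \<ge> 1" and nn: "n \<in> {1..n}" and sub: "\<And>i. i \<in> {1..n-1} \<Longrightarrow> i \<in> {1..n} \<and> i \<noteq> n" using n by auto
  define N :: "(nat \<Rightarrow> 'a) \<Rightarrow> real" where "N v = Max ((\<lambda>i. norm (v i)) ` {1..n-1})" for v
  have gN: "?g u = N (\<lambda>i. u n - u i)" for u :: "nat \<Rightarrow> 'a" by (simp add: N_def max_dist_def)
  have Nle: "N v \<le> a \<longleftrightarrow> (\<forall>i\<in>{1..n-1}. norm (v i) \<le> a)" for v a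
    unfolding N_def using n by (subst Max_le_iff) auto
  have leN: "norm (v i) \<le> N v" if "i \<in> {1..n-1}" for v i using Nle[of v "N v"] that by blast
  have N0: "0 \<le> N v" for v
  proof -
    have "norm (v 1) \<le> N v" using n by (intro leN) auto
    then show ?thesis using norm_ge_zero[of "v 1"] by linarith
  qed
  have Nadd: "N (\<lambda>i. u i + v i) \<le> N u + N v" for u v
    unfolding Nle by (auto intro!: order_trans[OF norm_triangle_ineq] add_mono leN)
  have Nscale: "N (\<lambda>i. t *\<^sub>R u i) \<le> t * N u" if "t \<ge> 0" for t u
    unfolding Nle using that by (auto intro!: mult_left_mono leN)
  let ?p = "wmax n r :: (nat \<Rightarrow> 'a) \<Rightarrow> real"
  let ?C = "\<Sum>i=1..n. r i"
  have C0: "?C > 0" using r n by (intro sum_pos) auto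
  text \<open>Convexity turns the tangential first-order condition into a global inequality.\<close>
  have key: "c * ?g w \<le> c * ?g (\<lambda>i. w i + z i) + e * ?p z" if z: "\<And>i. i \<in> {1..n} \<Longrightarrow> z i \<in> ?T i" for z
  proof -
    \<comment> \<open>Tangency is used only for the constant base sequences \<open>w i\<close> and
      this one step sequence. The bound \<open>t k \<le> 1\<close> is there for the convex
      combination of \<open>w\<close> and \<open>w + z\<close>.\<close>
    define t :: "nat \<Rightarrow> real" where "t k = inverse (real (Suc k))" for k
    have t: "t \<longlonglongrightarrow> 0" "\<And>k. t k > 0" "\<And>k. t k \<le> 1"
      unfolding t_def using LIMSEQ_inverse_real_of_nat by (auto simp: field_simps)
    have "\<exists>y. y \<longlonglongrightarrow> z i \<and> (\<forall>k. w i + t k *\<^sub>R y k \<in> W i)" if i: "i \<in> {1..n}" for i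
    proof -
      have "(\<forall>k::nat. w i \<in> W i) \<and> (\<lambda>k::nat. w i) \<longlonglongrightarrow> w i \<and> (\<forall>k. t k > 0) \<and> t \<longlonglongrightarrow> 0"
        using w[OF i] t by simp
      then show ?thesis using z[OF i] unfolding clarke_tangent_cone_def
        by (auto dest!: spec[of _ "\<lambda>k. w i"] spec[of _ t])
    qed
    then have "\<forall>i. \<exists>y. i \<in> {1..n} \<longrightarrow> (y \<longlonglongrightarrow> z i \<and> (\<forall>k. w i + t k *\<^sub>R y k \<in> W i))" by blast
    then obtain y' where y': "\<And>i. i \<in> {1..n} \<Longrightarrow> y' i \<longlonglongrightarrow> z i" "\<And>i k. i \<in> {1..n} \<Longrightarrow> w i + t k *\<^sub>R y' i k \<in> W i" by metis
    define y where "y k i = y' i k" for k i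
    have y: "\<And>i. i \<in> {1..n} \<Longrightarrow> (\<lambda>k. y k i) \<longlonglongrightarrow> z i" "\<And>i k. i \<in> {1..n} \<Longrightarrow> w i + t k *\<^sub>R y k i \<in> W i"
      using y' by (auto simp: y_def)
    define d where "d k = ?p (\<lambda>i. y k i - z i)" for k
    have d: "d \<longlonglongrightarrow> 0" unfolding d_def by (rule wmax_diff_tendsto_0[OF n1 r y(1)])
    have py: "?p (y k) \<le> ?p z + d k" for k
      using wmax_triangle[OF n1 r, of z "\<lambda>i. y k i - z i"] by (simp add: d_def)
    have small: "\<forall>\<^sub>F k in sequentially. ?p (\<lambda>i. t k *\<^sub>R y k i) \<le> \<rho>"
    proof -
      have "(\<lambda>k. t k * (?p z + d k)) \<longlonglongrightarrow> 0 * (?p z + 0)" by (intro tendsto_intros t d)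
      then have "\<forall>\<^sub>F k in sequentially. t k * (?p z + d k) < \<rho>" using \<rho> by (intro order_tendstoD) auto
      then show ?thesis
      proof eventually_elim
        case (elim k)
        have "?p (\<lambda>i. t k *\<^sub>R y k i) \<le> t k * ?p (y k)" by (rule wmax_scale[OF n1 r]) (use t(2)[of k] in simp)
        also have "\<dots> \<le> t k * (?p z + d k)" using py[of k] t(2)[of k] by (intro mult_left_mono) auto
        finally show ?case using elim by simp
      qed
    qed
    have "\<forall>\<^sub>F k in sequentially. c * ?g w \<le> c * ?g (\<lambda>i. w i + z i) + e * ?p z + (c * ?C + e) * d k"
      using small
    proof eventually_elim
      case (elim k)
      let ?u = "\<lambda>i. w i + t k *\<^sub>R y k i"
      have tk: "t k \<ge> 0" using t(2)[of k] by simp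
      have "c * ?g w \<le> c * ?g ?u + e * ?p (\<lambda>i. t k *\<^sub>R y k i)"
        using min[of ?u] y(2)[of _ k] elim by simp
      moreover have "e * ?p (\<lambda>i. t k *\<^sub>R y k i) \<le> e * (t k * (?p z + d k))"
        using order_trans[OF wmax_scale[OF n1 r tk] mult_left_mono[OF py[of k] tk]] e
        by (intro mult_left_mono) auto
      moreover have "?g ?u \<le> ?g (\<lambda>i. w i + t k *\<^sub>R z i) + ?C * (t k * d k)"
      proof -
        have "?g ?u \<le> ?g (\<lambda>i. w i + t k *\<^sub>R z i) + ?C * ?p (\<lambda>i. (w i + t k *\<^sub>R y k i) - (w i + t k *\<^sub>R z i))"
          by (rule max_dist_lipschitz[OF n r])
        moreover have "?p (\<lambda>i. (w i + t k *\<^sub>R y k i) - (w i + t k *\<^sub>R z i)) \<le> t k * d k"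
          unfolding d_def using wmax_scale[OF n1 r tk, of "\<lambda>i. y k i - z i"] by (simp add: scaleR_diff_right)
        ultimately show ?thesis using C0 by (smt (verit) mult_left_mono)
      qed
      then have "c * ?g ?u \<le> c * (?g (\<lambda>i. w i + t k *\<^sub>R z i) + ?C * (t k * d k))"
        using c by (intro mult_left_mono) auto
      moreover have "?g (\<lambda>i. w i + t k *\<^sub>R z i) \<le> (1 - t k) * ?g w + t k * ?g (\<lambda>i. w i + z i)"
      proof -
        have "?g (\<lambda>i. w i + t k *\<^sub>R z i) = N (\<lambda>i. (1 - t k) *\<^sub>R (w n - w i) + t k *\<^sub>R ((w n + z n) - (w i + z i)))"
          unfolding gN by (simp add: algebra_simps)
        also have "\<dots> \<le> N (\<lambda>i. (1 - t k) *\<^sub>R (w n - w i)) + N (\<lambda>i. t k *\<^sub>R ((w n + z n) - (w i + z i)))"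
          by (rule Nadd)
        also have "\<dots> \<le> (1 - t k) * ?g w + t k * ?g (\<lambda>i. w i + z i)"
          unfolding gN using t(3)[of k] tk by (intro add_mono Nscale) auto
        finally show ?thesis .
      qed
      then have "c * ?g (\<lambda>i. w i + t k *\<^sub>R z i) \<le> c * ((1 - t k) * ?g w + t k * ?g (\<lambda>i. w i + z i))"
        using c by (intro mult_left_mono) auto
      ultimately have "t k * (c * ?g w) \<le> t k * (c * ?g (\<lambda>i. w i + z i) + e * ?p z + (c * ?C + e) * d k)"
        by (simp add: algebra_simps)
      then show ?case using t(2)[of k] by (simp only: mult_le_cancel_left_pos)
    qed
    moreover have lim: "(\<lambda>k. c * ?g (\<lambda>i. w i + z i) + e * ?p z + (c * ?C + e) * d k) \<longlonglongrightarrow>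
       c * ?g (\<lambda>i. w i + z i) + e * ?p z + (c * ?C + e) * 0"
      by (intro tendsto_intros d)
    ultimately show ?thesis using tendsto_lowerbound[OF lim] by simp
  qed
  define P :: "(nat \<Rightarrow> 'a) \<times> (nat \<Rightarrow> 'a) \<Rightarrow> real" where "P a = c * N (fst a) + e * ?p (snd a)" for a
  define b :: "real \<Rightarrow> (nat \<Rightarrow> 'a) \<Rightarrow> nat \<Rightarrow> 'a" where
    "b s z i = s *\<^sub>R (w n - w i) + (z n - z i)" for s z i
  \<comment> \<open>\<open>s\<close> homogenises the base point: \<open>s = 1\<close> with
    \<open>z = 0\<close> will give the pairing, and \<open>s = 0\<close> with a tangent vector in a
    single coordinate will give normality there.\<close>
  define H where "H = {((b s z, z), s * (c * ?g w)) | s z. s \<ge> 0 \<and> (\<forall>i\<in>{1..n}. z i \<in> ?T i)}"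
  have HI: "((b s z, z), s * (c * ?g w)) \<in> H" if "s \<ge> 0" "\<forall>i\<in>{1..n}. z i \<in> ?T i" for s z
    using that by (auto simp: H_def)
  obtain L where L: "linear L" "\<And>a. L a \<le> P a" "\<And>k s. (k, s) \<in> H \<Longrightarrow> s \<le> L k"
  proof (rule hahn_banach_sandwich[of P H])
    show "sublinear P"
    proof (rule sublinearI)
      fix a a' :: "(nat \<Rightarrow> 'a) \<times> (nat \<Rightarrow> 'a)"
      have "c * N (fst (a + a')) \<le> c * (N (fst a) + N (fst a'))"
        using Nadd[of "fst a" "fst a'"] c by (simp add: plus_fun_def)
      moreover have "e * ?p (snd (a + a')) \<le> e * (?p (snd a) + ?p (snd a'))"
        using wmax_triangle[OF n1 r, of "snd a" "snd a'"] e by (simp add: plus_fun_def)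
      ultimately show "P (a + a') \<le> P a + P a'" by (simp add: P_def algebra_simps)
    next
      fix a :: "(nat \<Rightarrow> 'a) \<times> (nat \<Rightarrow> 'a)" and t :: real assume t: "t > 0"
      have "c * N (fst (t *\<^sub>R a)) \<le> c * (t * N (fst a))"
        using Nscale[of t "fst a"] c t by (simp add: scaleR_fun_def)
      moreover have "e * ?p (snd (t *\<^sub>R a)) \<le> e * (t * ?p (snd a))"
        using wmax_scale[OF n1 r, of t "snd a"] e t by (simp add: scaleR_fun_def)
      ultimately show "P (t *\<^sub>R a) \<le> t * P a" by (simp add: P_def algebra_simps)
    next
      have "N (\<lambda>i. 0) = 0" by (rule antisym) (auto simp: Nle N0)
      then show "P 0 = 0" by (simp add: P_def zero_fun_def wmax_zero[OF n1])
    qed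
    have "b 0 0 = 0" by (simp add: b_def fun_eq_iff)
    then show "(0, 0) \<in> H" using HI[of 0 0] by (simp add: zero_prod_def clarke_tangent_cone_zero)
    show "a + a' \<in> H" if ab: "a \<in> H" "a' \<in> H" for a a'
    proof -
      obtain s z s' z' where h: "a = ((b s z, z), s * (c * ?g w))" "s \<ge> 0" "\<forall>i\<in>{1..n}. z i \<in> ?T i"
         "a' = ((b s' z', z'), s' * (c * ?g w))" "s' \<ge> 0" "\<forall>i\<in>{1..n}. z' i \<in> ?T i"
        using ab unfolding H_def by blast
      have "a + a' = ((b (s + s') (z + z'), z + z'), (s + s') * (c * ?g w))"
        unfolding h by (auto simp: b_def plus_fun_def algebra_simps)
      moreover have "\<forall>i\<in>{1..n}. (z + z') i \<in> ?T i" using h by (simp add: plus_fun_def clarke_tangent_cone_add)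
      ultimately show ?thesis using HI[of "s + s'" "z + z'"] h by simp
    qed
    show "t *\<^sub>R a \<in> H" if at: "a \<in> H" "t > 0" for a and t :: real
    proof -
      obtain s z where h: "a = ((b s z, z), s * (c * ?g w))" "s \<ge> 0" "\<forall>i\<in>{1..n}. z i \<in> ?T i"
        using at unfolding H_def by blast
      have "t *\<^sub>R a = ((b (t * s) (t *\<^sub>R z), t *\<^sub>R z), (t * s) * (c * ?g w))"
        unfolding h by (auto simp: b_def scaleR_fun_def algebra_simps)
      moreover have "\<forall>i\<in>{1..n}. (t *\<^sub>R z) i \<in> ?T i" using h at by (simp add: scaleR_fun_def clarke_tangent_cone_scale)
      ultimately show ?thesis using HI[of "t * s" "t *\<^sub>R z"] h at by (simp add: mult.assoc)
    qed
    show "q \<le> P k" if kq: "(k, q) \<in> H" for k q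
    proof -
      obtain s z where h: "k = (b s z, z)" "q = s * (c * ?g w)" "s \<ge> 0" "\<forall>i\<in>{1..n}. z i \<in> ?T i"
        using kq unfolding H_def by blast
      show ?thesis
      proof (cases "s = 0")
        case True
        then show ?thesis using h c e N0[of "b s z"] wmax_nonneg[OF n1 r, of z] by (simp add: P_def)
      next
        case False
        then have s: "s > 0" using h by simp
        let ?z = "\<lambda>i. inverse s *\<^sub>R z i"
        have "c * ?g w \<le> c * ?g (\<lambda>i. w i + ?z i) + e * ?p ?z"
          using h s by (intro key clarke_tangent_cone_scale) auto
        also have "?g (\<lambda>i. w i + ?z i) = N (\<lambda>i. inverse s *\<^sub>R b s z i)"
          unfolding gN b_def using s by (simp add: algebra_simps)
        also have "c * N (\<lambda>i. inverse s *\<^sub>R b s z i) + e * ?p ?z \<le> c * (inverse s * N (b s z)) + e * (inverse s * ?p z)"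
          using s c e by (intro add_mono mult_left_mono Nscale wmax_scale[OF n1 r]) auto
        finally have "c * ?g w \<le> inverse s * (c * N (b s z) + e * ?p z)" by (simp add: algebra_simps)
        then have "s * (c * ?g w) \<le> s * (inverse s * (c * N (b s z) + e * ?p z))" using s by (intro mult_left_mono) auto
        also have "\<dots> = c * N (b s z) + e * ?p z" using s by simp
        finally show ?thesis using h by (simp add: P_def)
      qed
    qed
  qed blast
  define \<delta> :: "nat \<Rightarrow> 'a \<Rightarrow> nat \<Rightarrow> 'a" where "\<delta> i x = (\<lambda>j. if j = i then x else 0)" for i x
  have \<delta>_lin: "\<delta> i (x + x') = \<delta> i x + \<delta> i x'" "\<delta> i (t *\<^sub>R x) = t *\<^sub>R \<delta> i x" for i x x' t
    by (auto simp: \<delta>_def plus_fun_def scaleR_fun_def)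
  have decomp: "(\<Sum>i\<in>I. \<delta> i (x i)) = (\<lambda>j. if j \<in> I then x j else 0)" if "finite I" for I x
    using that by induction (auto simp: zero_fun_def plus_fun_def \<delta>_def)
  define V where "V i x = inverse c * L (\<delta> i x, 0)" for i x
  define Y where "Y i x = inverse c * L (0, \<delta> i x)" for i x
  have Lsum1: "L (\<Sum>i\<in>I. f i, 0) = (\<Sum>i\<in>I. L (f i, 0))" if "finite I" for I and f :: "nat \<Rightarrow> nat \<Rightarrow> 'a"
    using that
  proof induction
    case empty then show ?case using linear_0[OF L(1)] by (simp only: sum.empty zero_prod_def)
  next
    case (insert i I)
    have "L (f i + sum f I, 0) = L ((f i, 0) + (sum f I, 0))" by simp
    also have "\<dots> = L (f i, 0) + L (sum f I, 0)" by (rule linear_add[OF L(1)])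
    finally show ?case by (simp only: sum.insert[OF insert(1,2)] insert(3))
  qed
  have Lsum2: "L (0, \<Sum>i\<in>I. f i) = (\<Sum>i\<in>I. L (0, f i))" if "finite I" for I and f :: "nat \<Rightarrow> nat \<Rightarrow> 'a"
    using that
  proof induction
    case empty then show ?case using linear_0[OF L(1)] by (simp only: sum.empty zero_prod_def)
  next
    case (insert i I)
    have "L (0, f i + sum f I) = L ((0, f i) + (0, sum f I))" by simp
    also have "\<dots> = L (0, f i) + L (0, sum f I)" by (rule linear_add[OF L(1)])
    finally show ?case by (simp only: sum.insert[OF insert(1,2)] insert(3))
  qed
  have Vlin: "linear (V i)" for i
  proof (rule linearI)
    show "V i (x + x') = V i x + V i x'" for x x'
      using linear_add[OF L(1), of "(\<delta> i x, 0)" "(\<delta> i x', 0)"] by (simp add: V_def \<delta>_lin algebra_simps)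
    show "V i (t *\<^sub>R x) = t *\<^sub>R V i x" for t x
      using linear_scale[OF L(1), of t "(\<delta> i x, 0)"] by (simp add: V_def \<delta>_lin)
  qed
  have Ylin: "linear (Y i)" for i
  proof (rule linearI)
    show "Y i (x + x') = Y i x + Y i x'" for x x'
      using linear_add[OF L(1), of "(0, \<delta> i x)" "(0, \<delta> i x')"] by (simp add: Y_def \<delta>_lin algebra_simps)
    show "Y i (t *\<^sub>R x) = t *\<^sub>R Y i x" for t x
      using linear_scale[OF L(1), of t "(0, \<delta> i x)"] by (simp add: Y_def \<delta>_lin)
  qed
  have ic: "inverse c > 0" using c by simp
  have p00: "?p 0 = 0" "N 0 = 0" using Nle[of 0 0] N0[of 0] by (auto simp: zero_fun_def wmax_zero[OF n1] intro: antisym)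
  have Vle: "V i x \<le> norm x" for i x
  proof -
    have "N (\<delta> i x) \<le> norm x" unfolding Nle by (auto simp: \<delta>_def)
    then have "c * N (\<delta> i x) \<le> c * norm x" using c by simp
    then have "L (\<delta> i x, 0) \<le> c * norm x" using L(2)[of "(\<delta> i x, 0)"] p00 by (simp add: P_def)
    then show ?thesis using c by (simp add: V_def field_simps)
  qed
  have Yle: "Y i x \<le> e / (c * r i) * norm x" for i x
  proof -
    have "?p (\<delta> i x) \<le> norm x / r i" unfolding wmax_le_iff[OF n1 r] using r by (auto simp: \<delta>_def less_imp_neq[symmetric] less_imp_le)
    then have "e * ?p (\<delta> i x) \<le> e * (norm x / r i)" using e by (intro mult_left_mono) auto
    then have "L (0, \<delta> i x) \<le> e * (norm x / r i)" using L(2)[of "(0, \<delta> i x)"] p00 by (simp add: P_def)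
    then have "inverse c * L (0, \<delta> i x) \<le> inverse c * (e * (norm x / r i))" using ic by (intro mult_left_mono) auto
    then show ?thesis by (simp add: Y_def field_simps)
  qed
  have blin: "bounded_linear f" if "linear f" "\<And>x. f x \<le> K * norm x" for f :: "'a \<Rightarrow> real" and K
  proof -
    have "\<bar>f x\<bar> \<le> norm x * K" for x
      using that(2)[of x] that(2)[of "- x"] linear_neg[OF that(1), of x] by (simp add: abs_le_iff mult.commute)
    then show ?thesis using that(1) by (auto simp: bounded_linear_def bounded_linear_axioms_def)
  qed
  have Vb: "bounded_linear (V i)" for i using blin[OF Vlin, of i 1] Vle by simp
  have Yb: "bounded_linear (Y i)" for i using blin[OF Ylin, of i] Yle by blast
  define v where "v i = Blinfun (V i)" for i
  define y where "y i = Blinfun (Y i)" for i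
  have vV: "blinfun_apply (v i) = V i" "blinfun_apply (y i) = Y i" for i
    using Vb Yb by (auto simp: v_def y_def bounded_linear_Blinfun_apply)
  have sumV: "(\<Sum>i=1..n-1. V i (x i)) = inverse c * L (\<lambda>j. if j \<in> {1..n-1} then x j else 0, 0)" for x
    unfolding V_def sum_distrib_left[symmetric] using Lsum1[of "{1..n-1}" "\<lambda>i. \<delta> i (x i)"] decomp[of "{1..n-1}" x] by simp
  have sumY: "(\<Sum>i=1..n. Y i (x i)) = inverse c * L (0, \<lambda>j. if j \<in> {1..n} then x j else 0)" for x
    unfolding Y_def sum_distrib_left[symmetric] using Lsum2[of "{1..n}" "\<lambda>i. \<delta> i (x i)"] decomp[of "{1..n}" x] by simp
  have sumV_le: "(\<Sum>i=1..n-1. V i (x i)) \<le> N x" for x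
  proof -
    have "L (\<lambda>j. if j \<in> {1..n-1} then x j else 0, 0) \<le> c * N x"
      using L(2)[of "(\<lambda>j. if j \<in> {1..n-1} then x j else 0, 0)"] p00 leN by (simp add: P_def N_def)
    then show ?thesis unfolding sumV using c by (simp add: field_simps)
  qed
  have sumY_le: "(\<Sum>i=1..n. Y i (x i)) \<le> inverse c * (e * ?p x)" for x
  proof -
    have "L (0, \<lambda>j. if j \<in> {1..n} then x j else 0) \<le> e * ?p x"
      using L(2)[of "(0, \<lambda>j. if j \<in> {1..n} then x j else 0)"] p00 by (simp add: P_def wmax_def)
    then show ?thesis unfolding sumY using ic by (intro mult_left_mono) auto
  qed
  \<comment> \<open>The discarded coordinates form a pair on which \<open>P\<close> vanishes with
    both signs, and \<open>L \<le> P\<close> then forces \<open>L\<close> to vanish on it as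
    well.\<close>
  have outside: "L (a, z) = L (\<lambda>j. if j \<in> {1..n-1} then a j else 0, \<lambda>j. if j \<in> {1..n} then z j else 0)" for a z
  proof -
    let ?d = "(a - (\<lambda>j. if j \<in> {1..n-1} then a j else 0), z - (\<lambda>j. if j \<in> {1..n} then z j else 0))"
    have "P ?d = 0" "P (- ?d) = 0"
    proof -
      have "N (fst ?d) = N 0" "?p (snd ?d) = ?p 0" "N (fst (- ?d)) = N 0" "?p (snd (- ?d)) = ?p 0"
        unfolding N_def wmax_def by (auto intro!: arg_cong[of _ _ Max] image_cong)
      then show "P ?d = 0" "P (- ?d) = 0" using p00 by (auto simp: P_def)
    qed
    then have "L ?d = 0" using L(2)[of ?d] L(2)[of "- ?d"] linear_neg[OF L(1), of ?d] by simp
    moreover have "L (a, z) - L (\<lambda>j. if j \<in> {1..n-1} then a j else 0, \<lambda>j. if j \<in> {1..n} then z j else 0) = L ?d"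
      using linear_diff[OF L(1), of "(a, z)" "(\<lambda>j. if j \<in> {1..n-1} then a j else 0, \<lambda>j. if j \<in> {1..n} then z j else 0)"] by simp
    ultimately show ?thesis by simp
  qed
  have Lexp: "inverse c * L (a, z) = (\<Sum>i=1..n-1. V i (a i)) + (\<Sum>i=1..n. Y i (z i))" for a z
  proof -
    have "L (a, z) = L ((\<lambda>j. if j \<in> {1..n-1} then a j else 0, 0) + (0, \<lambda>j. if j \<in> {1..n} then z j else 0))"
      using outside[of a z] by simp
    then show ?thesis unfolding sumV sumY linear_add[OF L(1)] by (simp only: distrib_left)
  qed
  have HL: "s * ?g w \<le> (\<Sum>i=1..n-1. V i (b s z i)) + (\<Sum>i=1..n. Y i (z i))"
    if "s \<ge> 0" "\<forall>i\<in>{1..n}. z i \<in> ?T i" for s z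
  proof -
    have "inverse c * (s * (c * ?g w)) \<le> inverse c * L (b s z, z)" using L(3)[OF HI[OF that]] ic by (intro mult_left_mono) auto
    moreover have "inverse c * (s * (c * ?g w)) = s * ?g w" using c by simp
    ultimately show ?thesis unfolding Lexp by linarith
  qed
  have pair: "(\<Sum>i=1..n-1. blinfun_apply (v i) (w n - w i)) = ?g w"
  proof (rule antisym)
    show "(\<Sum>i=1..n-1. blinfun_apply (v i) (w n - w i)) \<le> ?g w" unfolding vV gN by (rule sumV_le)
    show "?g w \<le> (\<Sum>i=1..n-1. blinfun_apply (v i) (w n - w i))"
      using HL[of 1 "\<lambda>i. 0"] by (simp add: vV b_def linear_0[OF Ylin] clarke_tangent_cone_zero)
  qed
  have le1: "(\<Sum>i\<in>{1..n-1}. 1 * norm (v i)) \<le> 1"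
  proof (rule weighted_norm_sum_le)
    fix x :: "nat \<Rightarrow> 'a" assume "\<And>i. i \<in> {1..n-1} \<Longrightarrow> norm (x i) \<le> 1"
    then have "N x \<le> 1" unfolding Nle by blast
    then show "(\<Sum>i=1..n-1. blinfun_apply (v i) (x i)) \<le> 1" unfolding vV using sumV_le[of x] by simp
  qed auto
  \<comment> \<open>The paired differences have norm at most \<open>?g w\<close>, so a pairing equal
    to \<open>?g w > 0\<close> forces the norms to sum to at least 1.\<close>
  have "(\<Sum>i=1..n-1. blinfun_apply (v i) (w n - w i)) \<le> (\<Sum>i=1..n-1. norm (v i) * ?g w)"
  proof (rule sum_mono)
    fix i assume i: "i \<in> {1..n-1}"
    have "blinfun_apply (v i) (w n - w i) \<le> norm (v i) * norm (w n - w i)"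
      using norm_blinfun[of "v i" "w n - w i"] by simp
    also have "\<dots> \<le> norm (v i) * ?g w" using norm_le_max_dist[OF i] by (intro mult_left_mono) auto
    finally show "blinfun_apply (v i) (w n - w i) \<le> norm (v i) * ?g w" .
  qed
  then have "1 * ?g w \<le> (\<Sum>i=1..n-1. norm (v i)) * ?g w" by (simp add: sum_distrib_right pair[simplified])
  then have ge1: "1 \<le> (\<Sum>i=1..n-1. norm (v i))" using pos by (simp only: mult_le_cancel_right_pos)
  have sum1: "(\<Sum>i=1..n-1. norm (v i)) = 1" using le1 ge1 by simp
  have ysum: "(\<Sum>i\<in>{1..n}. r i * norm (y i)) \<le> inverse c * e"
  proof (rule weighted_norm_sum_le)
    fix x :: "nat \<Rightarrow> 'a" assume x: "\<And>i. i \<in> {1..n} \<Longrightarrow> norm (x i) \<le> r i"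
    then have "?p x \<le> 1" unfolding wmax_le_iff[OF n1 r] by simp
    then have "inverse c * (e * ?p x) \<le> inverse c * e" using ic e by (simp add: mult_left_le)
    then show "(\<Sum>i=1..n. blinfun_apply (y i) (x i)) \<le> inverse c * e" unfolding vV using sumY_le[of x] by simp
  qed (use r in \<open>auto simp: less_imp_le\<close>)
  have ysum': "c * (\<Sum>i=1..n. r i * norm (y i)) \<le> e" using ysum c by (simp add: field_simps)
  have normal1: "v i - y i \<in> clarke_normal_cone (W i) (w i)" if i: "i \<in> {1..n-1}" for i
    unfolding clarke_normal_cone_def
  proof (intro CollectI ballI)
    fix z assume z: "z \<in> ?T i"
    let ?z = "\<delta> i z"
    \<comment> \<open>Moving only the point with index \<open>i\<close> by \<open>z\<close> changes
      only the difference with that index, by \<open>- z\<close>; this is the sign in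
      \<open>v i - y i\<close>. Moving the last point, as is done for index \<open>n\<close>,
      changes all differences by \<open>+ z\<close>.\<close>
    have zT: "\<forall>j\<in>{1..n}. ?z j \<in> ?T j" using z clarke_tangent_cone_zero by (auto simp: \<delta>_def)
    have "?z n = 0" using sub[OF i] by (auto simp: \<delta>_def)
    then have "V j (b 0 ?z j) = (if j = i then - V i z else 0)" for j
      using linear_neg[OF Vlin, of i z] linear_0[OF Vlin, of j] by (auto simp: b_def \<delta>_def)
    then have 1: "(\<Sum>j=1..n-1. V j (b 0 ?z j)) = - V i z" using i by simp
    have "Y j (?z j) = (if j = i then Y i z else 0)" for j
      using linear_0[OF Ylin, of j] by (auto simp: \<delta>_def)
    then have 2: "(\<Sum>j=1..n. Y j (?z j)) = Y i z" using sub[OF i] by simp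
    show "blinfun_apply (v i - y i) z \<le> 0"
      using HL[of 0 ?z] zT 1 2 by (simp add: blinfun.diff_left vV)
  qed
  have normal2: "- (\<Sum>i=1..n-1. v i) - y n \<in> clarke_normal_cone (W n) (w n)"
    unfolding clarke_normal_cone_def
  proof (intro CollectI ballI)
    fix z assume z: "z \<in> ?T n"
    let ?z = "\<delta> n z"
    have zT: "\<forall>j\<in>{1..n}. ?z j \<in> ?T j" using z clarke_tangent_cone_zero by (auto simp: \<delta>_def)
    have "b 0 ?z j = z" if "j \<in> {1..n-1}" for j using sub[OF that] by (auto simp: b_def \<delta>_def)
    then have 1: "(\<Sum>j=1..n-1. V j (b 0 ?z j)) = (\<Sum>j=1..n-1. V j z)" by (intro sum.cong) auto
    have "Y j (?z j) = (if j = n then Y n z else 0)" for j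
      using linear_0[OF Ylin, of j] by (auto simp: \<delta>_def)
    then have 2: "(\<Sum>j=1..n. Y j (?z j)) = Y n z" using nn by simp
    show "blinfun_apply (- (\<Sum>i=1..n-1. v i) - y n) z \<le> 0"
      using HL[of 0 ?z] zT 1 2 by (simp add: blinfun.diff_left blinfun.minus_left blinfun.sum_left vV)
  qed
  show ?thesis by (rule that[OF sum1 pair ysum' normal1 normal2])
qed


subsection \<open>Peeling the dual ball of an Asplund space\<close>

text \<open>Plain functions rather than elements of the type of bounded linear maps: the product
  topology on \<open>'a \<Rightarrow> real\<close> is then the weak-star topology on the
  ball.\<close>

definition dual_ball :: "('a::real_normed_vector \<Rightarrow> real) set" where
  "dual_ball = {f. linear f \<and> (\<forall>x. \<bar>f x\<bar> \<le> norm x)}"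

lemma dual_ball_linear: "f \<in> dual_ball \<Longrightarrow> linear f"
  and dual_ball_le: "f \<in> dual_ball \<Longrightarrow> \<bar>f x\<bar> \<le> norm x"
  by (auto simp: dual_ball_def)

lemma zero_in_dual_ball: "(\<lambda>x. 0) \<in> dual_ball"
  by (auto simp: dual_ball_def intro: linearI)

lemma closed_eval_le: "closed {f :: 'a \<Rightarrow> real. f x \<le> c}"
  by (intro closed_Collect_le continuous_intros continuous_on_product_coordinates)

lemma closed_eval_near: "closed {f :: 'a \<Rightarrow> real. \<bar>f x - c\<bar> \<le> d}"
  by (intro closed_Collect_le continuous_intros continuous_on_product_coordinates)

lemma closed_linear_functions:
  "closed {f :: 'a::real_vector \<Rightarrow> real. linear f}"
proof -
  have "{f :: 'a \<Rightarrow> real. linear f} =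
      (\<Inter>x. \<Inter>y. {f. f (x + y) = f x + f y}) \<inter> (\<Inter>r. \<Inter>x. {f. f (r *\<^sub>R x) = r * f x})"
    by (auto simp: linear_iff)
  also have "closed \<dots>"
    by (intro closed_Int closed_INT ballI closed_Collect_eq continuous_intros continuous_on_product_coordinates)
  finally show ?thesis .
qed

text \<open>Banach-Alaoglu: linearity is a closed condition inside a product of compact
  intervals.\<close>

theorem compact_dual_ball: "compact (dual_ball :: ('a::real_normed_vector \<Rightarrow> real) set)"
proof -
  let ?B = "PiE UNIV (\<lambda>x::'a. {- norm x..norm x})"
  have "compactin (product_topology (\<lambda>_. euclidean) UNIV) ?B"
    by (simp add: compactin_PiE)
  then have B: "compact ?B" by (simp add: euclidean_product_topology)
  have "dual_ball = ?B \<inter> {f :: 'a \<Rightarrow> real. linear f}"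
    by (auto simp: dual_ball_def PiE_def abs_le_iff minus_le_iff)
  then show ?thesis using compact_Int_closed[OF B closed_linear_functions] by (simp only:)
qed

lemma closed_dual_ball: "closed (dual_ball :: ('a::real_normed_vector \<Rightarrow> real) set)"
proof -
  have eq: "dual_ball = {f :: 'a \<Rightarrow> real. linear f} \<inter> (\<Inter>x. {f. \<bar>f x - 0\<bar> \<le> norm x})"
    by (auto simp: dual_ball_def)
  show ?thesis
    unfolding eq by (intro closed_Int closed_linear_functions closed_INT ballI closed_eval_near)
qed

text \<open>Smulian's argument. The support function of \<open>A\<close> is convex and 1-Lipschitz,
  hence differentiable somewhere; elements of \<open>A\<close> that nearly attain the supremum there
  are close to the derivative, and so to each other, in norm.\<close>

lemma asplund_slice:
  fixes A :: "('a::banach \<Rightarrow> real) set"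
  assumes asp: "asplund TYPE('a)" and A: "A \<subseteq> dual_ball" "A \<noteq> {}" and e: "e > 0"
  shows "\<exists>x \<alpha>. (\<exists>f\<in>A. \<alpha> < f x) \<and>
    (\<forall>f\<in>A. \<forall>g\<in>A. \<alpha> < f x \<longrightarrow> \<alpha> < g x \<longrightarrow> (\<forall>h. \<bar>f h - g h\<bar> \<le> e * norm h))"
proof -
  define p where "p x = (SUP f\<in>A. f x)" for x
  have lin: "linear f" and bd: "\<bar>f x\<bar> \<le> norm x" if "f \<in> A" for f x
    using that A by (auto simp: dual_ball_def)
  have bdd: "bdd_above ((\<lambda>f. f x) ` A)" for x
    by (rule bdd_aboveI2[of _ _ "norm x"]) (use bd abs_le_D1 in blast)
  have ub: "f x \<le> p x" if "f \<in> A" for f x unfolding p_def by (rule cSUP_upper[OF that bdd])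
  have lub: "p x \<le> c" if "\<And>f. f \<in> A \<Longrightarrow> f x \<le> c" for x c unfolding p_def by (rule cSUP_least[OF A(2) that])
  have lip: "p x \<le> p y + norm (x - y)" for x y
  proof (rule lub)
    fix f assume f: "f \<in> A"
    have "f x = f y + f (x - y)" using linear_diff[OF lin[OF f]] by simp
    then show "f x \<le> p y + norm (x - y)" using ub[OF f, of y] bd[OF f, of "x - y"] by simp
  qed
  have "continuous_on UNIV p"
  proof (rule continuous_onI)
    fix x :: 'a and e :: real assume "e > 0"
    then show "\<exists>d>0. \<forall>x'\<in>UNIV. dist x' x < d \<longrightarrow> dist (p x') (p x) \<le> e"
    proof (intro exI[of _ e] conjI ballI impI)
      fix y assume "dist y x < e"
      then show "dist (p y) (p x) \<le> e"
        using lip[of x y] lip[of y x] by (simp add: dist_norm norm_minus_commute abs_le_iff)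
    qed
  qed
  moreover have "convex_on UNIV p"
  proof (rule convex_onI)
    fix t :: real and x y :: 'a assume t: "0 < t" "t < 1"
    show "p ((1 - t) *\<^sub>R x + t *\<^sub>R y) \<le> (1 - t) * p x + t * p y"
    proof (rule lub)
      fix f assume f: "f \<in> A"
      have "f ((1 - t) *\<^sub>R x + t *\<^sub>R y) = (1 - t) * f x + t * f y"
        using linear_add[OF lin[OF f]] linear_scale[OF lin[OF f]] by simp
      also have "\<dots> \<le> (1 - t) * p x + t * p y" using t ub[OF f] by (intro add_mono mult_left_mono) auto
      finally show "f ((1 - t) *\<^sub>R x + t *\<^sub>R y) \<le> (1 - t) * p x + t * p y" .
    qed
  qed simp
  ultimately have "UNIV \<subseteq> closure {x\<in>UNIV. p differentiable (at x)}"
    using asp unfolding asplund_def by blast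
  then have "{x. p differentiable (at x)} \<noteq> {}" by (auto simp del: Collect_empty_eq)
  then obtain x D where D: "(p has_derivative D) (at x)" by (auto simp: differentiable_def)
  then obtain d where d: "d > 0" "\<And>y. norm (y - x) < d \<Longrightarrow> norm (p y - p x - D (y - x)) \<le> (e / 4) * norm (y - x)"
    unfolding has_derivative_at_alt using e by (metis zero_less_divide_iff zero_less_numeral)
  have Dlin: "linear D" using D has_derivative_linear by blast
  \<comment> \<open>Membership in the slice and the differentiability estimate cost
    \<open>(e / 4) * \<delta>\<close> each on vectors of norm \<open>\<delta>\<close>. The resulting
    one-sided bound is used for \<open>f\<close> at \<open>h\<close> and for \<open>g\<close> at
    \<open>- h\<close>, which adds up to \<open>e * \<delta>\<close>.\<close>
  define \<delta> where "\<delta> = d / 2"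
  define \<alpha> where "\<alpha> = p x - (e / 4) * \<delta>"
  have \<delta>: "\<delta> > 0" "\<delta> < d" using d by (auto simp: \<delta>_def)
  have near: "f h \<le> D h + (e / 2) * \<delta>" if f: "f \<in> A" "\<alpha> < f x" and h: "norm h = \<delta>" for f h
  proof -
    have "f x + f h \<le> p (x + h)" using ub[OF f(1), of "x + h"] linear_add[OF lin[OF f(1)], of x h] by simp
    moreover have "\<bar>p (x + h) - p x - D h\<bar> \<le> (e / 4) * \<delta>" using d(2)[of "x + h"] h \<delta> by simp
    moreover have "f x > p x - (e / 4) * \<delta>" using f(2) by (simp add: \<alpha>_def)
    ultimately have "f h \<le> D h + ((e / 4) * \<delta> + (e / 4) * \<delta>)" by linarith
    then show ?thesis by (simp add: algebra_simps)
  qed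
  have diff: "f h - g h \<le> e * norm h" if f: "f \<in> A" "\<alpha> < f x" and g: "g \<in> A" "\<alpha> < g x" for f g h
  proof (cases "h = 0")
    case True
    then show ?thesis using linear_0[OF lin[OF f(1)]] linear_0[OF lin[OF g(1)]] by simp
  next
    case False
    define s where "s = \<delta> / norm h"
    have s: "s > 0" "norm (s *\<^sub>R h) = \<delta>" using False \<delta> by (auto simp: s_def)
    have "f (s *\<^sub>R h) \<le> D (s *\<^sub>R h) + (e / 2) * \<delta>" by (rule near[OF f s(2)])
    moreover have "g (- (s *\<^sub>R h)) \<le> D (- (s *\<^sub>R h)) + (e / 2) * \<delta>" by (rule near[OF g]) (use s in simp)
    ultimately have "f (s *\<^sub>R h) - g (s *\<^sub>R h) \<le> e * \<delta>"
      using linear_neg[OF Dlin] linear_neg[OF lin[OF g(1)]] by (simp add: algebra_simps)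
    then have "s * (f h - g h) \<le> s * (e * norm h)"
      using linear_scale[OF lin[OF f(1)]] linear_scale[OF lin[OF g(1)]] False by (simp add: s_def algebra_simps)
    then show ?thesis using s by (simp only: mult_le_cancel_left_pos)
  qed
  have "\<exists>f\<in>A. \<alpha> < f x"
  proof (rule ccontr)
    assume "\<not> (\<exists>f\<in>A. \<alpha> < f x)"
    then have "p x \<le> \<alpha>" by (intro lub) auto
    then show False using e \<delta> by (simp add: \<alpha>_def mult_le_0_iff)
  qed
  moreover have "\<bar>f h - g h\<bar> \<le> e * norm h" if "f \<in> A" "g \<in> A" "\<alpha> < f x" "\<alpha> < g x" for f g h
    using diff[of f g h] diff[of g f h] that by (simp add: abs_le_iff)
  ultimately show ?thesis by blast
qed

text \<open>Zermelo's tower for an arbitrary shrinking operation \<open>F\<close>: it is well-ordered by reverse inclusion, with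
  \<open>F A\<close> the successor of \<open>A\<close>, so no ordinals are needed.\<close>

inductive_set tower :: "('b set \<Rightarrow> 'b set) \<Rightarrow> 'b set \<Rightarrow> 'b set set" for F K where
  base: "K \<in> tower F K"
| step: "A \<in> tower F K \<Longrightarrow> F A \<in> tower F K"
| inter: "\<S> \<noteq> {} \<Longrightarrow> (\<And>A. A \<in> \<S> \<Longrightarrow> A \<in> tower F K) \<Longrightarrow> \<Inter>\<S> \<in> tower F K"

lemma tower_subset:
  assumes F: "\<And>A. F A \<subseteq> A" and A: "A \<in> tower F K"
  shows "A \<subseteq> K"
  using A by induction (use F in blast)+

text \<open>Induction on \<open>B\<close> for a fixed \<open>A\<close> with the extremality property
  \<open>ext\<close>. In the successor step the case \<open>A = B\<close> turns \<open>F B\<close>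
  into \<open>F A\<close>, and a proper inclusion is the case that \<open>ext\<close>
  covers.\<close>

lemma tower_compare_extreme:
  assumes F: "\<And>A. F A \<subseteq> A" and B: "B \<in> tower F K" and A: "A \<in> tower F K"
    and ext: "\<And>B. B \<in> tower F K \<Longrightarrow> A \<subset> B \<Longrightarrow> A \<subseteq> F B"
  shows "A \<subseteq> B \<or> B \<subseteq> F A"
  using B
proof induction
  case base then show ?case using tower_subset[OF F A] by simp
next
  case (step B) then show ?case using ext F by blast
next
  case (inter \<S>) then show ?case by blast
qed

text \<open>A second induction shows that every layer is extreme. The inclusion into
  \<open>F A\<close>, and not merely into \<open>A\<close>, is the useful part: no layer lies
  strictly between \<open>F A\<close> and \<open>A\<close>.\<close>

lemma tower_compare:
  assumes F: "\<And>A. F A \<subseteq> A" and A: "A \<in> tower F K" and B: "B \<in> tower F K"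
  shows "A \<subseteq> B \<or> B \<subseteq> F A"
proof -
  have "\<forall>B\<in>tower F K. A \<subset> B \<longrightarrow> A \<subseteq> F B"
    using A
  proof induction
    case base then show ?case using tower_subset[OF F] by blast
  next
    case (step A)
    show ?case
    proof (intro ballI impI)
      fix B assume B: "B \<in> tower F K" "F A \<subset> B"
      have "A \<subseteq> B \<or> B \<subseteq> F A" using tower_compare_extreme[OF F B(1) step(1)] step(2) by blast
      then show "F A \<subseteq> F B" using B(2) step(2) B(1) F by blast
    qed
  next
    case (inter \<S>)
    show ?case
    proof (intro ballI impI)
      fix B assume B: "B \<in> tower F K" "\<Inter>\<S> \<subset> B"
      then obtain A where A: "A \<in> \<S>" "\<not> B \<subseteq> A" by blast
      have "A \<subseteq> B \<or> B \<subseteq> F A" using tower_compare_extreme[OF F B(1), of A] inter A by blast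
      then have "A \<subset> B" using A F by blast
      then show "\<Inter>\<S> \<subseteq> F B" using inter A B(1) by blast
    qed
  qed
  then show ?thesis using tower_compare_extreme[OF F B A] by blast
qed

lemma finite_chain_Inter_mem:
  assumes "finite \<S>" "\<S> \<noteq> {}" "\<And>A B. A \<in> \<S> \<Longrightarrow> B \<in> \<S> \<Longrightarrow> A \<subseteq> B \<or> B \<subseteq> A"
  shows "\<Inter>\<S> \<in> \<S>"
  using assms
proof (induction rule: finite_ne_induct)
  case (insert A \<S>)
  then have "\<Inter>\<S> \<in> \<S>" by blast
  then have "A \<subseteq> \<Inter>\<S> \<or> \<Inter>\<S> \<subseteq> A" using insert.prems by blast
  then show ?case using \<open>\<Inter>\<S> \<in> \<S>\<close> by (auto simp: Int_absorb1 Int_absorb2)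
qed simp

text \<open>The box \<open>B d\<close> consists of the functionals \<open>g\<close> with \<open>\<bar>g a - r\<bar> \<le> d\<close> for \<open>(a, r) \<in> B\<close>. As a box around \<open>f\<close> shrinks,
  the last layer of the tower that it meets becomes constant by weak-star compactness.\<close>

theorem asplund_selection:
  assumes asp: "asplund TYPE('a::banach)" and e: "e > 0"
  obtains sel :: "('a::banach \<times> real) set \<Rightarrow> real \<Rightarrow> 'a \<Rightarrow> real" where
    "\<And>B d. sel B d \<in> dual_ball"
    "\<And>f A. f \<in> dual_ball \<Longrightarrow> \<exists>B m. finite B \<and> B \<subseteq> A \<and>
       (\<forall>r. (\<forall>a\<in>B. \<bar>f a - r a\<bar> \<le> 1 / real (Suc m)) \<longrightarrow>
         (\<exists>g\<in>dual_ball. (\<forall>a\<in>A. g a = f a) \<and>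
           (\<forall>h. \<bar>sel ((\<lambda>a. (a, r a)) ` B) (1 / real (Suc m)) h - g h\<bar> \<le> e * norm h)))"
proof -
  let ?K = "dual_ball :: ('a \<Rightarrow> real) set"
  have "\<forall>A. \<exists>x \<alpha>. A \<subseteq> ?K \<and> A \<noteq> {} \<longrightarrow> (\<exists>f\<in>A. \<alpha> < f x) \<and>
    (\<forall>f\<in>A. \<forall>g\<in>A. \<alpha> < f x \<longrightarrow> \<alpha> < g x \<longrightarrow> (\<forall>h. \<bar>f h - g h\<bar> \<le> e * norm h))"
  proof
    fix A :: "('a \<Rightarrow> real) set"
    show "\<exists>x \<alpha>. A \<subseteq> ?K \<and> A \<noteq> {} \<longrightarrow> (\<exists>f\<in>A. \<alpha> < f x) \<and>
      (\<forall>f\<in>A. \<forall>g\<in>A. \<alpha> < f x \<longrightarrow> \<alpha> < g x \<longrightarrow> (\<forall>h. \<bar>f h - g h\<bar> \<le> e * norm h))"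
      using asplund_slice[OF asp, of A e] e by (cases "A \<subseteq> ?K \<and> A \<noteq> {}") (simp, blast)
  qed
  then obtain X \<alpha> where X: "\<And>A. A \<subseteq> ?K \<Longrightarrow> A \<noteq> {} \<Longrightarrow> \<exists>f\<in>A. \<alpha> A < f (X A)"
    "\<And>A f g h. A \<subseteq> ?K \<Longrightarrow> A \<noteq> {} \<Longrightarrow> f \<in> A \<Longrightarrow> g \<in> A \<Longrightarrow> \<alpha> A < f (X A) \<Longrightarrow> \<alpha> A < g (X A) \<Longrightarrow> \<bar>f h - g h\<bar> \<le> e * norm h"
    by metis
  \<comment> \<open>The successor keeps what lies outside the chosen slice, so the discarded part
    \<open>A - F A\<close> has the small norm diameter that \<open>F_close\<close> records.\<close>
  define F where "F A = {f \<in> A. f (X A) \<le> \<alpha> A}" for A :: "('a \<Rightarrow> real) set"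
  have F_sub: "F A \<subseteq> A" for A by (auto simp: F_def)
  have F_ne: "F A \<noteq> A" if "A \<subseteq> ?K" "A \<noteq> {}" for A proof
    assume "F A = A"
    then have "f (X A) \<le> \<alpha> A" if "f \<in> A" for f using that unfolding F_def by blast
    then show False using X(1)[OF that] by force
  qed
  have F_close: "\<bar>f h - g h\<bar> \<le> e * norm h" if "A \<subseteq> ?K" "f \<in> A - F A" "g \<in> A - F A" for A f g h
    proof -
    have "A \<noteq> {}" using that by auto
    then show ?thesis using that X(2)[of A f g h] by (simp add: F_def not_le)
  qed
  let ?T = "tower F ?K"
  have T_sub: "A \<subseteq> ?K" if "A \<in> ?T" for A using tower_subset[OF F_sub that] .
  have T_closed: "closed A" if "A \<in> ?T" for A
    using that
  proof induction
    case base show ?case by (rule closed_dual_ball)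
  next
    case (step A)
    have "F A = A \<inter> {f. f (X A) \<le> \<alpha> A}" by (auto simp: F_def)
    then show ?case using step(2) by (simp add: closed_Int closed_eval_le)
  next
    case (inter \<S>) then show ?case by blast
  qed
  have chain: "A \<subseteq> B \<or> B \<subseteq> A" if "A \<in> ?T" "B \<in> ?T" for A B
    using tower_compare[OF F_sub that] F_sub by blast
  \<comment> \<open>The last layer that meets \<open>C\<close>. Layers form a chain of weak-star
    closed sets, so for closed nonempty \<open>C\<close> in the ball compactness makes the
    intersection of the layers meeting \<open>C\<close> meet it too.\<close>
  define least where "least C = \<Inter>{A \<in> ?T. A \<inter> C \<noteq> {}}" for C
  have least: "least C \<in> ?T" "least C \<inter> C \<noteq> {}" if C: "closed C" "C \<subseteq> ?K" "C \<noteq> {}" for C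
  proof -
    have KC: "?K \<in> {A \<in> ?T. A \<inter> C \<noteq> {}}" using C tower.base by blast
    then show "least C \<in> ?T" unfolding least_def by (intro tower.inter) auto
    have "compact C" using C compact_dual_ball by (metis compact_Int_closed inf.absorb2)
    then have "C \<inter> \<Inter>{A \<in> ?T. A \<inter> C \<noteq> {}} \<noteq> {}"
    proof (rule compact_imp_fip)
      show "closed A" if "A \<in> {A \<in> ?T. A \<inter> C \<noteq> {}}" for A using that T_closed by blast
      fix \<S> assume S: "finite \<S>" "\<S> \<subseteq> {A \<in> ?T. A \<inter> C \<noteq> {}}"
      show "C \<inter> \<Inter>\<S> \<noteq> {}"
      proof (cases "\<S> = {}")
        case False
        then have "\<Inter>\<S> \<in> \<S>" using S chain by (intro finite_chain_Inter_mem) blast+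
        then show ?thesis using S by blast
      qed (use C in simp)
    qed
    then show "least C \<inter> C \<noteq> {}" unfolding least_def by blast
  qed
  define box where "box B d = {g \<in> ?K. \<forall>(a, r)\<in>B. \<bar>g a - r\<bar> \<le> d}" for B :: "('a \<times> real) set" and d
  have box: "closed (box B d)" "box B d \<subseteq> ?K" for B d
  proof -
    have eq: "box B d = ?K \<inter> (\<Inter>q\<in>B. {g. \<bar>g (fst q) - snd q\<bar> \<le> d})"
      by (auto simp: box_def split_def)
    show "closed (box B d)"
      unfolding eq by (intro closed_Int closed_INT ballI closed_dual_ball closed_eval_near)
  qed (auto simp: box_def)
  \<comment> \<open>The zero functional is a default for empty boxes and keeps every selected value
    in the dual ball.\<close>
  define sel where "sel B d = (if box B d = {} then (\<lambda>_. 0) else SOME g. g \<in> least (box B d) \<inter> box B d)" for B d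
  have sel_in: "sel B d \<in> least (box B d) \<inter> box B d" if "box B d \<noteq> {}" for B d
  proof -
    have "(SOME g. g \<in> least (box B d) \<inter> box B d) \<in> least (box B d) \<inter> box B d"
      using least(2)[OF box that] by (rule some_in_eq[THEN iffD2])
    then show ?thesis using that by (simp add: sel_def)
  qed
  show ?thesis
  proof (rule that[of sel])
    show "sel B d \<in> ?K" for B d
      using sel_in[of B d] box(2)[of B d] zero_in_dual_ball by (cases "box B d = {}") (auto simp: sel_def[of B d])
  next
    fix f :: "'a \<Rightarrow> real" and A assume f: "f \<in> ?K"
    \<comment> \<open>Boxes with base points in \<open>A\<close> see \<open>f\<close> only through
      its values on \<open>A\<close>. The argument therefore runs with all functionals that agree
      with \<open>f\<close> there, and the conclusion names one of them instead of
      \<open>f\<close>.\<close>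
    define C where "C = {g \<in> ?K. \<forall>a\<in>A. g a = f a}"
    have Ceq: "C = ?K \<inter> (\<Inter>a\<in>A. {g. \<bar>g a - f a\<bar> \<le> 0})" by (auto simp: C_def)
    have C: "closed C" "C \<subseteq> ?K" "C \<noteq> {}"
    proof -
      show "closed C" unfolding Ceq by (intro closed_Int closed_INT ballI closed_dual_ball closed_eval_near)
    qed (use f in \<open>auto simp: C_def\<close>)
    define I where "I = least C"
    have I: "I \<in> ?T" "I \<inter> C \<noteq> {}" using least[OF C] by (auto simp: I_def)
    then have FI: "F I \<in> ?T" "F I \<noteq> I" using tower.step F_ne T_sub by blast+
    have "F I \<inter> C = {}"
    proof (rule ccontr)
      assume "F I \<inter> C \<noteq> {}"
      then have "I \<subseteq> F I" unfolding I_def least_def using FI(1) by (auto simp: I_def least_def)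
      then show False using FI F_sub by blast
    qed
    \<comment> \<open>The radius has numerator 2 because two errors of
      \<open>1 / real (Suc m)\<close> add up: from \<open>g\<close> to the centre \<open>r a\<close>
      of the box, and from there to \<open>f a\<close>.\<close>
    define Q where "Q q = {g. \<bar>g (fst q) - f (fst q)\<bar> \<le> 2 / real (Suc (snd q))}" for q :: "'a \<times> nat"
    have "F I \<inter> \<Inter>(Q ` (A \<times> UNIV)) = {}"
    proof (rule ccontr)
      assume "F I \<inter> \<Inter>(Q ` (A \<times> UNIV)) \<noteq> {}"
      then obtain g where g: "g \<in> F I" "\<And>q. q \<in> A \<times> UNIV \<Longrightarrow> g \<in> Q q" by blast
      have "g a = f a" if a: "a \<in> A" for a
      proof -
        have "(\<lambda>m. 2 * inverse (real (Suc m))) \<longlonglongrightarrow> 2 * 0" by (intro tendsto_intros LIMSEQ_inverse_real_of_nat)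
        then have "(\<lambda>m. 2 / real (Suc m)) \<longlonglongrightarrow> 0" by (simp add: divide_inverse)
        moreover have "\<bar>g a - f a\<bar> \<le> 2 / real (Suc m)" for m using g(2)[of "(a, m)"] a by (simp add: Q_def)
        ultimately have "\<bar>g a - f a\<bar> \<le> 0" by (intro LIMSEQ_le_const) auto
        then show ?thesis by simp
      qed
      then have "g \<in> C" using g T_sub[OF FI(1)] by (auto simp: C_def)
      then show False using g \<open>F I \<inter> C = {}\<close> by blast
    qed
    moreover have "compact (F I)"
      using T_closed[OF FI(1)] T_sub[OF FI(1)] compact_dual_ball by (metis compact_Int_closed inf.absorb2)
    moreover have "closed S" if "S \<in> Q ` (A \<times> UNIV)" for S using that closed_eval_near by (auto simp: Q_def)
    ultimately obtain \<S> where S: "finite \<S>" "\<S> \<subseteq> Q ` (A \<times> UNIV)" "F I \<inter> \<Inter>\<S> = {}"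
      using compact_imp_fip[of "F I" "Q ` (A \<times> UNIV)"] by blast
    obtain P where P: "finite P" "P \<subseteq> A \<times> UNIV" "\<S> = Q ` P" using finite_subset_image[OF S(1,2)] by blast
    obtain m where m: "\<And>q. q \<in> P \<Longrightarrow> snd q \<le> m"
      using P(1) finite_nat_set_iff_bounded_le[of "snd ` P"] by auto
    show "\<exists>B m. finite B \<and> B \<subseteq> A \<and>
       (\<forall>r. (\<forall>a\<in>B. \<bar>f a - r a\<bar> \<le> 1 / real (Suc m)) \<longrightarrow>
         (\<exists>g\<in>dual_ball. (\<forall>a\<in>A. g a = f a) \<and>
           (\<forall>h. \<bar>sel ((\<lambda>a. (a, r a)) ` B) (1 / real (Suc m)) h - g h\<bar> \<le> e * norm h)))"
    proof (intro exI[of _ "fst ` P"] exI[of _ m] conjI allI impI)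
      show "finite (fst ` P)" "fst ` P \<subseteq> A" using P by auto
      fix r assume r: "\<forall>a\<in>fst ` P. \<bar>f a - r a\<bar> \<le> 1 / real (Suc m)"
      let ?b = "box ((\<lambda>a. (a, r a)) ` fst ` P) (1 / real (Suc m))"
      have FIb: "F I \<inter> ?b = {}"
      proof (rule ccontr)
        assume "F I \<inter> ?b \<noteq> {}"
        then obtain g where g: "g \<in> F I" "\<And>q. q \<in> P \<Longrightarrow> \<bar>g (fst q) - r (fst q)\<bar> \<le> 1 / real (Suc m)"
          by (auto simp: box_def)
        have "g \<in> Q q" if q: "q \<in> P" for q
        proof -
          have "\<bar>g (fst q) - f (fst q)\<bar> \<le> 1 / real (Suc m) + 1 / real (Suc m)"
            using g(2)[OF q] r q by (smt (verit) imageI)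
          also have "\<dots> = 2 / real (Suc m)" by simp
          also have "\<dots> \<le> 2 / real (Suc (snd q))" using m[OF q] by (intro divide_left_mono) auto
          finally show ?thesis by (simp add: Q_def)
        qed
        then show False using g S P by blast
      qed
      obtain g where g: "g \<in> I" "g \<in> C" using I by blast
      have "g a = f a" if "a \<in> fst ` P" for a using that g(2) P(2) by (auto simp: C_def)
      then have gb: "g \<in> ?b" using g(2) r by (auto simp: C_def box_def)
      then have ne: "?b \<noteq> {}" by blast
      have lT: "least ?b \<in> ?T" "least ?b \<inter> ?b \<noteq> {}" using least[OF box ne] by auto
      \<comment> \<open>\<open>g\<close> witnesses that the box meets \<open>I\<close>, so its last
        layer is inside \<open>I\<close>; were it smaller, it would be inside \<open>F I\<close>,
        which the box avoids. Hence the selected functional and \<open>g\<close> both lie in the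
        slice \<open>I - F I\<close>.\<close>
      have "least ?b \<subseteq> I" unfolding least_def using I(1) g(1) gb by blast
      moreover have "I \<subseteq> least ?b \<or> least ?b \<subseteq> F I" by (rule tower_compare[OF F_sub I(1) lT(1)])
      then have "I \<subseteq> least ?b" using FIb lT(2) by blast
      ultimately have "least ?b = I" by blast
      then have "sel ((\<lambda>a. (a, r a)) ` fst ` P) (1 / real (Suc m)) \<in> I - F I" using sel_in[OF ne] FIb by blast
      moreover have "g \<in> I - F I" using g gb FIb by blast
      ultimately show "\<exists>g\<in>dual_ball. (\<forall>a\<in>A. g a = f a) \<and>
           (\<forall>h. \<bar>sel ((\<lambda>a. (a, r a)) ` fst ` P) (1 / real (Suc m)) h - g h\<bar> \<le> e * norm h)"
        using F_close[OF T_sub[OF I(1)]] g(2) by (intro bexI[of _ g]) (auto simp: C_def)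
    qed
  qed
qed


subsection \<open>Separable reduction\<close>

lemma frechet_normal_coneI:
  assumes "\<And>e. e > 0 \<Longrightarrow> \<exists>\<delta>>0. \<forall>z\<in>\<Omega>. norm (z - x) < \<delta> \<longrightarrow> blinfun_apply f (z - x) \<le> e * norm (z - x)"
  shows "f \<in> frechet_normal_cone \<Omega> x"
proof -
  let ?q = "\<lambda>z. ereal (blinfun_apply f (z - x) / norm (z - x))"
  have "Limsup (at x within \<Omega>) ?q \<le> 0 + ereal e" if e: "e > 0" for e
  proof (rule Limsup_bounded)
    obtain \<delta> where \<delta>: "\<delta> > 0" "\<And>z. z \<in> \<Omega> \<Longrightarrow> norm (z - x) < \<delta> \<Longrightarrow> blinfun_apply f (z - x) \<le> e * norm (z - x)"
      using assms[OF e] by blast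
    have "?q z \<le> 0 + ereal e" if "z \<in> \<Omega>" "z \<noteq> x" "dist z x < \<delta>" for z
      using \<delta>(2)[of z] that by (simp add: dist_norm divide_le_eq)
    then show "\<forall>\<^sub>F z in at x within \<Omega>. ?q z \<le> 0 + ereal e"
      unfolding eventually_at using \<delta>(1) by blast
  qed
  then have "Limsup (at x within \<Omega>) ?q \<le> 0" using ereal_le_epsilon2 by blast
  then show ?thesis by (simp add: frechet_normal_cone_def)
qed

lemma dual_ball_bounded_linear:
  assumes "f \<in> dual_ball" shows "bounded_linear f"
proof -
  have "\<forall>x. norm (f x) \<le> norm x * 1" using dual_ball_le[OF assms] by simp
  then show ?thesis
    using dual_ball_linear[OF assms] unfolding bounded_linear_def bounded_linear_axioms_def by blast
qed

lemma dual_ball_Blinfun: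
  assumes "f \<in> dual_ball"
  shows "blinfun_apply (Blinfun f) = f" "norm (Blinfun f) \<le> 1"
proof -
  show eq: "blinfun_apply (Blinfun f) = f"
    by (rule bounded_linear_Blinfun_apply[OF dual_ball_bounded_linear[OF assms]])
  show "norm (Blinfun f) \<le> 1"
    by (rule norm_blinfun_bound) (use dual_ball_le[OF assms] in \<open>auto simp: eq\<close>)
qed

lemma blinfun_in_dual_ball:
  fixes y :: "'a::real_normed_vector \<Rightarrow>\<^sub>L real"
  assumes "norm y \<le> 1" shows "blinfun_apply y \<in> dual_ball"
proof -
  have "\<bar>blinfun_apply y x\<bar> \<le> norm x" for x
    using norm_blinfun[of y x] mult_right_mono[OF assms norm_ge_zero[of x]] by simp
  then show ?thesis
    by (auto simp: dual_ball_def intro: bounded_linear.linear blinfun.bounded_linear_right)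
qed

text \<open>A countable set can only be closed off under rational multiples; the closure restores
  the real ones.\<close>

lemma subspace_closure_rational:
  fixes A :: "'a::real_normed_vector set"
  assumes "0 \<in> A" and add: "\<And>x y. x \<in> A \<Longrightarrow> y \<in> A \<Longrightarrow> x + y \<in> A"
    and scale: "\<And>q x. q \<in> \<rat> \<Longrightarrow> x \<in> A \<Longrightarrow> q *\<^sub>R x \<in> A"
  shows "subspace (closure A)"
proof (rule subspaceI)
  show "0 \<in> closure A" using assms(1) closure_subset by blast
  show "x + y \<in> closure A" if xy: "x \<in> closure A" "y \<in> closure A" for x y
  proof -
    obtain s t where st: "\<And>k. s k \<in> A" "s \<longlonglongrightarrow> x" "\<And>k. t k \<in> A" "t \<longlonglongrightarrow> y"
      using xy unfolding closure_sequential by blast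
    then have "(\<lambda>k. s k + t k) \<longlonglongrightarrow> x + y" by (intro tendsto_intros)
    then show ?thesis unfolding closure_sequential using st add by (intro exI[of _ "\<lambda>k. s k + t k"]) auto
  qed
  show "c *\<^sub>R x \<in> closure A" if x: "x \<in> closure A" for c :: real and x
  proof -
    obtain s where s: "\<And>k. s k \<in> A" "s \<longlonglongrightarrow> x" using x unfolding closure_sequential by blast
    have "\<exists>q\<in>\<rat>. c < q \<and> q < c + inverse (real (Suc k))" for k
      by (rule Rats_dense_in_real) simp
    then obtain q where q: "\<And>k. q k \<in> \<rat>" "\<And>k. c < q k" "\<And>k. q k < c + inverse (real (Suc k))" by metis
    have "(\<lambda>k. c + inverse (real (Suc k))) \<longlonglongrightarrow> c + 0" by (intro tendsto_intros LIMSEQ_inverse_real_of_nat)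
    then have up: "(\<lambda>k. c + inverse (real (Suc k))) \<longlonglongrightarrow> c" by simp
    have "q \<longlonglongrightarrow> c"
      by (rule tendsto_sandwich[OF _ _ tendsto_const up]) (use q in \<open>auto intro!: always_eventually less_imp_le\<close>)
    then have "(\<lambda>k. q k *\<^sub>R s k) \<longlonglongrightarrow> c *\<^sub>R x" using s by (intro tendsto_intros)
    then show ?thesis unfolding closure_sequential using s q scale by (intro exI[of _ "\<lambda>k. q k *\<^sub>R s k"]) auto
  qed
qed

text \<open>Every closing operation takes finitely many arguments, so a finite subset of the union
  already lies in one of the increasing stages.\<close>

lemma countable_closing_off:
  fixes G :: "'b set \<Rightarrow> 'b set"
  assumes G: "\<And>X. finite X \<Longrightarrow> countable (G X)" and S0: "countable S0"
  obtains S where "S0 \<subseteq> S" "countable S" "\<And>X. finite X \<Longrightarrow> X \<subseteq> S \<Longrightarrow> G X \<subseteq> S"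
proof -
  define N where "N = rec_nat S0 (\<lambda>_ S. S \<union> (\<Union>X\<in>{X. finite X \<and> X \<subseteq> S}. G X))"
  have N: "N 0 = S0" "N (Suc k) = N k \<union> (\<Union>X\<in>{X. finite X \<and> X \<subseteq> N k}. G X)" for k
    by (simp_all add: N_def)
  have "countable (N k)" for k
  proof (induction k)
    case (Suc k)
    have "countable {X. finite X \<and> X \<subseteq> N k}" by (rule countable_Collect_finite_subset[OF Suc])
    then have "countable (\<Union>X\<in>{X. finite X \<and> X \<subseteq> N k}. G X)" using G by (intro countable_UN) auto
    then show ?case unfolding N using Suc by simp
  qed (simp add: N S0)
  moreover have mono: "N k \<subseteq> N m" if "k \<le> m" for k m
    using that by (induction rule: dec_induct) (auto simp: N)
  have stage: "\<exists>k. X \<subseteq> N k" if "finite X" "X \<subseteq> (\<Union>k. N k)" for X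
    using that
  proof induction
    case (insert x X)
    then obtain k m where "X \<subseteq> N k" "x \<in> N m" by blast
    then have "insert x X \<subseteq> N (max k m)" using mono[of k "max k m"] mono[of m "max k m"] by auto
    then show ?case by blast
  qed simp
  have "G X \<subseteq> (\<Union>k. N k)" if X: "finite X" "X \<subseteq> (\<Union>k. N k)" for X
  proof -
    obtain k where "X \<subseteq> N k" using stage[OF X] by blast
    then have "G X \<subseteq> N (Suc k)" unfolding N using X(1) by blast
    then show ?thesis by blast
  qed
  moreover have "S0 \<subseteq> (\<Union>k. N k)" using N(1) by blast
  ultimately show ?thesis by (intro that[of "\<Union>k. N k"]) auto
qed

text \<open>A countable set \<open>A\<close> of points and a countable set \<open>D\<close> of
  functionals are closed off against each other; \<open>V\<close> and \<open>Y\<close> are their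
  closures. Nearly norming vectors make restriction from \<open>Y\<close> to \<open>V\<close>
  isometric, the selections make \<open>D\<close> dense in the dual of \<open>V\<close>, and stored
  witnesses let any failure of Frechet normality be seen inside \<open>V\<close>.\<close>

theorem asplund_separable_reduction:
  fixes \<Omega> :: "nat \<Rightarrow> 'a::banach set"
  assumes asp: "asplund TYPE('a)" and A0: "countable A0"
  obtains V :: "'a set" and Y :: "('a \<Rightarrow>\<^sub>L real) set" and ys :: "nat \<Rightarrow> 'a \<Rightarrow> real" where
    "closed V" "subspace V" "A0 \<subseteq> V" "closed Y" "subspace Y"
    "\<And>k. ys k \<in> dual_ball"
    "\<And>f e. f \<in> dual_ball \<Longrightarrow> e > 0 \<Longrightarrow> \<exists>k. \<forall>x\<in>V. \<bar>f x - ys k x\<bar> \<le> e * norm x"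
    "\<And>f. f \<in> dual_ball \<Longrightarrow> \<exists>y\<in>Y. norm y \<le> 1 \<and> (\<forall>x\<in>V. blinfun_apply y x = f x)"
    "\<And>i x y. x \<in> V \<Longrightarrow> y \<in> Y \<Longrightarrow>
      (\<And>e. e > 0 \<Longrightarrow> \<exists>\<delta>>0. \<forall>z\<in>\<Omega> i \<inter> V. norm (z - x) < \<delta> \<longrightarrow> blinfun_apply y (z - x) \<le> e * norm (z - x)) \<Longrightarrow>
      y \<in> frechet_normal_cone (\<Omega> i) x"
proof -
  define Q :: "nat \<Rightarrow> (('a \<times> real) set \<Rightarrow> real \<Rightarrow> 'a \<Rightarrow> real) \<Rightarrow> bool" where
    "Q k sel \<longleftrightarrow> (\<forall>B d. sel B d \<in> dual_ball) \<and>
    (\<forall>f A. f \<in> dual_ball \<longrightarrow> (\<exists>B m. finite B \<and> B \<subseteq> A \<and>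
       (\<forall>r. (\<forall>a\<in>B. \<bar>f a - r a\<bar> \<le> 1 / real (Suc m)) \<longrightarrow>
         (\<exists>g\<in>dual_ball. (\<forall>a\<in>A. g a = f a) \<and>
           (\<forall>h. \<bar>sel ((\<lambda>a. (a, r a)) ` B) (1 / real (Suc m)) h - g h\<bar> \<le> (1 / real (Suc k)) * norm h)))))"
    for k sel
  have "\<exists>sel. Q k sel" for k
  proof -
    have "(0::real) < 1 / real (Suc k)" by simp
    then show ?thesis
    proof (rule asplund_selection[OF asp], goal_cases)
      case (1 sel)
      show ?case unfolding Q_def by (intro exI[of _ sel] conjI allI impI 1)
    qed
  qed
  then obtain sel where Q: "\<And>k. Q k (sel k)" by metis
  have sel_ball: "\<And>k B d. sel k B d \<in> dual_ball"
    using Q unfolding Q_def by blast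
  have sel: "\<exists>B m. finite B \<and> B \<subseteq> A \<and>
       (\<forall>r. (\<forall>a\<in>B. \<bar>f a - r a\<bar> \<le> 1 / real (Suc m)) \<longrightarrow>
         (\<exists>g\<in>dual_ball. (\<forall>a\<in>A. g a = f a) \<and>
           (\<forall>h. \<bar>sel k ((\<lambda>a. (a, r a)) ` B) (1 / real (Suc m)) h - g h\<bar> \<le> (1 / real (Suc k)) * norm h)))"
    if "f \<in> dual_ball" for f A k
    using Q[of k, unfolded Q_def, THEN conjunct2, rule_format, OF that] .
  have "\<forall>(y :: 'a \<Rightarrow>\<^sub>L real) k. \<exists>x. norm x \<le> 1 \<and> norm y - 1 / real (Suc k) < blinfun_apply y x"
  proof (intro allI)
    fix y :: "'a \<Rightarrow>\<^sub>L real" and k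
    have "(0::real) < 1 / real (Suc k)" by simp
    from norm_pos_attain[OF this, of y] show "\<exists>x. norm x \<le> 1 \<and> norm y - 1 / real (Suc k) < blinfun_apply y x" by blast
  qed
  then obtain nrm :: "('a \<Rightarrow>\<^sub>L real) \<Rightarrow> nat \<Rightarrow> 'a" where
    nrm: "\<And>y k. norm (nrm y k) \<le> 1" "\<And>y k. norm y - 1 / real (Suc k) < blinfun_apply y (nrm y k)" by metis
  \<comment> \<open>A witness against normality near \<open>a\<close>. Its parameters will be taken
    from countable sets, with \<open>r\<close> and \<open>b\<close> rational, so countably many
    witnesses suffice; the choice is meaningful only if some witness exists.\<close>
  define pick where "pick i a y r b = (SOME z. z \<in> \<Omega> i \<and> norm (z - a) < r \<and> blinfun_apply y (z - a) > b)"
    for i a and y :: "'a \<Rightarrow>\<^sub>L real" and r b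
  have pick: "pick i a y r b \<in> \<Omega> i \<and> norm (pick i a y r b - a) < r \<and> blinfun_apply y (pick i a y r b - a) > b"
    if "z \<in> \<Omega> i" "norm (z - a) < r" "blinfun_apply y (z - a) > b" for i a y r b z
    unfolding pick_def by (rule someI[of _ z]) (use that in simp)
  define as where "as X = {a. (Inl a :: 'a + ('a \<Rightarrow>\<^sub>L real)) \<in> X}" for X
  define bs where "bs X = {y. (Inr y :: 'a + ('a \<Rightarrow>\<^sub>L real)) \<in> X}" for X
  \<comment> \<open>The sum type lets one closing-off treat points (\<open>Inl\<close>) and
    functionals (\<open>Inr\<close>) at once. Selections need finite rational boxes over the points
    already present.\<close>
  define G where "G X = (\<lambda>(a, b). Inl (a + b)) ` (as X \<times> as X) \<union> (\<lambda>(q, a). Inl (q *\<^sub>R a)) ` (\<rat> \<times> as X) \<union>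
     ((\<lambda>(a, b). Inr (a + b)) ` (bs X \<times> bs X) \<union> (\<lambda>(q, a). Inr (q *\<^sub>R a)) ` (\<rat> \<times> bs X)) \<union>
     ((\<lambda>(y, k). Inl (nrm y k)) ` (bs X \<times> UNIV) \<union>
     (\<lambda>(B, k, m). Inr (Blinfun (sel k B (1 / real (Suc m))))) ` ({B. finite B \<and> B \<subseteq> as X \<times> \<rat>} \<times> UNIV \<times> UNIV) \<union>
     (\<lambda>(a, y, i, r, b). Inl (pick i a y r b)) ` (as X \<times> bs X \<times> UNIV \<times> \<rat> \<times> \<rat>))" for X
  have "countable (G X)" if X: "finite X" for X
  proof -
    have "as X = Inl -` X" "bs X = Inr -` X" by (auto simp: as_def bs_def)
    then have "countable (as X)" "countable (bs X)"
      using finite_vimageI[OF X inj_Inl] finite_vimageI[OF X inj_Inr] by (simp_all add: countable_finite)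
    moreover from this have "countable {B. finite B \<and> B \<subseteq> as X \<times> \<rat>}"
      by (intro countable_Collect_finite_subset countable_SIGMA countable_rat)
    ultimately show ?thesis unfolding G_def
      by (intro countable_Un countable_image countable_SIGMA countable_rat) auto
  qed
  moreover have "countable (insert (Inl 0) (insert (Inr 0) (Inl ` A0)) :: ('a + ('a \<Rightarrow>\<^sub>L real)) set)" using A0 by simp
  ultimately obtain S where S: "insert (Inl 0) (insert (Inr 0) (Inl ` A0)) \<subseteq> S" "countable S"
    "\<And>X. finite X \<Longrightarrow> X \<subseteq> S \<Longrightarrow> G X \<subseteq> S" using countable_closing_off[where G = G] by metis
  define A where "A = as S"
  define D where "D = bs S"
  have A_add: "a + b \<in> A" if "a \<in> A" "b \<in> A" for a b
    using S(3)[of "{Inl a, Inl b}"] that by (auto simp: A_def as_def G_def)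
  have A_scale: "q *\<^sub>R a \<in> A" if "q \<in> \<rat>" "a \<in> A" for q a
    using S(3)[of "{Inl a}"] that by (auto simp: A_def as_def G_def)
  have D_add: "a + b \<in> D" if "a \<in> D" "b \<in> D" for a b
    using S(3)[of "{Inr a, Inr b}"] that by (auto simp: D_def bs_def G_def)
  have D_scale: "q *\<^sub>R a \<in> D" if "q \<in> \<rat>" "a \<in> D" for q a
    using S(3)[of "{Inr a}"] that by (auto simp: D_def bs_def G_def)
  have A_nrm: "nrm y k \<in> A" if "y \<in> D" for y k
    using S(3)[of "{Inr y}"] that by (auto simp: D_def A_def as_def bs_def G_def)
  have A_pick: "pick i a y r b \<in> A" if "a \<in> A" "y \<in> D" "r \<in> \<rat>" "b \<in> \<rat>" for i a y r b
  proof -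
    have "G {Inl a, Inr y} \<subseteq> S" using that by (intro S(3)) (auto simp: A_def D_def as_def bs_def)
    moreover have "Inl (pick i a y r b) \<in> G {Inl a, Inr y}"
      unfolding G_def using that by (intro UnI2) (auto simp: as_def bs_def image_iff)
    ultimately show ?thesis by (auto simp: A_def as_def)
  qed
  have D_sel: "Blinfun (sel k B (1 / real (Suc m))) \<in> D" if B: "finite B" "B \<subseteq> A \<times> \<rat>" for k m B
  proof -
    let ?X = "Inl ` fst ` B :: ('a + ('a \<Rightarrow>\<^sub>L real)) set"
    have "G ?X \<subseteq> S" using B by (intro S(3)) (auto simp: A_def as_def)
    moreover have "Inr (Blinfun (sel k B (1 / real (Suc m)))) \<in> G ?X"
    proof -
      have "B \<subseteq> as ?X \<times> \<rat>" using B(2) by (force simp: as_def)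
      then have "(B, k, m) \<in> {B. finite B \<and> B \<subseteq> as ?X \<times> \<rat>} \<times> UNIV \<times> UNIV" using B(1) by simp
      then have "Inr (Blinfun (sel k B (1 / real (Suc m)))) \<in>
         (\<lambda>(B, k, m). Inr (Blinfun (sel k B (1 / real (Suc m))))) ` ({B. finite B \<and> B \<subseteq> as ?X \<times> \<rat>} \<times> UNIV \<times> UNIV)"
        by (rule rev_image_eqI) simp
      then show ?thesis unfolding G_def by blast
    qed
    ultimately show ?thesis by (auto simp: D_def bs_def)
  qed
  define V where "V = closure A"
  define Y where "Y = closure D"
  have AV: "A \<subseteq> V" and DY: "D \<subseteq> Y" by (auto simp: V_def Y_def closure_subset)
  have V: "closed V" "subspace V" "A0 \<subseteq> V"
  proof -
    show "subspace V" unfolding V_def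
      by (rule subspace_closure_rational) (use S(1) A_add A_scale in \<open>auto simp: A_def as_def\<close>)
    show "A0 \<subseteq> V" using S(1) AV by (auto simp: A_def as_def)
  qed (simp add: V_def)
  have Y: "closed Y" "subspace Y"
  proof -
    show "subspace Y" unfolding Y_def
      by (rule subspace_closure_rational) (use S(1) D_add D_scale in \<open>auto simp: D_def bs_def\<close>)
  qed (simp add: Y_def)
  \<comment> \<open>A bound on \<open>V\<close> is a bound in norm for functionals of
    \<open>Y\<close>: they are approximated by functionals of \<open>D\<close>, whose nearly norming
    vectors lie in \<open>A\<close>.\<close>
  have norm_le: "norm y \<le> c" if y: "y \<in> Y" and c: "\<And>x. x \<in> V \<Longrightarrow> \<bar>blinfun_apply y x\<bar> \<le> c * norm x" "0 \<le> c" for y c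
  proof (rule field_le_epsilon)
    fix e :: real assume e: "e > 0"
    then obtain y' where y': "y' \<in> D" "dist y' y < e / 3"
      using y unfolding Y_def closure_approachable by (metis zero_less_divide_iff zero_less_numeral)
    obtain k where k: "inverse (real (Suc k)) < e / 3" using reals_Archimedean[of "e / 3"] e by auto
    let ?x = "nrm y' k"
    have "norm y' - e / 3 < blinfun_apply y' ?x" using nrm(2)[of y' k] k by (simp add: inverse_eq_divide)
    also have "\<dots> = blinfun_apply y ?x + blinfun_apply (y' - y) ?x" by (simp add: blinfun.diff_left)
    also have "\<dots> \<le> c * norm ?x + norm (y' - y) * norm ?x"
    proof (intro add_mono)
      show "blinfun_apply y ?x \<le> c * norm ?x" using c(1)[of ?x] A_nrm[OF y'(1)] AV by (auto simp: abs_le_iff)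
      show "blinfun_apply (y' - y) ?x \<le> norm (y' - y) * norm ?x" using norm_blinfun[of "y' - y" ?x] by simp
    qed
    also have "\<dots> \<le> c * 1 + e / 3 * 1"
      using nrm(1)[of y' k] y'(2) c(2) e by (intro add_mono mult_mono) (auto simp: dist_norm)
    finally have "norm y' < c + e / 3 + e / 3" by simp
    moreover have "norm y \<le> norm y' + e / 3"
      using norm_triangle_ineq2[of y y'] y'(2) by (simp add: dist_norm norm_minus_commute)
    ultimately show "norm y \<le> c + e" by simp
  qed
  have approx: "\<exists>y\<in>D. norm y \<le> 1 \<and> (\<forall>x\<in>V. \<bar>f x - blinfun_apply y x\<bar> \<le> 1 / real (Suc k) * norm x)"
    if f: "f \<in> dual_ball" for f k
  proof -
    obtain B m where B: "finite B" "B \<subseteq> A" and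
      r: "\<And>r. (\<forall>a\<in>B. \<bar>f a - r a\<bar> \<le> 1 / real (Suc m)) \<Longrightarrow>
         (\<exists>g\<in>dual_ball. (\<forall>a\<in>A. g a = f a) \<and>
           (\<forall>h. \<bar>sel k ((\<lambda>a. (a, r a)) ` B) (1 / real (Suc m)) h - g h\<bar> \<le> (1 / real (Suc k)) * norm h))"
      using sel[OF f, of A k] by blast
    \<comment> \<open>Rational centres keep the box among the countably many that were closed off;
      the tolerance in the selection theorem permits moving from \<open>f a\<close> to
      \<open>q a\<close>.\<close>
    have "\<exists>q\<in>\<rat>. f a < q \<and> q < f a + 1 / real (Suc m)" for a by (rule Rats_dense_in_real) simp
    then obtain q where q: "\<And>a. q a \<in> \<rat>" "\<And>a. f a < q a" "\<And>a. q a < f a + 1 / real (Suc m)" by metis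
    have "\<bar>f a - q a\<bar> \<le> 1 / real (Suc m)" for a using q(2,3)[of a] by (simp add: abs_le_iff)
    then obtain g where g: "g \<in> dual_ball" "\<And>a. a \<in> A \<Longrightarrow> g a = f a"
      "\<And>h. \<bar>sel k ((\<lambda>a. (a, q a)) ` B) (1 / real (Suc m)) h - g h\<bar> \<le> (1 / real (Suc k)) * norm h"
      using r[of q] by blast
    let ?B = "(\<lambda>a. (a, q a)) ` B"
    let ?y = "Blinfun (sel k ?B (1 / real (Suc m)))"
    have "closed {x. g x = f x}"
      using g(1) f dual_ball_bounded_linear linear_continuous_on by (intro closed_Collect_eq) blast+
    then have "V \<subseteq> {x. g x = f x}" unfolding V_def using g(2) by (intro closure_minimal) auto
    then have "\<bar>f x - blinfun_apply ?y x\<bar> \<le> 1 / real (Suc k) * norm x" if "x \<in> V" for x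
      using g(3)[of x] that by (auto simp: dual_ball_Blinfun[OF sel_ball] abs_minus_commute)
    moreover have "?y \<in> D" by (rule D_sel) (use B q in auto)
    moreover have "norm ?y \<le> 1" by (rule dual_ball_Blinfun[OF sel_ball])
    ultimately show ?thesis by blast
  qed
  define D1 where "D1 = blinfun_apply ` {y \<in> D. norm y \<le> 1}"
  have "countable D"
  proof -
    have "Inr ` D \<subseteq> S" by (auto simp: D_def bs_def)
    then have "countable (Inr ` D :: ('a + ('a \<Rightarrow>\<^sub>L real)) set)" using S(2) by (rule countable_subset)
    then show ?thesis by (rule countable_image_inj_on) simp
  qed
  then have cD1: "countable D1" by (simp add: D1_def)
  have neD1: "D1 \<noteq> {}" using S(1) by (auto simp: D1_def D_def bs_def intro!: exI[of _ 0])
  define ys where "ys = from_nat_into D1"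
  have ys_ball: "ys k \<in> dual_ball" for k
    using from_nat_into[OF neD1, of k] by (auto simp: ys_def D1_def intro: blinfun_in_dual_ball)
  have ys_dense: "\<exists>k. \<forall>x\<in>V. \<bar>f x - ys k x\<bar> \<le> e * norm x" if f: "f \<in> dual_ball" and e: "e > 0" for f e
  proof -
    obtain k where k: "inverse (real (Suc k)) < e" using reals_Archimedean[OF e] by auto
    obtain y where y: "y \<in> D" "norm y \<le> 1" "\<And>x. x \<in> V \<Longrightarrow> \<bar>f x - blinfun_apply y x\<bar> \<le> 1 / real (Suc k) * norm x"
      using approx[OF f, of k] by blast
    have "blinfun_apply y \<in> D1" using y by (simp add: D1_def)
    then obtain m where m: "ys m = blinfun_apply y" using from_nat_into_surj[OF cD1] by (auto simp: ys_def)
    have "\<bar>f x - ys m x\<bar> \<le> e * norm x" if "x \<in> V" for x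
    proof -
      have "1 / real (Suc k) * norm x \<le> e * norm x" using k by (intro mult_right_mono) (auto simp: inverse_eq_divide)
      then show ?thesis using y(3)[OF that] m by simp
    qed
    then show ?thesis by blast
  qed
  have lift: "\<exists>y\<in>Y. norm y \<le> 1 \<and> (\<forall>x\<in>V. blinfun_apply y x = f x)" if f: "f \<in> dual_ball" for f
  proof -
    obtain y where y: "\<And>k. y k \<in> D" "\<And>k. norm (y k) \<le> 1"
      "\<And>k x. x \<in> V \<Longrightarrow> \<bar>f x - blinfun_apply (y k) x\<bar> \<le> 1 / real (Suc k) * norm x"
      using approx[OF f] by metis
    \<comment> \<open>The approximants are mutually close only on \<open>V\<close>; since their
      differences lie in \<open>Y\<close>, \<open>norm_le\<close> makes them close in norm.\<close>
    have "Cauchy y"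
    proof (rule CauchyI)
      fix e :: real assume e: "e > 0"
      obtain M where M: "inverse (real (Suc M)) < e / 3" using reals_Archimedean[of "e / 3"] e by auto
      have "norm (y k - y m) < e" if km: "k \<ge> M" "m \<ge> M" for k m
      proof -
        have "norm (y k - y m) \<le> 2 * (1 / real (Suc M))"
        proof (rule norm_le)
          show "y k - y m \<in> Y" using y(1) DY Y(2) by (intro subspace_diff) auto
          fix x assume x: "x \<in> V"
          have "\<bar>f x - blinfun_apply (y j) x\<bar> \<le> 1 / real (Suc M) * norm x" if "j \<ge> M" for j
          proof -
            have "1 / real (Suc j) * norm x \<le> 1 / real (Suc M) * norm x"
              using that by (intro mult_right_mono divide_left_mono) auto
            then show ?thesis using y(3)[OF x, of j] by linarith
          qed
          from this[OF km(1)] this[OF km(2)]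
          show "\<bar>blinfun_apply (y k - y m) x\<bar> \<le> 2 * (1 / real (Suc M)) * norm x"
            by (simp add: blinfun.diff_left)
        qed simp
        also have "\<dots> < e" using M e by (simp add: inverse_eq_divide)
        finally show ?thesis .
      qed
      then show "\<exists>M. \<forall>m\<ge>M. \<forall>n\<ge>M. norm (y m - y n) < e" by blast
    qed
    then obtain z where z: "y \<longlonglongrightarrow> z" using Cauchy_convergent convergentD by blast
    have zY: "z \<in> Y" using z y(1) DY Y(1) by (meson closed_sequentially subsetD)
    have eq: "blinfun_apply z x = f x" if x: "x \<in> V" for x
    proof -
      have "(\<lambda>k. blinfun_apply (y k) x) \<longlonglongrightarrow> blinfun_apply z x" using z by (intro tendsto_intros)
      moreover have "(\<lambda>k. blinfun_apply (y k) x) \<longlonglongrightarrow> f x"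
      proof (rule LIM_zero_cancel, rule Lim_null_comparison)
        show "\<forall>\<^sub>F k in sequentially. norm (blinfun_apply (y k) x - f x) \<le> inverse (real (Suc k)) * norm x"
          using y(3)[OF x] by (intro always_eventually) (auto simp: inverse_eq_divide abs_minus_commute)
        have "(\<lambda>k. inverse (real (Suc k)) * norm x) \<longlonglongrightarrow> 0 * norm x" by (intro tendsto_intros LIMSEQ_inverse_real_of_nat)
        then show "(\<lambda>k. inverse (real (Suc k)) * norm x) \<longlonglongrightarrow> 0" by simp
      qed
      ultimately show ?thesis by (rule LIMSEQ_unique)
    qed
    moreover have "norm z \<le> 1" by (rule norm_le[OF zY]) (use eq dual_ball_le[OF f] in auto)
    ultimately show ?thesis using zY by blast
  qed
  have normal: "y \<in> frechet_normal_cone (\<Omega> i) x" if x: "x \<in> V" and y: "y \<in> Y"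
    and loc: "\<And>e. e > 0 \<Longrightarrow> \<exists>\<delta>>0. \<forall>z\<in>\<Omega> i \<inter> V. norm (z - x) < \<delta> \<longrightarrow> blinfun_apply y (z - x) \<le> e * norm (z - x)" for i x y
  proof (rule frechet_normal_coneI)
    fix e :: real assume e: "e > 0"
    \<comment> \<open>The replacement \<open>z'\<close> found in \<open>V\<close> may be four times
      as far from \<open>x\<close> as \<open>z\<close>. This explains \<open>\<delta> / 4\<close>
      below, and \<open>e / 8\<close> makes the value at \<open>z'\<close> at most half of
      \<open>e * norm (z - x)\<close>.\<close>
    obtain \<delta> where \<delta>: "\<delta> > 0" "\<And>z. z \<in> \<Omega> i \<Longrightarrow> z \<in> V \<Longrightarrow> norm (z - x) < \<delta> \<Longrightarrow> blinfun_apply y (z - x) \<le> (e / 8) * norm (z - x)"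
      using loc[of "e / 8"] e by auto
    show "\<exists>\<delta>>0. \<forall>z\<in>\<Omega> i. norm (z - x) < \<delta> \<longrightarrow> blinfun_apply y (z - x) \<le> e * norm (z - x)"
    proof (intro exI[of _ "\<delta> / 4"] conjI ballI impI)
      show "0 < \<delta> / 4" using \<delta>(1) by simp
      fix z assume z: "z \<in> \<Omega> i" "norm (z - x) < \<delta> / 4"
      show "blinfun_apply y (z - x) \<le> e * norm (z - x)"
      proof (rule ccontr)
        assume neg: "\<not> blinfun_apply y (z - x) \<le> e * norm (z - x)"
        define s where "s = norm (z - x)"
        define K where "K = norm y"
        have s: "s > 0" using neg by (auto simp: s_def blinfun.zero_right)
        \<comment> \<open>Exchanging \<open>y\<close> and \<open>y'\<close> costs at most
          \<open>3 * \<tau> * s\<close> and exchanging the base points \<open>x\<close> and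
          \<open>a\<close> at most \<open>K * \<tau> * s\<close>. Both happen twice, for
          \<open>z\<close> and for \<open>z'\<close>; the 7 in place of 6 is slack.\<close>
        define \<tau> where "\<tau> = min 1 (e / (4 * (2 * K + 7)))"
        have K: "K \<ge> 0" by (simp add: K_def)
        have \<tau>: "\<tau> > 0" "\<tau> \<le> 1" using e K by (auto simp: \<tau>_def)
        have "\<tau> \<le> e / (4 * (2 * K + 7))" by (simp add: \<tau>_def)
        then have \<tau>e: "\<tau> * (2 * K + 7) \<le> e / 4" using K by (simp add: field_simps)
        have ts: "\<tau> * s > 0" using \<tau> s by simp
        obtain a where a: "a \<in> A" "norm (a - x) < \<tau> * s"
          using x ts unfolding V_def closure_approachable dist_norm by blast
        obtain y' where y': "y' \<in> D" "norm (y' - y) < \<tau>"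
          using y \<tau>(1) unfolding Y_def closure_approachable dist_norm by blast
        have za: "norm (z - a) < s + \<tau> * s"
          using norm_triangle_ineq4[of "z - x" "a - x"] a(2) by (simp add: s_def)
        obtain r where r: "r \<in> \<rat>" "s + \<tau> * s < r" "r < s + \<tau> * s + \<tau> * s"
          using Rats_dense_in_real[of "s + \<tau> * s" "s + \<tau> * s + \<tau> * s"] ts by auto
        have ts_le: "\<tau> * s \<le> s" using mult_right_mono[OF \<tau>(2), of s] s by simp
        then have r3: "r < 3 * s" using r(3) by linarith
        have diff: "\<bar>blinfun_apply y' h - blinfun_apply y h\<bar> \<le> \<tau> * norm h" for h
        proof -
          have "\<bar>blinfun_apply (y' - y) h\<bar> \<le> norm (y' - y) * norm h" using norm_blinfun[of "y' - y" h] by simp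
          also have "\<dots> \<le> \<tau> * norm h" using y'(2) by (intro mult_right_mono) auto
          finally show ?thesis by (simp add: blinfun.diff_left)
        qed
        have ya: "\<bar>blinfun_apply y (a - x)\<bar> \<le> K * (\<tau> * s)"
        proof -
          have "\<bar>blinfun_apply y (a - x)\<bar> \<le> K * norm (a - x)" using norm_blinfun[of y "a - x"] by (simp add: K_def)
          also have "\<dots> \<le> K * (\<tau> * s)" using a(2) K by (intro mult_left_mono) auto
          finally show ?thesis .
        qed
        have split: "blinfun_apply y (h - x) = blinfun_apply y (h - a) + blinfun_apply y (a - x)" for h
          by (simp add: blinfun.diff_right)
        have r\<tau>: "\<tau> * norm h \<le> \<tau> * (3 * s)" if "norm h < r" for h :: 'a
          using that r3 \<tau> by (intro mult_left_mono) auto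
        have "blinfun_apply y' (z - a) > e * s - K * (\<tau> * s) - \<tau> * (3 * s)"
        proof -
          have "blinfun_apply y (z - a) > e * s - K * (\<tau> * s)"
            using neg ya split[of z] by (simp add: s_def abs_le_iff)
          then show ?thesis using diff[of "z - a"] r\<tau>[of "z - a"] za r(2) by (simp add: abs_le_iff)
        qed
        then obtain b where b: "b \<in> \<rat>" "e * s - K * (\<tau> * s) - \<tau> * (3 * s) < b" "b < blinfun_apply y' (z - a)"
          using Rats_dense_in_real by blast
        define z' where "z' = pick i a y' r b"
        have z': "z' \<in> \<Omega> i" "norm (z' - a) < r" "blinfun_apply y' (z' - a) > b"
          using pick[of z i a r b y'] z(1) za r(2) b(3) by (auto simp: z'_def)
        have "z' \<in> V" using A_pick[OF a(1) y'(1) r(1) b(1)] AV by (auto simp: z'_def)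
        have n4: "norm (z' - x) \<le> 4 * s"
        proof -
          have "norm (z' - x) \<le> norm (z' - a) + norm (a - x)" using norm_triangle_ineq[of "z' - a" "a - x"] by simp
          then show ?thesis using z'(2) r3 a(2) ts_le by linarith
        qed
        then have "norm (z' - x) < \<delta>" using z(2) by (simp add: s_def)
        then have "blinfun_apply y (z' - x) \<le> (e / 8) * norm (z' - x)" using \<delta>(2) z'(1) \<open>z' \<in> V\<close> by blast
        also have "\<dots> \<le> (e / 8) * (4 * s)" using n4 e by (intro mult_left_mono) auto
        finally have "blinfun_apply y (z' - x) \<le> e * s / 2" by simp
        moreover have "blinfun_apply y (z' - x) > e * s - K * (\<tau> * s) - \<tau> * (3 * s) - \<tau> * (3 * s) - K * (\<tau> * s)"
          using z'(3) b(2) diff[of "z' - a"] r\<tau>[OF z'(2)] ya split[of z'] by (simp add: abs_le_iff)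
        moreover have "(\<tau> * (2 * K + 7)) * s \<le> (e / 4) * s" using \<tau>e s by (intro mult_right_mono) auto
        moreover have "e * s > 0" using e s by simp
        ultimately show False using ts by (simp add: algebra_simps)
      qed
    qed
  qed
  show ?thesis by (rule that[of V Y ys]) (use V Y ys_ball ys_dense lift normal in blast)+
qed


subsection \<open>Smooth approximation of the norm\<close>

text \<open>\<open>\<psi>\<close> is the conjugate of \<open>\<theta>\<close> on the dual ball,
  hence differentiable where near-maximisers converge in norm on \<open>V\<close>. If
  \<open>g\<close> is a near-maximiser and \<open>f\<close> a maximiser at the same point, each
  \<open>q k g\<close> is close to \<open>q k f\<close>. Density supplies a \<open>k\<close> with
  \<open>q k f\<close> small, so both functionals are close to \<open>ys k\<close> on
  \<open>V\<close>. The bounds \<open>0 \<le> \<theta> \<le> 1\<close> give the uniform error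
  1.\<close>

theorem smooth_norm_approximation:
  fixes V :: "'a::real_normed_vector set" and Y :: "('a \<Rightarrow>\<^sub>L real) set" and ys :: "nat \<Rightarrow> 'a \<Rightarrow> real"
  assumes V0: "0 \<in> V" and Vscale: "\<And>c x. x \<in> V \<Longrightarrow> c *\<^sub>R x \<in> V" and Vdiff: "\<And>x y. x \<in> V \<Longrightarrow> y \<in> V \<Longrightarrow> x - y \<in> V"
    and ys: "\<And>k. ys k \<in> dual_ball"
    and dense: "\<And>f e. f \<in> dual_ball \<Longrightarrow> e > 0 \<Longrightarrow> \<exists>k. \<forall>x\<in>V. \<bar>f x - ys k x\<bar> \<le> e * norm x"
    and lift: "\<And>f. f \<in> dual_ball \<Longrightarrow> \<exists>y\<in>Y. norm y \<le> 1 \<and> (\<forall>x\<in>V. blinfun_apply y x = f x)"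
  obtains \<psi> :: "'a \<Rightarrow> real" where "\<And>x. norm x - 1 \<le> \<psi> x" "\<And>x. \<psi> x \<le> norm x"
    "\<And>x y. \<bar>\<psi> x - \<psi> y\<bar> \<le> norm (x - y)"
    "\<And>x. x \<in> V \<Longrightarrow> \<exists>y\<in>Y. norm y \<le> 1 \<and> norm x - 1 \<le> blinfun_apply y x \<and>
       (\<psi> has_derivative blinfun_apply y) (at x within V)"
proof -
  let ?K = "dual_ball :: ('a \<Rightarrow> real) set"
  define B where "B = {x \<in> V. norm x \<le> 1}"
  have B0: "0 \<in> B" using V0 by (simp add: B_def)
  define q where "q k f = (SUP x\<in>B. \<bar>f x - ys k x\<bar>)" for k and f :: "'a \<Rightarrow> real"
  have diff2: "\<bar>f x - ys k x\<bar> \<le> 2 * norm x" if "f \<in> ?K" for f k x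
    using dual_ball_le[OF that, of x] dual_ball_le[OF ys, of k x] by linarith
  have diff_B: "\<bar>f x - ys k x\<bar> \<le> 2" if "f \<in> ?K" "x \<in> B" for f k x
    using diff2[OF that(1), of x k] that(2) by (simp add: B_def)
  have bdd: "bdd_above ((\<lambda>x. \<bar>f x - ys k x\<bar>) ` B)" if f: "f \<in> ?K" for f k
    by (rule bdd_aboveI2[of _ _ 2]) (rule diff_B[OF f])
  have q_upper: "\<bar>f x - ys k x\<bar> \<le> q k f" if "f \<in> ?K" "x \<in> B" for f k x
    unfolding q_def by (rule cSUP_upper[OF that(2) bdd[OF that(1)]])
  have q_nonneg: "0 \<le> q k f" if "f \<in> ?K" for f k
    using q_upper[OF that B0, of k] by linarith
  have q_bound: "\<bar>f x - ys k x\<bar> \<le> q k f * norm x" if f: "f \<in> ?K" and x: "x \<in> V" for f k x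
  proof (cases "x = 0")
    case True
    then show ?thesis using linear_0[OF dual_ball_linear[OF f]] linear_0[OF dual_ball_linear[OF ys]] by simp
  next
    case False
    let ?u = "inverse (norm x) *\<^sub>R x"
    have "?u \<in> B" using x Vscale False by (simp add: B_def)
    then have "\<bar>f ?u - ys k ?u\<bar> \<le> q k f" by (rule q_upper[OF f])
    moreover have "f ?u - ys k ?u = inverse (norm x) * (f x - ys k x)"
      using linear_scale[OF dual_ball_linear[OF f]] linear_scale[OF dual_ball_linear[OF ys]]
      by (simp add: right_diff_distrib)
    ultimately have "inverse (norm x) * \<bar>f x - ys k x\<bar> \<le> q k f" by (simp add: abs_mult del: inverse_eq_divide)
    then show ?thesis using False by (simp add: field_simps)
  qed
  have q_least: "q k f \<le> c" if "\<And>x. x \<in> B \<Longrightarrow> \<bar>f x - ys k x\<bar> \<le> c" for f k c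
    unfolding q_def by (rule cSUP_least) (use B0 that in auto)
  have q_le2: "q k f \<le> 2" if "f \<in> ?K" for f k
    by (rule q_least) (rule diff_B[OF that])
  have q_attain: "\<exists>x\<in>B. a < \<bar>f x - ys k x\<bar>" if "a < q k f" "f \<in> ?K" for a k f
    using that(1) less_cSUP_iff[OF _ bdd[OF that(2)]] B0 unfolding q_def by blast
  \<comment> \<open>As \<open>q k\<close> is at most 2 on the dual ball, its square is at most 4;
    the weights times 4 sum to 1, which gives \<open>\<theta> \<le> 1\<close>.\<close>
  define w :: "nat \<Rightarrow> real" where "w k = (1/2) ^ Suc k / 4" for k
  have w: "w k > 0" for k by (simp add: w_def)
  have w_sums: "(\<lambda>k. w k * 4) sums 1"
    using power_half_series by (simp add: w_def)
  define \<theta> where "\<theta> f = (\<Sum>k. w k * (q k f)\<^sup>2)" for f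
  have q4: "(q k f)\<^sup>2 \<le> 4" if "f \<in> ?K" for k f
    using power_mono[OF q_le2[OF that, of k] q_nonneg[OF that, of k], of 2] by simp
  have summ: "summable (\<lambda>k. w k * (q k f)\<^sup>2)" if f: "f \<in> ?K" for f
  proof (rule summable_comparison_test'[where g = "\<lambda>k. w k * 4" and N = 0])
    show "summable (\<lambda>k. w k * 4)" using w_sums by (rule sums_summable)
    show "norm (w k * (q k f)\<^sup>2) \<le> w k * 4" if "k \<ge> 0" for k
      using w[of k] q4[OF f, of k] by (simp add: abs_mult)
  qed
  have \<theta>_nonneg: "0 \<le> \<theta> f" if f: "f \<in> ?K" for f
    unfolding \<theta>_def by (rule suminf_nonneg[OF summ[OF f]]) (use w in \<open>simp add: less_imp_le\<close>)
  have \<theta>_le1: "\<theta> f \<le> 1" if f: "f \<in> ?K" for f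
  proof -
    have "\<theta> f \<le> (\<Sum>k. w k * 4)"
      unfolding \<theta>_def using w q4[OF f] by (intro suminf_le summ[OF f] sums_summable[OF w_sums] mult_left_mono) (auto simp: less_imp_le)
    then show ?thesis using sums_unique[OF w_sums] by simp
  qed
  \<comment> \<open>Together with \<open>\<theta>_fin\<close> this presents \<open>\<theta>\<close>
    as a supremum of finite sums evaluated at points of \<open>B\<close>. Each of these is weak-star
    continuous, so \<open>\<theta>\<close> is weak-star lower semicontinuous and the supremum in
    \<open>\<psi>\<close> will be attained.\<close>
  have \<theta>_lsc: "\<theta> f \<le> s" if f: "f \<in> ?K"
    and fin: "\<And>N \<xi>. (\<And>k. \<xi> k \<in> B) \<Longrightarrow> (\<Sum>k<N. w k * (f (\<xi> k) - ys k (\<xi> k))\<^sup>2) \<le> s" for f s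
    unfolding \<theta>_def
  proof (rule suminf_le_const[OF summ[OF f]])
    fix N
    have "\<forall>j k. \<exists>x. x \<in> B \<and> q k f - inverse (real (Suc j)) < \<bar>f x - ys k x\<bar>"
      using q_attain[OF _ f] by (metis diff_less inverse_positive_iff_positive of_nat_0_less_iff zero_less_Suc diff_less_eq less_add_same_cancel1)
    then obtain \<xi> where \<xi>: "\<And>j k. \<xi> j k \<in> B" "\<And>j k. q k f - inverse (real (Suc j)) < \<bar>f (\<xi> j k) - ys k (\<xi> j k)\<bar>"
      by metis
    have lim: "(\<lambda>j. \<bar>f (\<xi> j k) - ys k (\<xi> j k)\<bar>) \<longlonglongrightarrow> q k f" for k
    proof (rule tendsto_sandwich[OF _ _ _ tendsto_const])
      have "(\<lambda>j. q k f - inverse (real (Suc j))) \<longlonglongrightarrow> q k f - 0" by (intro tendsto_intros LIMSEQ_inverse_real_of_nat)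
      then show "(\<lambda>j. q k f - inverse (real (Suc j))) \<longlonglongrightarrow> q k f" by simp
    qed (use \<xi> q_upper[OF f] in \<open>auto intro!: always_eventually less_imp_le\<close>)
    have "(\<lambda>j. \<Sum>k<N. w k * \<bar>f (\<xi> j k) - ys k (\<xi> j k)\<bar>\<^sup>2) \<longlonglongrightarrow> (\<Sum>k<N. w k * (q k f)\<^sup>2)"
      by (intro tendsto_intros lim)
    then show "(\<Sum>k<N. w k * (q k f)\<^sup>2) \<le> s"
      by (rule LIMSEQ_le_const2) (use fin[OF \<xi>(1)] in auto)
  qed
  have \<theta>_fin: "(\<Sum>k<N. w k * (f (\<xi> k) - ys k (\<xi> k))\<^sup>2) \<le> \<theta> f" if f: "f \<in> ?K" and \<xi>: "\<And>k. \<xi> k \<in> B" for f N \<xi>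
  proof -
    have "(f (\<xi> k) - ys k (\<xi> k))\<^sup>2 \<le> (q k f)\<^sup>2" for k
      using q_upper[OF f \<xi>, of k k] by (rule abs_le_square_iff[THEN iffD1, OF order_trans[OF _ abs_ge_self]])
    then have "(\<Sum>k<N. w k * (f (\<xi> k) - ys k (\<xi> k))\<^sup>2) \<le> (\<Sum>k<N. w k * (q k f)\<^sup>2)"
      using w by (intro sum_mono mult_left_mono) (auto simp: less_imp_le)
    also have "\<dots> \<le> \<theta> f" unfolding \<theta>_def
      using w by (intro sum_le_suminf summ[OF f]) (auto simp: less_imp_le)
    finally show ?thesis .
  qed
  define \<psi> where "\<psi> x = (SUP f\<in>?K. f x - \<theta> f)" for x
  have bdd\<psi>: "bdd_above ((\<lambda>f. f x - \<theta> f) ` ?K)" for x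
  proof (rule bdd_aboveI2)
    show "f x - \<theta> f \<le> norm x" if "f \<in> ?K" for f
      using dual_ball_le[OF that, of x] \<theta>_nonneg[OF that] by linarith
  qed
  have neK: "?K \<noteq> {}" using zero_in_dual_ball by blast
  have \<psi>_ge: "f x - \<theta> f \<le> \<psi> x" if "f \<in> ?K" for f x
    unfolding \<psi>_def by (rule cSUP_upper[OF that bdd\<psi>])
  have maximiser: "\<exists>f\<in>?K. \<psi> x = f x - \<theta> f" for x
  proof -
    \<comment> \<open>Nested weak-star closed sets of near-maximisers; a point common to all of them
      is a maximiser.\<close>
    define C where "C m = {f \<in> ?K. \<psi> x - 1 / real (Suc m) \<le> f x - \<theta> f}" for m
    have C_eq: "C m = ?K \<inter> (\<Inter>N. \<Inter>\<xi>\<in>{\<xi>. \<forall>k. \<xi> k \<in> B}.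
        {f. (\<Sum>k<N. w k * (f (\<xi> k) - ys k (\<xi> k))\<^sup>2) \<le> f x - \<psi> x + 1 / real (Suc m)})" (is "_ = ?R") for m
    proof (rule set_eqI)
      fix f
      show "f \<in> C m \<longleftrightarrow> f \<in> ?R"
      proof
        assume "f \<in> C m"
        then have f: "f \<in> ?K" "\<theta> f \<le> f x - \<psi> x + 1 / real (Suc m)" by (auto simp: C_def)
        show "f \<in> ?R" using f(1) order_trans[OF \<theta>_fin[OF f(1)] f(2)] by blast
      next
        assume f: "f \<in> ?R"
        then have fK: "f \<in> ?K" by blast
        have "\<theta> f \<le> f x - \<psi> x + 1 / real (Suc m)" by (rule \<theta>_lsc[OF fK]) (use f in blast)
        then show "f \<in> C m" using fK by (simp add: C_def)
      qed
    qed
    have C_closed: "closed (C m)" for m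
      unfolding C_eq
      by (intro closed_Int closed_INT ballI closed_dual_ball closed_Collect_le continuous_intros continuous_on_product_coordinates)
    have C_ne: "C m \<noteq> {}" for m
    proof -
      have "\<psi> x - 1 / real (Suc m) < (SUP f\<in>?K. f x - \<theta> f)" by (simp add: \<psi>_def)
      then obtain f where "f \<in> ?K" "\<psi> x - 1 / real (Suc m) < f x - \<theta> f"
        using less_cSUP_iff[OF neK bdd\<psi>] by blast
      then show ?thesis by (auto simp: C_def intro: less_imp_le)
    qed
    have C_mono: "C m \<subseteq> C k" if "k \<le> m" for k m
    proof -
      have "1 / real (Suc m) \<le> 1 / real (Suc k)" using that by (intro divide_left_mono) auto
      then show ?thesis by (auto simp: C_def)
    qed
    have "?K \<inter> \<Inter>(range C) \<noteq> {}"
    proof (rule compact_imp_fip[OF compact_dual_ball])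
      show "closed S" if "S \<in> range C" for S using that C_closed by blast
      fix \<S> assume S: "finite \<S>" "\<S> \<subseteq> range C"
      then obtain M where M: "finite M" "\<S> = C ` M" using finite_subset_image[OF S] by blast
      obtain m where m: "\<And>k. k \<in> M \<Longrightarrow> k \<le> m" using M(1) finite_nat_set_iff_bounded_le by auto
      have "C m \<subseteq> ?K \<inter> \<Inter>\<S>" using C_mono m M by (auto simp: C_def)
      then show "?K \<inter> \<Inter>\<S> \<noteq> {}" using C_ne[of m] by blast
    qed
    then obtain f where f: "f \<in> ?K" "\<And>m. f \<in> C m" by blast
    have "(\<lambda>m. \<psi> x - inverse (real (Suc m))) \<longlonglongrightarrow> \<psi> x - 0" by (intro tendsto_intros LIMSEQ_inverse_real_of_nat)
    then have "(\<lambda>m. \<psi> x - 1 / real (Suc m)) \<longlonglongrightarrow> \<psi> x" by (simp add: inverse_eq_divide)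
    then have "\<psi> x \<le> f x - \<theta> f" by (rule LIMSEQ_le_const2) (use f(2) in \<open>auto simp: C_def\<close>)
    then show ?thesis using f(1) \<psi>_ge[OF f(1), of x] by (intro bexI[of _ f]) auto
  qed
  have \<psi>_lower: "norm x - 1 \<le> \<psi> x" for x
  proof -
    obtain f where f: "linear f" "\<And>z. \<bar>f z\<bar> \<le> norm z" "f x = norm x" using norming_functional[of x] by blast
    then have "f \<in> ?K" by (simp add: dual_ball_def)
    then show ?thesis using \<psi>_ge[of f x] \<theta>_le1[of f] f(3) by linarith
  qed
  have \<psi>_upper: "\<psi> x \<le> norm x" for x
  proof -
    obtain f where "f \<in> ?K" "\<psi> x = f x - \<theta> f" using maximiser by blast
    then show ?thesis using dual_ball_le[of f x] \<theta>_nonneg[of f] by linarith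
  qed
  have lip1: "\<psi> x \<le> \<psi> y + norm (x - y)" for x y
  proof -
    obtain f where f: "f \<in> ?K" "\<psi> x = f x - \<theta> f" using maximiser by blast
    have "f x = f y + f (x - y)" using linear_diff[OF dual_ball_linear[OF f(1)]] by simp
    then show ?thesis using f \<psi>_ge[OF f(1), of y] dual_ball_le[OF f(1), of "x - y"] by linarith
  qed
  have \<psi>_lip: "\<bar>\<psi> x - \<psi> y\<bar> \<le> norm (x - y)" for x y
    using lip1[of x y] lip1[of y x] by (simp add: abs_le_iff norm_minus_commute)
  text \<open>The quadratic terms make \<open>\<theta>\<close> uniformly convex enough to control each \<open>q k\<close>.\<close>
  have gap: "w k * (q k f - q k g)\<^sup>2 / 2 \<le> t"
    if f: "f \<in> ?K" "\<psi> x = f x - \<theta> f" and g: "g \<in> ?K" "\<psi> x - t \<le> g x - \<theta> g" for f g x t k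
  proof -
    \<comment> \<open>The midpoint is a competitor in the supremum, which bounds
      \<open>\<theta> f + \<theta> g - 2 * \<theta> m\<close> by \<open>t\<close>. Convexity of each
      \<open>q j\<close> and the parallelogram identity bound the same quantity below by the squared
      gap.\<close>
    define m where "m z = (f z + g z) / 2" for z
    have mK: "m \<in> ?K"
      unfolding dual_ball_def
    proof (intro CollectI conjI allI linearI)
      fix a b :: 'a and r :: real
      show "m (a + b) = m a + m b" "m (r *\<^sub>R a) = r *\<^sub>R m a"
        using linear_add[OF dual_ball_linear[OF f(1)]] linear_add[OF dual_ball_linear[OF g(1)]]
          linear_scale[OF dual_ball_linear[OF f(1)]] linear_scale[OF dual_ball_linear[OF g(1)]]
        by (simp_all add: m_def field_simps)
      show "\<bar>m a\<bar> \<le> norm a" using dual_ball_le[OF f(1), of a] dual_ball_le[OF g(1), of a] by (simp add: m_def)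
    qed
    have qm: "q j m \<le> (q j f + q j g) / 2" for j
    proof (rule q_least)
      fix z assume z: "z \<in> B"
      have "m z - ys j z = ((f z - ys j z) + (g z - ys j z)) / 2" by (simp add: m_def field_simps)
      then show "\<bar>m z - ys j z\<bar> \<le> (q j f + q j g) / 2"
        using q_upper[OF f(1) z, of j] q_upper[OF g(1) z, of j] unfolding abs_le_iff by (auto simp: field_simps)
    qed
    let ?a = "\<lambda>j. w j * ((q j f)\<^sup>2 + (q j g)\<^sup>2 - 2 * (q j m)\<^sup>2)"
    have quad: "w j * ((q j f - q j g)\<^sup>2 / 2) \<le> ?a j" for j
    proof (rule mult_left_mono)
      have "(q j m)\<^sup>2 \<le> ((q j f + q j g) / 2)\<^sup>2" using qm q_nonneg[OF mK] by (rule power_mono)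
      then show "(q j f - q j g)\<^sup>2 / 2 \<le> (q j f)\<^sup>2 + (q j g)\<^sup>2 - 2 * (q j m)\<^sup>2"
        by (simp add: power2_eq_square field_simps)
    qed (use w[of j] in simp)
    have nn: "0 \<le> ?a j" for j using quad[of j] w[of j] by (smt (verit) mult_nonneg_nonneg zero_le_power2 divide_nonneg_nonneg)
    have "(\<lambda>j. w j * (q j f)\<^sup>2 + w j * (q j g)\<^sup>2 - 2 * (w j * (q j m)\<^sup>2)) sums (\<theta> f + \<theta> g - 2 * \<theta> m)"
      unfolding \<theta>_def by (intro sums_diff sums_add sums_mult summable_sums summ f(1) g(1) mK)
    then have a_sums: "?a sums (\<theta> f + \<theta> g - 2 * \<theta> m)" by (simp add: algebra_simps)
    have "?a k \<le> \<theta> f + \<theta> g - 2 * \<theta> m"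
      using sum_le_suminf[OF sums_summable[OF a_sums], of "{k}"] nn sums_unique[OF a_sums] by simp
    moreover have "m x - \<theta> m \<le> \<psi> x" by (rule \<psi>_ge[OF mK])
    then have "\<theta> f + \<theta> g - 2 * \<theta> m \<le> t" using f(2) g(2) by (simp add: m_def field_simps)
    ultimately show ?thesis using quad[of k] by simp
  qed
  have deriv: "\<exists>y\<in>Y. norm y \<le> 1 \<and> norm x - 1 \<le> blinfun_apply y x \<and>
       (\<psi> has_derivative blinfun_apply y) (at x within V)" if x: "x \<in> V" for x
  proof -
    obtain f where f: "f \<in> ?K" "\<psi> x = f x - \<theta> f" using maximiser by blast
    obtain y where y: "y \<in> Y" "norm y \<le> 1" "\<And>z. z \<in> V \<Longrightarrow> blinfun_apply y z = f z" using lift[OF f(1)] by blast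
    have "(\<psi> has_derivative blinfun_apply y) (at x within V)"
      unfolding has_derivative_within_alt
    proof (intro conjI allI impI blinfun.bounded_linear_right)
      fix e :: real assume e: "e > 0"
      obtain k where k: "\<And>z. z \<in> V \<Longrightarrow> \<bar>f z - ys k z\<bar> \<le> (e / 4) * norm z" using dense[OF f(1), of "e / 4"] e by auto
      have qk: "q k f \<le> e / 4"
      proof (rule q_least)
        fix z assume z: "z \<in> B"
        have "(e / 4) * norm z \<le> (e / 4) * 1" using z e by (intro mult_left_mono) (auto simp: B_def)
        then show "\<bar>f z - ys k z\<bar> \<le> e / 4" using k[of z] z by (simp add: B_def)
      qed
      \<comment> \<open>Chosen to invert \<open>gap\<close>: with \<open>t = 2 * norm ?h\<close> the
        weighted squared gap is at most \<open>4 * norm ?h\<close>, which is below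
        \<open>w k * (e / 4)\<^sup>2\<close>.\<close>
      define d where "d = w k * (e / 4)\<^sup>2 / 4"
      have d: "d > 0" using w e by (simp add: d_def)
      show "\<exists>d>0. \<forall>z\<in>V. norm (z - x) < d \<longrightarrow>
          norm (\<psi> z - \<psi> x - blinfun_apply y (z - x)) \<le> e * norm (z - x)"
      proof (intro exI[of _ d] conjI ballI impI d)
        fix z assume z: "z \<in> V" "norm (z - x) < d"
        let ?h = "z - x"
        have hV: "?h \<in> V" using z x Vdiff by blast
        have yh: "blinfun_apply y ?h = f ?h" by (rule y(3)[OF hV])
        have fz: "f z = f x + f ?h" using linear_diff[OF dual_ball_linear[OF f(1)]] by simp
        \<comment> \<open>The maximiser at \<open>x\<close> bounds the increment of
          \<open>\<psi>\<close> from below by \<open>f ?h\<close>, and the maximiser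
          \<open>g\<close> at \<open>z\<close> bounds it from above by \<open>g ?h\<close>. What
          remains is to compare \<open>f\<close> and \<open>g\<close> at \<open>?h\<close>.\<close>
        have lower: "\<psi> x + f ?h \<le> \<psi> z" using \<psi>_ge[OF f(1), of z] f(2) fz by linarith
        obtain g where g: "g \<in> ?K" "\<psi> z = g z - \<theta> g" using maximiser by blast
        have gz: "g z = g x + g ?h" using linear_diff[OF dual_ball_linear[OF g(1)]] by simp
        have upper: "\<psi> z \<le> \<psi> x + g ?h" using \<psi>_ge[OF g(1), of x] g(2) gz by linarith
        have "\<psi> x - 2 * norm ?h \<le> g x - \<theta> g"
          using g(2) gz dual_ball_le[OF g(1), of ?h] lip1[of x z] by (simp add: norm_minus_commute)
        then have "w k * (q k f - q k g)\<^sup>2 / 2 \<le> 2 * norm ?h" by (rule gap[OF f g(1)])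
        then have "w k * (q k f - q k g)\<^sup>2 \<le> w k * (e / 4)\<^sup>2" using z(2) by (simp add: d_def)
        then have "(q k f - q k g)\<^sup>2 \<le> (e / 4)\<^sup>2" using w[of k] by (simp only: mult_le_cancel_left_pos)
        then have "\<bar>q k f - q k g\<bar> \<le> e / 4" using e abs_le_square_iff[of "q k f - q k g" "e / 4"] by simp
        then have qg: "q k g \<le> e / 2" using qk by linarith
        have "\<bar>g ?h - f ?h\<bar> \<le> \<bar>g ?h - ys k ?h\<bar> + \<bar>f ?h - ys k ?h\<bar>" by linarith
        also have "\<dots> \<le> (e / 2) * norm ?h + (e / 4) * norm ?h"
          using q_bound[OF g(1) hV, of k] k[OF hV] mult_right_mono[OF qg norm_ge_zero[of ?h]] by linarith
        also have "\<dots> \<le> e * norm ?h" using e by (simp add: algebra_simps)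
        finally have "g ?h - f ?h \<le> e * norm ?h" by linarith
        then show "norm (\<psi> z - \<psi> x - blinfun_apply y ?h) \<le> e * norm ?h"
          using lower upper yh by (simp add: abs_le_iff)
      qed
    qed
    moreover have "norm x - 1 \<le> blinfun_apply y x"
      using y(3)[OF x] f(2) \<psi>_lower[of x] \<theta>_nonneg[OF f(1)] by linarith
    ultimately show ?thesis using y by blast
  qed
  show ?thesis by (rule that[OF \<psi>_lower \<psi>_upper \<psi>_lip deriv])
qed


subsection \<open>A smooth variational principle\<close>

text \<open>Not a norm: homogeneity is lost. The inequality
  \<open>norm x - \<kappa> \<le> blinfun_apply y x\<close> replaces the identity that the gradient
  of a norm satisfies. Derivatives exist only within \<open>V\<close>, but their representatives are
  taken from \<open>Y\<close>.\<close>

definition smooth_norm :: "'a::real_normed_vector set \<Rightarrow> ('a \<Rightarrow>\<^sub>L real) set \<Rightarrow> real \<Rightarrow> ('a \<Rightarrow> real) \<Rightarrow> bool" where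
  "smooth_norm V Y \<kappa> p \<longleftrightarrow> (\<forall>x. norm x - \<kappa> \<le> p x \<and> p x \<le> norm x) \<and> (\<forall>x y. \<bar>p x - p y\<bar> \<le> norm (x - y)) \<and>
     (\<forall>x\<in>V. \<exists>y\<in>Y. norm y \<le> 1 \<and> norm x - \<kappa> \<le> blinfun_apply y x \<and> (p has_derivative blinfun_apply y) (at x within V))"

text \<open>Rescaling turns the error 1 into \<open>\<kappa>\<close>, while the two factors
  \<open>\<kappa>\<close> and \<open>inverse \<kappa>\<close> cancel in the Lipschitz constant and
  in the derivative.\<close>

lemma smooth_norm_scale:
  assumes p: "smooth_norm V Y 1 p" and Vscale: "\<And>c x. x \<in> V \<Longrightarrow> c *\<^sub>R x \<in> V" and \<kappa>: "\<kappa> > 0"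
  shows "smooth_norm V Y \<kappa> (\<lambda>x. \<kappa> * p (inverse \<kappa> *\<^sub>R x))"
  unfolding smooth_norm_def
proof (intro conjI allI ballI)
  fix x y
  have n: "norm (inverse \<kappa> *\<^sub>R z) = norm z / \<kappa>" for z :: 'a using \<kappa> by (simp add: field_simps)
  have "norm x / \<kappa> - 1 \<le> p (inverse \<kappa> *\<^sub>R x)" "p (inverse \<kappa> *\<^sub>R x) \<le> norm x / \<kappa>"
    using p n[of x] unfolding smooth_norm_def by metis+
  then show "norm x - \<kappa> \<le> \<kappa> * p (inverse \<kappa> *\<^sub>R x)" "\<kappa> * p (inverse \<kappa> *\<^sub>R x) \<le> norm x"
    using \<kappa> by (simp_all add: field_simps)
  have "\<bar>p (inverse \<kappa> *\<^sub>R x) - p (inverse \<kappa> *\<^sub>R y)\<bar> \<le> norm (inverse \<kappa> *\<^sub>R x - inverse \<kappa> *\<^sub>R y)"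
    using p unfolding smooth_norm_def by blast
  also have "\<dots> = norm (x - y) / \<kappa>" unfolding scaleR_diff_right[symmetric] by (rule n)
  finally have "\<kappa> * \<bar>p (inverse \<kappa> *\<^sub>R x) - p (inverse \<kappa> *\<^sub>R y)\<bar> \<le> norm (x - y)" using \<kappa> by (simp add: field_simps)
  moreover have "\<kappa> * \<bar>p (inverse \<kappa> *\<^sub>R x) - p (inverse \<kappa> *\<^sub>R y)\<bar> = \<bar>\<kappa> * p (inverse \<kappa> *\<^sub>R x) - \<kappa> * p (inverse \<kappa> *\<^sub>R y)\<bar>"
    using \<kappa> by (simp add: abs_mult flip: right_diff_distrib)
  ultimately show "\<bar>\<kappa> * p (inverse \<kappa> *\<^sub>R x) - \<kappa> * p (inverse \<kappa> *\<^sub>R y)\<bar> \<le> norm (x - y)" by simp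
next
  fix x assume x: "x \<in> V"
  then have "inverse \<kappa> *\<^sub>R x \<in> V" by (rule Vscale)
  then obtain y where y: "y \<in> Y" "norm y \<le> 1" "norm (inverse \<kappa> *\<^sub>R x) - 1 \<le> blinfun_apply y (inverse \<kappa> *\<^sub>R x)"
    "(p has_derivative blinfun_apply y) (at (inverse \<kappa> *\<^sub>R x) within V)" using p unfolding smooth_norm_def by blast
  have "(p has_derivative blinfun_apply y) (at (inverse \<kappa> *\<^sub>R x) within (\<lambda>x. inverse \<kappa> *\<^sub>R x) ` V)"
    by (rule has_derivative_subset[OF y(4)]) (use Vscale in auto)
  then have "((\<lambda>x. p (inverse \<kappa> *\<^sub>R x)) has_derivative (\<lambda>h. blinfun_apply y (inverse \<kappa> *\<^sub>R h))) (at x within V)"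
    by (intro has_derivative_in_compose[where f = "\<lambda>x. inverse \<kappa> *\<^sub>R x" and g = p]) (auto intro!: derivative_eq_intros)
  then have "((\<lambda>x. \<kappa> * p (inverse \<kappa> *\<^sub>R x)) has_derivative (\<lambda>h. \<kappa> * blinfun_apply y (inverse \<kappa> *\<^sub>R h))) (at x within V)"
    by (rule has_derivative_mult_right)
  moreover have "(\<lambda>h. \<kappa> * blinfun_apply y (inverse \<kappa> *\<^sub>R h)) = blinfun_apply y"
    using \<kappa> by (auto simp: blinfun.scaleR_right)
  moreover have "norm x / \<kappa> - 1 \<le> blinfun_apply y x / \<kappa>"
    using y(3) \<kappa> by (simp add: blinfun.scaleR_right divide_inverse mult.commute)
  then have "\<kappa> * (norm x / \<kappa> - 1) \<le> \<kappa> * (blinfun_apply y x / \<kappa>)" using \<kappa> by (intro mult_left_mono) auto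
  then have "norm x - \<kappa> \<le> blinfun_apply y x" using \<kappa> by (simp add: right_diff_distrib)
  ultimately show "\<exists>y\<in>Y. norm y \<le> 1 \<and> norm x - \<kappa> \<le> blinfun_apply y x \<and>
      ((\<lambda>x. \<kappa> * p (inverse \<kappa> *\<^sub>R x)) has_derivative blinfun_apply y) (at x within V)"
    using y by auto
qed

section \<open>Log-sum-exp as a smooth maximum, with the softmax weights as its gradient\<close>

definition lse :: "real \<Rightarrow> 'j set \<Rightarrow> ('j \<Rightarrow> real) \<Rightarrow> real" where
  "lse \<kappa> J a = \<kappa> * ln (\<Sum>j\<in>J. exp (a j / \<kappa>))"

definition softmax :: "real \<Rightarrow> 'j set \<Rightarrow> ('j \<Rightarrow> real) \<Rightarrow> 'j \<Rightarrow> real" where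
  "softmax \<kappa> J a j = exp (a j / \<kappa>) / (\<Sum>j\<in>J. exp (a j / \<kappa>))"

lemma sum_exp_pos: "finite J \<Longrightarrow> J \<noteq> {} \<Longrightarrow> 0 < (\<Sum>j\<in>J. exp (a j / \<kappa> :: real))"
  by (intro sum_pos) auto

lemma softmax_pos: "finite J \<Longrightarrow> J \<noteq> {} \<Longrightarrow> 0 < softmax \<kappa> J a j"
  unfolding softmax_def by (intro divide_pos_pos sum_exp_pos) auto

lemma sum_softmax:
  assumes "finite J" "J \<noteq> {}"
  shows "(\<Sum>j\<in>J. softmax \<kappa> J a j) = 1"
  using sum_exp_pos[OF assms, of a \<kappa>] by (simp add: softmax_def flip: sum_divide_distrib)

lemma lse_ge:
  assumes "finite J" "j \<in> J" "\<kappa> > 0" shows "a j \<le> lse \<kappa> J a"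
proof -
  have "exp (a j / \<kappa>) \<le> (\<Sum>j\<in>J. exp (a j / \<kappa>))" using assms by (intro member_le_sum) auto
  then have "a j / \<kappa> \<le> ln (\<Sum>j\<in>J. exp (a j / \<kappa>))"
    using sum_exp_pos[of J a \<kappa>] assms by (subst ln_ge_iff) auto
  then show ?thesis using assms by (simp add: lse_def field_simps)
qed

lemma lse_le:
  assumes "finite J" "J \<noteq> {}" "\<kappa> > 0" "\<And>j. j \<in> J \<Longrightarrow> a j \<le> m"
  shows "lse \<kappa> J a \<le> m + \<kappa> * ln (real (card J))"
proof -
  have c: "real (card J) > 0" using assms by (simp add: card_gt_0_iff)
  have "(\<Sum>j\<in>J. exp (a j / \<kappa>)) \<le> (\<Sum>j\<in>J. exp (m / \<kappa>))"
    using assms by (intro sum_mono) (auto simp: divide_right_mono)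
  also have "\<dots> = real (card J) * exp (m / \<kappa>)" by simp
  finally have "ln (\<Sum>j\<in>J. exp (a j / \<kappa>)) \<le> ln (real (card J) * exp (m / \<kappa>))"
    using sum_exp_pos[OF assms(1,2), of a \<kappa>] by (intro ln_mono) auto
  also have "\<dots> = ln (real (card J)) + m / \<kappa>" using c by (simp add: ln_mult)
  finally have "\<kappa> * ln (\<Sum>j\<in>J. exp (a j / \<kappa>)) \<le> \<kappa> * (ln (real (card J)) + m / \<kappa>)" using assms by (intro mult_left_mono) auto
  then show ?thesis using assms(3) by (simp add: lse_def algebra_simps)
qed

text \<open>The entropy of the weights is at most \<open>ln (card J)\<close>.\<close>

lemma softmax_average_ge:
  assumes J: "finite J" and i: "i \<in> J" and \<kappa>: "\<kappa> > 0"
  shows "a i - \<kappa> * ln (real (card J)) \<le> (\<Sum>j\<in>J. softmax \<kappa> J a j * a j)"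
proof -
  let ?w = "softmax \<kappa> J a" and ?N = "real (card J)"
  have ne: "J \<noteq> {}" using i by auto
  have N: "?N > 0" using J ne by (simp add: card_gt_0_iff)
  have w: "?w j > 0" for j by (rule softmax_pos[OF J ne])
  have lnw: "a j = \<kappa> * ln (?w j) + lse \<kappa> J a" for j
    using sum_exp_pos[OF J ne, of a \<kappa>] \<kappa> by (simp add: softmax_def lse_def ln_div algebra_simps)
  have "- ln ?N \<le> (\<Sum>j\<in>J. ?w j * ln (?w j))"
  proof -
    \<comment> \<open>The inequality \<open>ln x \<le> x - 1\<close>, summed with the weights, says
      that the entropy relative to the uniform distribution is nonnegative; the right-hand sides sum
      to \<open>1 - 1 = 0\<close>.\<close>
    have "?w j * (- ln ?N) - ?w j * ln (?w j) \<le> inverse ?N - ?w j" for j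
    proof -
      have "ln (inverse (?N * ?w j)) \<le> inverse (?N * ?w j) - 1"
        using N w[of j] by (intro ln_le_minus_one) auto
      then have "?w j * ln (inverse (?N * ?w j)) \<le> ?w j * (inverse (?N * ?w j) - 1)" using w[of j] by (intro mult_left_mono) auto
      also have "\<dots> = inverse ?N - ?w j" using N w[of j] by (simp add: field_simps)
      finally show ?thesis using N w[of j] by (simp only: ln_inverse mult_pos_pos ln_mult_pos) (simp only: minus_add_distrib right_diff_distrib distrib_left mult_minus_right minus_diff_eq diff_conv_add_uminus)
    qed
    then have "(\<Sum>j\<in>J. ?w j * (- ln ?N) - ?w j * ln (?w j)) \<le> (\<Sum>j\<in>J. inverse ?N - ?w j)" by (intro sum_mono)
    moreover have "(\<Sum>j\<in>J. ?w j * (- ln ?N) - ?w j * ln (?w j)) = - ln ?N - (\<Sum>j\<in>J. ?w j * ln (?w j))"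
      unfolding sum_subtractf sum_distrib_right[symmetric] sum_softmax[OF J ne] by simp
    moreover have "(\<Sum>j\<in>J. inverse ?N - ?w j) = 0"
      unfolding sum_subtractf sum_softmax[OF J ne] using N by simp
    ultimately show ?thesis by linarith
  qed
  then have "\<kappa> * (- ln ?N) \<le> \<kappa> * (\<Sum>j\<in>J. ?w j * ln (?w j))" using \<kappa> by (intro mult_left_mono) auto
  moreover have "(\<Sum>j\<in>J. ?w j * a j) = (\<Sum>j\<in>J. \<kappa> * (?w j * ln (?w j)) + ?w j * lse \<kappa> J a)"
  proof (intro sum.cong refl)
    fix j
    have "?w j * a j = ?w j * (\<kappa> * ln (?w j) + lse \<kappa> J a)" by (simp only: lnw[of j, symmetric])
    then show "?w j * a j = \<kappa> * (?w j * ln (?w j)) + ?w j * lse \<kappa> J a" by (simp only: distrib_left mult.left_commute)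
  qed
  then have "(\<Sum>j\<in>J. ?w j * a j) = \<kappa> * (\<Sum>j\<in>J. ?w j * ln (?w j)) + lse \<kappa> J a"
    unfolding sum.distrib sum_distrib_left[symmetric] sum_distrib_right[symmetric] sum_softmax[OF J ne] by simp
  ultimately show ?thesis using lse_ge[OF J i \<kappa>, of a] by simp
qed

lemma lse_has_derivative:
  assumes J: "finite J" "J \<noteq> {}" and \<kappa>: "\<kappa> > 0"
    and a: "\<And>j. j \<in> J \<Longrightarrow> ((\<lambda>z. a z j) has_derivative d j) (at x within S)"
  shows "((\<lambda>z. lse \<kappa> J (a z)) has_derivative (\<lambda>h. \<Sum>j\<in>J. softmax \<kappa> J (a x) j * d j h)) (at x within S)"
proof -
  let ?s = "\<Sum>j\<in>J. exp (a x j / \<kappa>)"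
  have s: "?s > 0" by (rule sum_exp_pos[OF J])
  have "((\<lambda>z. exp (a z j / \<kappa>)) has_derivative (\<lambda>h. exp (a x j / \<kappa>) * (d j h / \<kappa>))) (at x within S)" if "j \<in> J" for j
    using has_derivative_exp[OF has_derivative_divide'[OF a[OF that] has_derivative_const, of \<kappa>]] \<kappa>
    by (auto simp: field_simps elim!: has_derivative_eq_rhs)
  then have "((\<lambda>z. \<Sum>j\<in>J. exp (a z j / \<kappa>)) has_derivative (\<lambda>h. \<Sum>j\<in>J. exp (a x j / \<kappa>) * (d j h / \<kappa>))) (at x within S)"
    by (rule has_derivative_sum)
  then have "((\<lambda>z. \<kappa> * ln (\<Sum>j\<in>J. exp (a z j / \<kappa>))) has_derivative
      (\<lambda>h. \<kappa> * ((\<Sum>j\<in>J. exp (a x j / \<kappa>) * (d j h / \<kappa>)) * inverse ?s))) (at x within S)"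
    using s by (intro has_derivative_mult_right has_derivative_ln) auto
  moreover have "\<kappa> * ((\<Sum>j\<in>J. exp (a x j / \<kappa>) * (d j h / \<kappa>)) * inverse ?s) = (\<Sum>j\<in>J. softmax \<kappa> J (a x) j * d j h)" for h
    using \<kappa> by (simp add: softmax_def sum_distrib_left sum_distrib_right divide_inverse mult.assoc) (simp add: field_simps)
  ultimately show ?thesis unfolding lse_def by simp
qed

lemma lse_tendsto:
  assumes J: "finite J" "J \<noteq> {}" and \<kappa>: "\<kappa> > 0" and a: "\<And>j. j \<in> J \<Longrightarrow> (\<lambda>k. a k j) \<longlonglongrightarrow> b j"
  shows "(\<lambda>k. lse \<kappa> J (a k)) \<longlonglongrightarrow> lse \<kappa> J b"
  unfolding lse_def using sum_exp_pos[OF J, of b \<kappa>] \<kappa>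
  by (intro tendsto_intros a) auto

text \<open>Ekeland's perturbation is a norm and would destroy smoothness. Here the distance
  \<open>D\<close> is replaced at stage \<open>k\<close> by an approximation \<open>Q k\<close> of
  error \<open>(1/2)^k\<close>, and the perturbation is a series of such terms centred at successive
  near-minimisers. With smooth \<open>Q k\<close> the whole series can be differentiated.\<close>

theorem borwein_preiss_principle:
  fixes H0 :: "'s \<Rightarrow> real" and D :: "'s \<Rightarrow> 's \<Rightarrow> real" and Q :: "nat \<Rightarrow> 's \<Rightarrow> 's \<Rightarrow> real"
  assumes S: "S \<noteq> {}" and lb: "\<And>u. u \<in> S \<Longrightarrow> b \<le> H0 u" and s: "s > 0"
    and D0: "\<And>u v. 0 \<le> D u v" "\<And>u. D u u = 0"
    and Dbd: "\<And>u v. u \<in> S \<Longrightarrow> v \<in> S \<Longrightarrow> D u v \<le> R"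
    and Ql: "\<And>k u a. D u a - (1/2)^k \<le> Q k u a" and Qu: "\<And>k u a. Q k u a \<le> D u a"
    and Qlip: "\<And>k u v a. Q k u a - Q k v a \<le> D v u"
    and complete: "\<And>\<sigma> :: nat \<Rightarrow> 's. (\<And>k. \<sigma> k \<in> S) \<Longrightarrow> (\<And>k. D (\<sigma> (Suc k)) (\<sigma> k) \<le> 3 * (1/2)^k) \<Longrightarrow>
       \<exists>u\<in>S. (\<lambda>k. D (\<sigma> k) u) \<longlonglongrightarrow> 0 \<and> (\<lambda>k. H0 (\<sigma> k)) \<longlonglongrightarrow> H0 u"
  obtains u a where "u \<in> S" "\<And>k::nat. a k \<in> S"
    "\<And>v. v \<in> S \<Longrightarrow> H0 u + (\<Sum>k. s * (1/2)^k * Q k u (a k)) \<le> H0 v + (\<Sum>k. s * (1/2)^k * Q k v (a k))"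
proof -
  \<comment> \<open>A function of the current objective, because the next objective is defined
    through the centre chosen for this one. The tolerance decays like \<open>(1/4)^k\<close>, faster
    than the weights \<open>(1/2)^k\<close>, which makes the centres converge.\<close>
  define pick where "pick k h = (SOME a. a \<in> S \<and> (\<forall>v\<in>S. h a \<le> h v + s * (1/4)^k))" for k :: nat and h :: "'s \<Rightarrow> real"
  have pick: "pick k h \<in> S \<and> (\<forall>v\<in>S. h (pick k h) \<le> h v + s * (1/4)^k)" if "\<And>v. v \<in> S \<Longrightarrow> c \<le> h v" for k h c
  proof -
    have bdd: "bdd_below (h ` S)" by (rule bdd_belowI2[of _ c]) (rule that)
    have "(INF v\<in>S. h v) < (INF v\<in>S. h v) + s * (1/4)^k" using s by simp
    then obtain a where a: "a \<in> S" "h a < (INF v\<in>S. h v) + s * (1/4)^k" using cINF_less_iff[OF S bdd] by blast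
    have "\<forall>v\<in>S. h a \<le> h v + s * (1/4)^k"
    proof
      fix v assume "v \<in> S"
      then show "h a \<le> h v + s * (1/4)^k" using a(2) cINF_lower[OF bdd] by fastforce
    qed
    with a(1) have "a \<in> S \<and> (\<forall>v\<in>S. h a \<le> h v + s * (1/4)^k)" by (rule conjI)
    then show ?thesis unfolding pick_def by (rule someI)
  qed
  define H where "H = rec_nat H0 (\<lambda>k h u. h u + s * (1/2)^k * Q k u (pick k h))"
  define a where "a k = pick k (H k)" for k
  have H: "H 0 = H0" "\<And>k u. H (Suc k) u = H k u + s * (1/2)^k * Q k u (a k)"
    by (simp_all add: H_def a_def)
  have H_sum: "H k u = H0 u + (\<Sum>i<k. s * (1/2)^i * Q i u (a i))" for k u
    by (induction k) (simp_all add: H)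
  have Qm1: "- 1 \<le> Q k u v" for k u v
    using Ql[of u v k] D0(1)[of u v] power_le_one[of "1/2 :: real" k] by linarith
  have half: "summable (\<lambda>k. s * (1/2::real)^k)" "(\<Sum>k. s * (1/2::real)^k) = 2 * s"
    using sums_mult[OF geometric_sums[of "1/2::real"], of s] by (auto simp: sums_iff)
  have halfN: "(\<Sum>i<k. s * (1/2::real)^i) \<le> 2 * s" for k
    using sum_le_suminf[OF half(1), of "{..<k}"] s half(2) by simp
  have Hlb: "b - 2 * s \<le> H k v" if "v \<in> S" for k v
  proof -
    have "(\<Sum>i<k. s * (1/2)^i * Q i v (a i)) \<ge> (\<Sum>i<k. - (s * (1/2)^i))"
    proof (rule sum_mono)
      fix i show "- (s * (1/2)^i) \<le> s * (1/2)^i * Q i v (a i)"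
        using mult_left_mono[OF Qm1[of i v "a i"], of "s * (1/2)^i"] s by simp
    qed
    then show ?thesis unfolding H_sum using halfN[of k] lb[OF that] by (simp add: sum_negf)
  qed
  have aS: "a k \<in> S" and amin: "\<And>v. v \<in> S \<Longrightarrow> H k (a k) \<le> H k v + s * (1/4)^k" for k
    using pick[of "b - 2 * s" "H k" k] Hlb by (auto simp: a_def)
  \<comment> \<open>Both near-minimality errors together are at most \<open>2 * s * (1/4)^k\<close>,
    hence \<open>2 * (1/2)^k\<close> after division by the weight; the error of \<open>Q k\<close>
    contributes one more \<open>(1/2)^k\<close>. This is the 3.\<close>
  have near: "D (a (Suc k)) (a k) \<le> 3 * (1/2)^k" for k
  proof -
    let ?D = "D (a (Suc k)) (a k)"
    have "H (Suc k) (a (Suc k)) \<le> H (Suc k) (a k) + s * (1/4)^Suc k" by (rule amin[OF aS])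
    also have "H (Suc k) (a k) \<le> H k (a k)"
      unfolding H using Qu[of k "a k" "a k"] D0(2) s by (simp add: mult_le_0_iff)
    finally have 1: "H (Suc k) (a (Suc k)) \<le> H k (a k) + s * (1/4)^Suc k" by simp
    have "H k (a k) - s * (1/4)^k + s * (1/2)^k * (?D - (1/2)^k) \<le> H (Suc k) (a (Suc k))"
    proof -
      have "s * (1/2)^k * (?D - (1/2)^k) \<le> s * (1/2)^k * Q k (a (Suc k)) (a k)"
        using s by (intro mult_left_mono Ql) auto
      then show ?thesis unfolding H using amin[OF aS, of k "Suc k"] by linarith
    qed
    then have 2: "s * (1/2)^k * (?D - (1/2)^k) \<le> s * (1/4)^k + s * (1/4)^Suc k" using 1 by linarith
    have q: "(1/4::real)^k = (1/2)^k * (1/2)^k" by (simp flip: power_mult_distrib)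
    have "s * (1/2)^k * (?D - (1/2)^k) \<le> s * (1/2)^k * (2 * (1/2)^k)"
    proof -
      have "s * (1/4)^k + s * (1/4)^Suc k \<le> 2 * (s * (1/4)^k)" using s by simp
      also have "\<dots> = s * (1/2)^k * (2 * (1/2)^k)" unfolding q by simp
      finally show ?thesis using 2 by linarith
    qed
    moreover have "s * (1/2)^k > 0" using s by simp
    ultimately have "?D - (1/2)^k \<le> 2 * (1/2)^k" by (simp only: mult_le_cancel_left_pos)
    then show ?thesis by simp
  qed
  obtain u where u: "u \<in> S" "(\<lambda>k. D (a k) u) \<longlonglongrightarrow> 0" "(\<lambda>k. H0 (a k)) \<longlonglongrightarrow> H0 u"
    using complete[of a, OF aS near] by blast
  have Qabs: "\<bar>Q k v (a k)\<bar> \<le> R + 1" if "v \<in> S" for k v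
    using Qm1[of k v "a k"] Qu[of k v "a k"] Dbd[OF that aS, of k] D0(1)[of v "a k"] by linarith
  have lim: "(\<lambda>k. H k v) \<longlonglongrightarrow> H0 v + (\<Sum>k. s * (1/2)^k * Q k v (a k))" if v: "v \<in> S" for v
  proof -
    have "summable (\<lambda>k. s * (1/2)^k * Q k v (a k))"
    proof (rule summable_comparison_test'[where g = "\<lambda>k. s * (1/2)^k * (R + 1)" and N = 0])
      show "summable (\<lambda>k. s * (1/2)^k * (R + 1))" by (rule summable_mult2[OF half(1)])
      show "norm (s * (1/2)^k * Q k v (a k)) \<le> s * (1/2)^k * (R + 1)" for k
        using mult_left_mono[OF Qabs[OF v, of k], of "s * (1/2)^k"] s by (simp add: abs_mult)
    qed
    then show ?thesis unfolding H_sum by (intro tendsto_intros summable_LIMSEQ)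
  qed
  have "H0 u + (\<Sum>k. s * (1/2)^k * Q k u (a k)) \<le> H0 v + (\<Sum>k. s * (1/2)^k * Q k v (a k))" if v: "v \<in> S" for v
  proof -
    \<comment> \<open>The perturbations have total weight at most \<open>2 * s\<close> and are
      1-Lipschitz with respect to \<open>D\<close>. The limit \<open>u\<close> can therefore replace
      the near-minimiser \<open>a k\<close> at a cost that vanishes.\<close>
    have le: "H k u \<le> H k v + (s * (1/4)^k + (H0 u - H0 (a k)) + 2 * s * D (a k) u)" for k
    proof -
      have "(\<Sum>i<k. s * (1/2)^i * Q i u (a i)) - (\<Sum>i<k. s * (1/2)^i * Q i (a k) (a i))
          = (\<Sum>i<k. s * (1/2)^i * (Q i u (a i) - Q i (a k) (a i)))"
        by (simp add: sum_subtractf right_diff_distrib)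
      also have "\<dots> \<le> (\<Sum>i<k. s * (1/2)^i * D (a k) u)"
        using s Qlip by (intro sum_mono mult_left_mono) auto
      also have "\<dots> \<le> 2 * s * D (a k) u"
        using mult_right_mono[OF halfN[of k] D0(1)[of "a k" u]] by (simp add: sum_distrib_right)
      finally have "H k u \<le> H k (a k) + (H0 u - H0 (a k)) + 2 * s * D (a k) u" unfolding H_sum by simp
      then show ?thesis using amin[OF v, of k] by linarith
    qed
    have "(\<lambda>k. H k v + (s * (1/4)^k + (H0 u - H0 (a k)) + 2 * s * D (a k) u)) \<longlonglongrightarrow>
       (H0 v + (\<Sum>k. s * (1/2)^k * Q k v (a k))) + (s * 0 + (H0 u - H0 u) + 2 * s * 0)"
      by (intro tendsto_intros lim[OF v] u LIMSEQ_power_zero) auto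
    then show ?thesis using LIMSEQ_le[OF lim[OF u(1)]] le by fastforce
  qed
  then show ?thesis using that[of u a] u(1) aS by blast
qed

text \<open>Finitely many terms are handled by their derivatives; the tail is controlled by the
  Lipschitz bound alone, so no uniformity of differentiability in \<open>k\<close> is
  required.\<close>

lemma series_has_derivative_within:
  fixes f :: "nat \<Rightarrow> 'a::real_normed_vector \<Rightarrow> real" and y :: "nat \<Rightarrow> 'a \<Rightarrow>\<^sub>L real"
  assumes s: "summable s" "\<And>k. 0 \<le> s k"
    and d: "\<And>k. (f k has_derivative blinfun_apply (y k)) (at x within V)"
    and lip: "\<And>k z. \<bar>f k z - f k x\<bar> \<le> norm (z - x)" and y: "\<And>k. norm (y k) \<le> 1"
    and f: "\<And>z. summable (\<lambda>k. s k * f k z)"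
  shows "((\<lambda>z. \<Sum>k. s k * f k z) has_derivative blinfun_apply (\<Sum>k. s k *\<^sub>R y k)) (at x within V)"
    and "norm (\<Sum>k. s k *\<^sub>R y k) \<le> (\<Sum>k. s k)" and "summable (\<lambda>k. s k *\<^sub>R y k)"
proof -
  have nsy: "norm (s k *\<^sub>R y k) \<le> s k" for k using y[of k] s(2)[of k] by (simp add: mult_left_le)
  have sn: "summable (\<lambda>k. norm (s k *\<^sub>R y k))"
    by (rule summable_comparison_test'[OF s(1), of 0]) (use nsy in simp)
  then show sy: "summable (\<lambda>k. s k *\<^sub>R y k)" by (rule summable_norm_cancel)
  show "norm (\<Sum>k. s k *\<^sub>R y k) \<le> (\<Sum>k. s k)"
    using summable_norm[OF sn] suminf_le[OF nsy sn s(1)] by linarith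
  have apply_sum: "blinfun_apply (\<Sum>k. s k *\<^sub>R y k) h = (\<Sum>k. s k * blinfun_apply (y k) h)"
    and apply_summ: "summable (\<lambda>k. s k * blinfun_apply (y k) h)" for h
    using bounded_linear.suminf[OF blinfun.bounded_linear_left sy, of h]
      bounded_linear.summable[OF blinfun.bounded_linear_left sy, of h] by (simp_all add: blinfun.scaleR_left)
  show "((\<lambda>z. \<Sum>k. s k * f k z) has_derivative blinfun_apply (\<Sum>k. s k *\<^sub>R y k)) (at x within V)"
    unfolding has_derivative_within_alt
  proof (intro conjI allI impI blinfun.bounded_linear_right)
    fix e :: real assume e: "e > 0"
    obtain N where N: "norm (\<Sum>k. s (k + N)) < e / 4" using suminf_exist_split[OF _ s(1), of "e / 4"] e by auto
    let ?S = "\<Sum>k<N. s k"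
    have S0: "0 \<le> ?S" using s(2) by (rule sum_nonneg)
    \<comment> \<open>The tolerance per head term, normalised so that the weighted head costs at
      most half of \<open>e\<close>; adding 1 avoids dividing by zero. The tail receives the other
      half.\<close>
    have e2: "e / (2 * (?S + 1)) > 0" using e S0 by simp
    have "\<forall>k. \<exists>d>0. \<forall>z\<in>V. norm (z - x) < d \<longrightarrow>
        norm (f k z - f k x - blinfun_apply (y k) (z - x)) \<le> e / (2 * (?S + 1)) * norm (z - x)"
      using d e2 unfolding has_derivative_within_alt by blast
    then obtain \<delta> where \<delta>: "\<And>k. \<delta> k > 0" "\<And>k z. z \<in> V \<Longrightarrow> norm (z - x) < \<delta> k \<Longrightarrow>
        norm (f k z - f k x - blinfun_apply (y k) (z - x)) \<le> e / (2 * (?S + 1)) * norm (z - x)" by metis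
    define d where "d = Min (insert 1 (\<delta> ` {..<N}))"
    have d0: "d > 0" using \<delta>(1) by (simp add: d_def)
    have d\<delta>: "d \<le> \<delta> k" if "k < N" for k using that by (simp add: d_def)
    show "\<exists>d>0. \<forall>z\<in>V. norm (z - x) < d \<longrightarrow> norm ((\<Sum>k. s k * f k z) - (\<Sum>k. s k * f k x)
        - blinfun_apply (\<Sum>k. s k *\<^sub>R y k) (z - x)) \<le> e * norm (z - x)"
    proof (intro exI[of _ d] conjI ballI impI d0)
      fix z assume z: "z \<in> V" "norm (z - x) < d"
      define t where "t k = s k * (f k z - f k x - blinfun_apply (y k) (z - x))" for k
      have t_sums: "(\<lambda>k. s k * f k z - s k * f k x - s k * blinfun_apply (y k) (z - x)) sums
        ((\<Sum>k. s k * f k z) - (\<Sum>k. s k * f k x) - blinfun_apply (\<Sum>k. s k *\<^sub>R y k) (z - x))"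
        unfolding apply_sum by (intro sums_diff summable_sums f apply_summ)
      then have t_sums: "t sums ((\<Sum>k. s k * f k z) - (\<Sum>k. s k * f k x) - blinfun_apply (\<Sum>k. s k *\<^sub>R y k) (z - x))"
        by (simp add: t_def[abs_def] right_diff_distrib)
      have tk: "\<bar>t k\<bar> \<le> s k * (2 * norm (z - x))" for k
      proof -
        have "\<bar>blinfun_apply (y k) (z - x)\<bar> \<le> norm (z - x)"
          using norm_blinfun[of "y k" "z - x"] mult_right_mono[OF y[of k] norm_ge_zero[of "z - x"]] by simp
        then have "\<bar>f k z - f k x - blinfun_apply (y k) (z - x)\<bar> \<le> 2 * norm (z - x)" using lip[of k z] by linarith
        then show ?thesis using s(2)[of k] by (simp add: t_def abs_mult mult_left_mono)
      qed
      have shift: "summable (\<lambda>k. s (k + N) * (2 * norm (z - x)))"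
        by (intro summable_mult2 summable_ignore_initial_segment s(1))
      have sabs: "summable (\<lambda>k. \<bar>t (k + N)\<bar>)"
        by (rule summable_comparison_test'[OF shift, of 0]) (use tk in simp)
      have "\<bar>\<Sum>k. t (k + N)\<bar> \<le> (\<Sum>k. \<bar>t (k + N)\<bar>)" by (rule summable_rabs[OF sabs])
      also have "\<dots> \<le> (\<Sum>k. s (k + N) * (2 * norm (z - x)))" by (rule suminf_le[OF tk sabs shift])
      also have "\<dots> = (\<Sum>k. s (k + N)) * (2 * norm (z - x))"
        by (rule suminf_mult2[symmetric]) (intro summable_ignore_initial_segment s(1))
      also have "\<dots> \<le> e / 4 * (2 * norm (z - x))" using N by (intro mult_right_mono) auto
      finally have tail: "\<bar>\<Sum>k. t (k + N)\<bar> \<le> e / 2 * norm (z - x)" by simp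
      have "\<bar>\<Sum>k<N. t k\<bar> \<le> (\<Sum>k<N. s k * (e / (2 * (?S + 1)) * norm (z - x)))"
      proof (rule order_trans[OF sum_abs sum_mono])
        fix k assume "k \<in> {..<N}"
        then show "\<bar>t k\<bar> \<le> s k * (e / (2 * (?S + 1)) * norm (z - x))"
          using mult_left_mono[OF \<delta>(2)[OF z(1), of k] s(2)[of k]] z(2) d\<delta>[of k] s(2)[of k] by (simp add: t_def abs_mult)
      qed
      also have "\<dots> = ?S / (?S + 1) * (e / 2 * norm (z - x))"
        unfolding sum_distrib_right[symmetric] by simp
      also have "\<dots> \<le> 1 * (e / 2 * norm (z - x))" using S0 e by (intro mult_right_mono) auto
      finally have head: "\<bar>\<Sum>k<N. t k\<bar> \<le> e / 2 * norm (z - x)" by simp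
      have "(\<Sum>k. s k * f k z) - (\<Sum>k. s k * f k x) - blinfun_apply (\<Sum>k. s k *\<^sub>R y k) (z - x) = (\<Sum>k. t (k + N)) + (\<Sum>k<N. t k)"
        using sums_unique[OF t_sums] suminf_split_initial_segment[OF sums_summable[OF t_sums], of N] by simp
      then show "norm ((\<Sum>k. s k * f k z) - (\<Sum>k. s k * f k x)
        - blinfun_apply (\<Sum>k. s k *\<^sub>R y k) (z - x)) \<le> e * norm (z - x)"
        using head tail by simp
    qed
  qed
qed


subsection \<open>Multipliers in the Frechet normal cones\<close>

lemma smooth_norm_tendsto:
  assumes p: "smooth_norm V Y \<kappa> p" and x: "(\<lambda>k::nat. x k) \<longlonglongrightarrow> z"
  shows "(\<lambda>k. p (x k)) \<longlonglongrightarrow> p z"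
proof -
  have lim: "(\<lambda>k. norm (x k - z)) \<longlonglongrightarrow> 0" using x by (simp add: LIM_zero_iff tendsto_norm_zero_iff)
  have "norm (p (x k) - p z) \<le> norm (x k - z)" for k using p by (simp add: smooth_norm_def)
  then have "(\<lambda>k. p (x k) - p z) \<longlonglongrightarrow> 0" by (intro Lim_null_comparison[OF always_eventually lim]) blast
  then show ?thesis by (simp add: LIM_zero_iff)
qed

lemma has_derivative_compose_within:
  assumes "(p has_derivative p') (at (g x) within V)" "(g has_derivative g') (at x within V)" "g ` V \<subseteq> V"
  shows "((\<lambda>z. p (g z)) has_derivative (\<lambda>h. p' (g' h))) (at x within V)"
  by (rule has_derivative_in_compose[OF assms(2) has_derivative_subset[OF assms(1,3)]])

lemma has_derivative_fun_upd:
  "((\<lambda>z. (u(i := z)) j) has_derivative (\<lambda>h. if j = i then h else 0)) F"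
  by (cases "j = i") (auto intro!: derivative_intros)

text \<open>The smoothed objective is minimised over tuples near \<open>w\<close> with coordinates
  in the sets and in \<open>V\<close>. The minimiser is kept strictly inside this neighbourhood, so
  its coordinates can be varied one at a time, and the negative partial gradients are normals
  relative to \<open>V\<close>. Smoothing and perturbation errors are charged to
  \<open>e1 - e\<close> and \<open>1 - \<tau>\<close>.\<close>

theorem smooth_multipliers:
  fixes \<Omega> :: "nat \<Rightarrow> 'a::banach set"
  assumes n: "n \<ge> 2" and r: "\<forall>i. r i > 0" and c: "c > 0" and e: "0 < e" "e < e1" and \<rho>: "\<rho> > 0" and \<tau>: "\<tau> < 1"
    and V: "closed V" "subspace V" and Y: "closed Y" "subspace Y"
    and \<Omega>: "\<And>i. i \<in> {1..n} \<Longrightarrow> closed (\<Omega> i)"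
    and smooth: "\<And>\<kappa>. \<kappa> > 0 \<Longrightarrow> \<exists>p. smooth_norm V Y \<kappa> p"
    and normal: "\<And>i x y. x \<in> V \<Longrightarrow> y \<in> Y \<Longrightarrow>
      (\<And>e. e > 0 \<Longrightarrow> \<exists>\<delta>>0. \<forall>z\<in>\<Omega> i \<inter> V. norm (z - x) < \<delta> \<longrightarrow> blinfun_apply y (z - x) \<le> e * norm (z - x)) \<Longrightarrow>
      y \<in> frechet_normal_cone (\<Omega> i) x"
    and w: "\<And>i. i \<in> {1..n} \<Longrightarrow> w i \<in> \<Omega> i \<inter> V"
    and min: "\<And>u. (\<And>i. i \<in> {1..n} \<Longrightarrow> u i \<in> \<Omega> i \<inter> V) \<Longrightarrow> wmax n r (\<lambda>i. u i - w i) \<le> \<rho> \<Longrightarrow>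
       c * max_dist n w \<le> c * max_dist n u + e * wmax n r (\<lambda>i. u i - w i)"
    and pos: "0 < max_dist n w"
  obtains u and v y :: "nat \<Rightarrow> 'a \<Rightarrow>\<^sub>L real" where
    "\<And>i. i \<in> {1..n} \<Longrightarrow> u i \<in> \<Omega> i" "wmax n r (\<lambda>i. u i - w i) \<le> \<rho>"
    "(\<Sum>i=1..n-1. norm (v i)) \<le> 1"
    "\<tau> * max_dist n u \<le> (\<Sum>i=1..n-1. blinfun_apply (v i) (u n - u i))"
    "c * (\<Sum>i=1..n. r i * norm (y i)) \<le> e1"
    "\<And>i. i \<in> {1..n-1} \<Longrightarrow> v i - y i \<in> frechet_normal_cone (\<Omega> i) (u i)"
    "- (\<Sum>i=1..n-1. v i) - y n \<in> frechet_normal_cone (\<Omega> n) (u n)"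
proof -
  let ?g = "max_dist n" and ?C = "\<Sum>i=1..n. r i" and ?I = "\<Sum>i=1..n. inverse (r i)" and ?L = "ln (real n)"
  let ?p = "\<lambda>u. wmax n r (\<lambda>i. u i - w i)"
  let ?J = "{1..n-1}" and ?J' = "{1..n}"
  have n1: "n \<ge> 1" and nJ': "n \<in> ?J'" and J: "finite ?J" "?J \<noteq> {}" and J': "finite ?J'" "?J' \<noteq> {}"
    and JJ': "\<And>j. j \<in> ?J \<Longrightarrow> j \<in> ?J' \<and> j \<noteq> n" using n by auto
  have C0: "?C > 0" and I0: "?I > 0" using r n by (auto intro!: sum_pos)
  have L0: "?L \<ge> 0" using n by simp
  have lnJ: "ln (real (card ?J)) \<le> ?L" using n by simp
  define M where "M = ?g w"
  have M0: "M > 0" using pos by (simp add: M_def)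
  \<comment> \<open>The second bound keeps \<open>max_dist\<close> at least \<open>M / 2\<close> on
    the neighbourhood, so the relative loss \<open>1 - \<tau>\<close> is worth a fixed positive
    amount there.\<close>
  define \<rho>1 where "\<rho>1 = Min {\<rho>, M / (2 * ?C)}"
  have \<rho>1: "\<rho>1 > 0" "\<rho>1 \<le> \<rho>" "?C * \<rho>1 \<le> M / 2"
    using \<rho> M0 C0 by (auto simp: \<rho>1_def min_def field_simps)
  \<comment> \<open>Half of the slack \<open>e1 - e\<close> raises the penalty slope to
    \<open>e'\<close>; the other half pays for the gradient of the perturbation series.\<close>
  define g0 where "g0 = (e1 - e) / 2"
  define e' where "e' = e + g0"
  have g0: "g0 > 0" "e' + g0 = e1" "e' > 0" using e by (auto simp: g0_def e'_def field_simps)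
  \<comment> \<open>The first bound keeps the weighted gradients of the perturbation within
    \<open>g0\<close>, the second keeps its values within a quarter of
    \<open>g0 * \<rho>1\<close>.\<close>
  define s where "s = Min {g0 / (2 * ?C), g0 * \<rho>1 / (8 * (\<rho>1 * ?C + 1))}"
  have rC: "\<rho>1 * ?C + 1 > 0" using \<rho>1 C0 by (simp add: add_pos_pos)
  have s: "s > 0" "2 * s * ?C \<le> g0" "2 * s * (\<rho>1 * ?C + 1) \<le> g0 * \<rho>1 / 4"
  proof -
    have "s \<le> g0 / (2 * ?C)" "s \<le> g0 * \<rho>1 / (8 * (\<rho>1 * ?C + 1))" by (auto simp: s_def)
    then have "s * (2 * ?C) \<le> g0" "s * (8 * (\<rho>1 * ?C + 1)) \<le> g0 * \<rho>1"
      using C0 rC by (simp_all only: pos_le_divide_eq mult_pos_pos zero_less_numeral)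
    then show "2 * s * ?C \<le> g0" "2 * s * (\<rho>1 * ?C + 1) \<le> g0 * \<rho>1 / 4"
      by (simp_all only: mult.assoc mult.left_commute[of s])
    have "g0 / (2 * ?C) > 0" "g0 * \<rho>1 / (8 * (\<rho>1 * ?C + 1)) > 0"
      by (intro divide_pos_pos mult_pos_pos g0(1) \<rho>1(1) C0 rC zero_less_numeral)+
    then show "s > 0" unfolding s_def by simp
  qed
  \<comment> \<open>The total smoothing error per unit of \<open>\<kappa>\<close> when
    \<open>H0\<close> is compared at \<open>w\<close> and at the minimiser: one approximation of
    norms and one logarithm for each of the two log-sum-exps.\<close>
  define K where "K = c * (1 + ?L) + e' * (?L + ?I)"
  have "1 + ?L > 0" "?L + ?I > 0" using L0 I0 by linarith+
  then have K0: "K > 0" unfolding K_def using mult_pos_pos[OF c] mult_pos_pos[OF g0(3)] by (meson add_pos_pos)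
  \<comment> \<open>The first bound is for the pairing with factor \<open>\<tau>\<close>, the second
    for strict interiority of the minimiser.\<close>
  define \<kappa> where "\<kappa> = Min {(1 - \<tau>) * M / (2 * (2 + ?L)), g0 * \<rho>1 / (4 * K)}"
  have \<kappa>: "\<kappa> > 0" "\<kappa> * (2 + ?L) \<le> (1 - \<tau>) * (M / 2)" "\<kappa> * K \<le> g0 * \<rho>1 / 4"
  proof -
    have "\<kappa> \<le> (1 - \<tau>) * M / (2 * (2 + ?L))" "\<kappa> \<le> g0 * \<rho>1 / (4 * K)" by (auto simp: \<kappa>_def)
    then show "\<kappa> * (2 + ?L) \<le> (1 - \<tau>) * (M / 2)" "\<kappa> * K \<le> g0 * \<rho>1 / 4"
      using L0 K0 by (simp_all add: pos_le_divide_eq algebra_simps)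
    have "(1 - \<tau>) * M / (2 * (2 + ?L)) > 0" "g0 * \<rho>1 / (4 * K) > 0"
      by (intro divide_pos_pos mult_pos_pos g0(1) \<rho>1(1) M0 K0 zero_less_numeral, use \<tau> L0 in linarith, use L0 in linarith)
         (intro divide_pos_pos mult_pos_pos g0(1) \<rho>1(1) K0 zero_less_numeral)
    then show "\<kappa> > 0" unfolding \<kappa>_def by simp
  qed
  obtain p where p: "smooth_norm V Y \<kappa> p" using smooth[OF \<kappa>(1)] by blast
  \<comment> \<open>The error is divided by \<open>n\<close> because \<open>Q k\<close> adds up
    \<open>n\<close> coordinates and may miss \<open>D\<close> by at most
    \<open>(1/2)^k\<close>.\<close>
  have "\<exists>q. smooth_norm V Y ((1/2)^k / real n) q" for k by (rule smooth) (use n in simp)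
  then obtain pk where pk: "\<And>k. smooth_norm V Y ((1/2)^k / real n) (pk k)" by metis
  have p_le: "p x \<le> norm x" and p_ge: "norm x - \<kappa> \<le> p x" for x using p by (auto simp: smooth_norm_def)
  have pk_le: "pk k x \<le> norm x" and pk_ge: "norm x - (1/2)^k / real n \<le> pk k x"
    and pk_lip: "\<bar>pk k x - pk k z\<bar> \<le> norm (x - z)" for k x z using pk[of k] by (auto simp: smooth_norm_def)
  define S where "S = {u. (\<forall>i\<in>?J'. u i \<in> \<Omega> i \<inter> V) \<and> ?p u \<le> \<rho>1}"
  define H0 where "H0 u = c * lse \<kappa> ?J (\<lambda>j. p (u n - u j)) + e' * lse \<kappa> ?J' (\<lambda>j. p (u j - w j) / r j)" for u
  define D where "D u v = (\<Sum>j=1..n. norm (u j - v j))" for u v :: "nat \<Rightarrow> 'a"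
  define Q where "Q k u v = (\<Sum>j=1..n. pk k (u j - v j))" for k and u v :: "nat \<Rightarrow> 'a"
  have wS: "w \<in> S" using w \<rho>1 by (simp add: S_def wmax_zero[OF n1])
  have H0_ge: "c * (?g u - \<kappa>) + e' * (?p u - \<kappa> * ?I) \<le> H0 u" for u
  proof -
    let ?l1 = "lse \<kappa> ?J (\<lambda>j. p (u n - u j))" and ?l2 = "lse \<kappa> ?J' (\<lambda>j. p (u j - w j) / r j)"
    have "?g u \<le> ?l1 + \<kappa>"
      unfolding max_dist_le_iff[OF n]
    proof
      fix i assume "i \<in> ?J"
      then have "p (u n - u i) \<le> ?l1" using \<kappa> J by (intro lse_ge[where a = "\<lambda>j. p (u n - u j)"]) auto
      then show "norm (u n - u i) \<le> ?l1 + \<kappa>" using p_ge[of "u n - u i"] by linarith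
    qed
    moreover have "?p u \<le> ?l2 + \<kappa> * ?I"
      unfolding wmax_le_iff[OF n1 r]
    proof
      fix i assume i: "i \<in> ?J'"
      have ri: "r i > 0" using r by simp
      have "p (u i - w i) / r i \<le> ?l2" using \<kappa> J' i by (intro lse_ge[where a = "\<lambda>j. p (u j - w j) / r j"]) auto
      moreover have "norm (u i - w i) / r i - \<kappa> * inverse (r i) \<le> p (u i - w i) / r i"
        using divide_right_mono[OF p_ge[of "u i - w i"], of "r i"] ri by (simp add: divide_inverse left_diff_distrib)
      moreover have "inverse (r i) \<le> ?I" using i r by (intro member_le_sum) (auto simp: less_imp_le)
      then have "\<kappa> * inverse (r i) \<le> \<kappa> * ?I" using \<kappa> by (intro mult_left_mono) auto
      ultimately have "norm (u i - w i) / r i \<le> ?l2 + \<kappa> * ?I" by linarith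
      then show "norm (u i - w i) \<le> (?l2 + \<kappa> * ?I) * r i" using ri by (simp add: pos_divide_le_eq)
    qed
    ultimately show ?thesis unfolding H0_def using c g0 by (intro add_mono mult_left_mono) auto
  qed
  have dS: "norm (u j - w j) \<le> \<rho>1 * r j" if "u \<in> S" "j \<in> ?J'" for u j
    using that wmax_le_iff[OF n1 r, of "\<lambda>i. u i - w i" \<rho>1] by (simp add: S_def)
  have D_bound: "D u v \<le> 2 * \<rho>1 * ?C" if "u \<in> S" "v \<in> S" for u v
  proof -
    have "norm (u j - v j) \<le> 2 * \<rho>1 * r j" if j: "j \<in> ?J'" for j
      using norm_triangle_ineq4[of "u j - w j" "v j - w j"] dS[OF \<open>u \<in> S\<close> j] dS[OF \<open>v \<in> S\<close> j] by simp
    then show ?thesis unfolding D_def sum_distrib_left by (intro sum_mono) auto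
  qed
  have Dw: "D w v \<le> \<rho>1 * ?C" if "v \<in> S" for v
    unfolding D_def sum_distrib_left using dS[OF that] by (intro sum_mono) (auto simp: norm_minus_commute)
  have Ql: "D u v - (1/2)^k \<le> Q k u v" for k u v
  proof -
    have "(\<Sum>j=1..n. norm (u j - v j) - (1/2)^k / real n) \<le> Q k u v"
      unfolding Q_def by (intro sum_mono pk_ge)
    then show ?thesis using n by (simp add: sum_subtractf D_def)
  qed
  have Qu: "Q k u v \<le> D u v" for k u v
    unfolding Q_def D_def by (intro sum_mono pk_le)
  obtain u a where uS: "u \<in> S" and aS: "\<And>k::nat. a k \<in> S" and
    umin: "\<And>v. v \<in> S \<Longrightarrow> H0 u + (\<Sum>k. s * (1/2)^k * Q k u (a k)) \<le> H0 v + (\<Sum>k. s * (1/2)^k * Q k v (a k))"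
  proof (rule borwein_preiss_principle[of S "c * (0 - \<kappa>) + e' * (0 - \<kappa> * ?I)" H0 s D "2 * \<rho>1 * ?C" Q])
    show "S \<noteq> {}" using wS by blast
    show "c * (0 - \<kappa>) + e' * (0 - \<kappa> * ?I) \<le> H0 u" for u
    proof -
      have "c * (0 - \<kappa>) + e' * (0 - \<kappa> * ?I) \<le> c * (?g u - \<kappa>) + e' * (?p u - \<kappa> * ?I)"
        using c g0 max_dist_nonneg[OF n, of u] wmax_nonneg[OF n1 r, of "\<lambda>i. u i - w i"]
        by (intro add_mono mult_left_mono) auto
      then show ?thesis using H0_ge[of u] by linarith
    qed
    show "0 < s" by (rule s)
    show "0 \<le> D u v" for u v by (simp add: D_def sum_nonneg)
    show "D u u = 0" for u by (simp add: D_def)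
    show "D u v \<le> 2 * \<rho>1 * ?C" if "u \<in> S" "v \<in> S" for u v by (rule D_bound[OF that])
    show "D u v - (1/2)^k \<le> Q k u v" for k u v by (rule Ql)
    show "Q k u v \<le> D u v" for k u v by (rule Qu)
    show "Q k u a - Q k v a \<le> D v u" for k u v a
      unfolding Q_def D_def sum_subtractf[symmetric]
    proof (rule sum_mono)
      fix j show "pk k (u j - a j) - pk k (v j - a j) \<le> norm (v j - u j)"
        using pk_lip[of k "u j - a j" "v j - a j"] by (simp add: norm_minus_commute)
    qed
    fix \<sigma> :: "nat \<Rightarrow> nat \<Rightarrow> 'a" assume \<sigma>: "\<And>k. \<sigma> k \<in> S" "\<And>k. D (\<sigma> (Suc k)) (\<sigma> k) \<le> 3 * (1/2)^k"
    have "\<exists>l. (\<lambda>k. \<sigma> k j) \<longlonglongrightarrow> l" if j: "j \<in> ?J'" for j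
    proof -
      have step: "norm (\<sigma> (Suc k) j - \<sigma> k j) \<le> 3 * (1/2)^k" for k
      proof -
        have "norm (\<sigma> (Suc k) j - \<sigma> k j) \<le> D (\<sigma> (Suc k)) (\<sigma> k)"
          unfolding D_def using j by (intro member_le_sum[where f = "\<lambda>j. norm (\<sigma> (Suc k) j - \<sigma> k j)"]) auto
        then show ?thesis using \<sigma>(2)[of k] by linarith
      qed
      have "summable (\<lambda>k. 3 * (1/2::real)^k)" by (intro summable_mult summable_geometric) simp
      then have "summable (\<lambda>k. norm (\<sigma> (Suc k) j - \<sigma> k j))"
        by (rule summable_comparison_test'[of _ 0]) (use step in simp)
      then have "summable (\<lambda>k. \<sigma> (Suc k) j - \<sigma> k j)" by (rule summable_norm_cancel)
      then have "(\<lambda>m. \<Sum>k<m. \<sigma> (Suc k) j - \<sigma> k j) \<longlonglongrightarrow> (\<Sum>k. \<sigma> (Suc k) j - \<sigma> k j)" by (rule summable_LIMSEQ)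
      then have "(\<lambda>m. \<sigma> m j - \<sigma> 0 j) \<longlonglongrightarrow> (\<Sum>k. \<sigma> (Suc k) j - \<sigma> k j)"
        using sum_lessThan_telescope[of "\<lambda>k. \<sigma> k j"] by simp
      then have "(\<lambda>m. (\<sigma> m j - \<sigma> 0 j) + \<sigma> 0 j) \<longlonglongrightarrow> (\<Sum>k. \<sigma> (Suc k) j - \<sigma> k j) + \<sigma> 0 j"
        by (intro tendsto_intros)
      then show ?thesis by auto
    qed
    then have "\<forall>j. \<exists>l. j \<in> ?J' \<longrightarrow> (\<lambda>k. \<sigma> k j) \<longlonglongrightarrow> l" by blast
    then obtain l where l: "\<And>j. j \<in> ?J' \<Longrightarrow> (\<lambda>k. \<sigma> k j) \<longlonglongrightarrow> l j" by metis
    have "l j \<in> \<Omega> j \<inter> V" if j: "j \<in> ?J'" for j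
    proof (rule closed_sequentially[OF _ _ l[OF j]])
      show "closed (\<Omega> j \<inter> V)" using \<Omega>[OF j] V(1) by (rule closed_Int)
      show "\<sigma> k j \<in> \<Omega> j \<inter> V" for k using \<sigma>(1)[of k] j by (simp add: S_def)
    qed
    moreover have "?p l \<le> \<rho>1"
      unfolding wmax_le_iff[OF n1 r]
    proof
      fix j assume j: "j \<in> ?J'"
      have "(\<lambda>k. norm (\<sigma> k j - w j)) \<longlonglongrightarrow> norm (l j - w j)" by (intro tendsto_intros l j)
      then show "norm (l j - w j) \<le> \<rho>1 * r j" by (rule LIMSEQ_le_const2) (use dS[OF \<sigma>(1) j] in blast)
    qed
    ultimately have "l \<in> S" by (simp add: S_def)
    moreover have "(\<lambda>k. D (\<sigma> k) l) \<longlonglongrightarrow> 0"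
    proof -
      have "(\<lambda>k. \<Sum>j=1..n. norm (\<sigma> k j - l j)) \<longlonglongrightarrow> (\<Sum>j=1..n. norm (l j - l j))"
        by (intro tendsto_intros l) auto
      then show ?thesis by (simp add: D_def)
    qed
    moreover have "(\<lambda>k. H0 (\<sigma> k)) \<longlonglongrightarrow> H0 l"
      unfolding H0_def
    proof (intro tendsto_add tendsto_mult tendsto_const lse_tendsto J J' \<kappa>(1))
      show "(\<lambda>k. p (\<sigma> k n - \<sigma> k j)) \<longlonglongrightarrow> p (l n - l j)" if "j \<in> ?J" for j
        using JJ'[OF that] nJ' by (intro smooth_norm_tendsto[OF p] tendsto_diff l) auto
      show "(\<lambda>k. p (\<sigma> k j - w j) / r j) \<longlonglongrightarrow> p (l j - w j) / r j" if "j \<in> ?J'" for j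
        using r that by (intro tendsto_divide smooth_norm_tendsto[OF p] tendsto_diff l tendsto_const) (auto simp: less_imp_neq[symmetric])
    qed
    ultimately show "\<exists>u\<in>S. (\<lambda>k. D (\<sigma> k) u) \<longlonglongrightarrow> 0 \<and> (\<lambda>k. H0 (\<sigma> k)) \<longlonglongrightarrow> H0 u" by blast
  qed blast
  have half: "summable (\<lambda>k. s * (1/2::real)^k)" "(\<Sum>k. s * (1/2::real)^k) = 2 * s"
    using sums_mult[OF geometric_sums[of "1/2::real"], of s] by (auto simp: sums_iff)
  have s_nn: "0 \<le> s * (1/2)^k" for k :: nat using s by simp
  have D_nn: "0 \<le> D u v" for u v by (simp add: D_def sum_nonneg)
  have pow1: "(1/2::real)^k \<le> 1" for k :: nat by (simp add: power_le_one)
  have Q_summ: "summable (\<lambda>k. s * (1/2)^k * Q k v (a k))" if v: "v \<in> S" for v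
  proof (rule summable_comparison_test'[where g = "\<lambda>k. s * (1/2)^k * (2 * \<rho>1 * ?C + 1)" and N = 0])
    show "summable (\<lambda>k. s * (1/2)^k * (2 * \<rho>1 * ?C + 1))" by (rule summable_mult2[OF half(1)])
    show "norm (s * (1/2)^k * Q k v (a k)) \<le> s * (1/2)^k * (2 * \<rho>1 * ?C + 1)" for k
    proof -
      have "\<bar>Q k v (a k)\<bar> \<le> 2 * \<rho>1 * ?C + 1"
        using Ql[of v "a k" k] Qu[of k v "a k"] D_nn[of v "a k"] D_bound[OF v aS, of k] pow1[of k] by linarith
      then show ?thesis unfolding real_norm_def abs_mult[of "s * (1/2)^k"] abs_of_nonneg[OF s_nn]
        by (rule mult_left_mono[OF _ s_nn])
    qed
  qed
  \<comment> \<open>The unsmoothed inequality at \<open>w\<close> has slope \<open>e\<close>, while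
    \<open>H0\<close> carries the slope \<open>e'\<close>. Comparing \<open>u\<close> with
    \<open>w\<close> thus bounds \<open>g0 * ?p u\<close> by the accumulated errors, which amount to
    at most half of \<open>g0 * \<rho>1\<close>.\<close>
  have strict: "?p u < \<rho>1"
  proof -
    have "(\<Sum>k. s * (1/2)^k * Q k w (a k)) \<le> (\<Sum>k. s * (1/2)^k * (\<rho>1 * ?C))"
      using Qu[of _ w] Dw[OF aS] s_nn
      by (intro suminf_le Q_summ[OF wS] summable_mult2 half(1) mult_left_mono) (auto intro: order_trans)
    then have 1: "(\<Sum>k. s * (1/2)^k * Q k w (a k)) \<le> 2 * s * (\<rho>1 * ?C)"
      using suminf_mult2[OF half(1), of "\<rho>1 * ?C"] half(2) by simp
    have "(\<Sum>k. s * (1/2)^k * (-1)) \<le> (\<Sum>k. s * (1/2)^k * Q k u (a k))"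
    proof (intro suminf_le Q_summ[OF uS] summable_mult2 half(1) mult_left_mono s_nn)
      show "- 1 \<le> Q k u (a k)" for k using Ql[of u "a k" k] D_nn[of u "a k"] pow1[of k] by linarith
    qed
    then have 2: "- (2 * s) \<le> (\<Sum>k. s * (1/2)^k * Q k u (a k))"
      using suminf_mult2[OF half(1), of "-1"] half(2) by simp
    have 3: "H0 w \<le> c * (M + \<kappa> * ?L) + e' * (\<kappa> * ?L)"
    proof -
      have "lse \<kappa> ?J (\<lambda>j. p (w n - w j)) \<le> M + \<kappa> * ln (real (card ?J))"
        unfolding M_def by (rule lse_le[OF J \<kappa>(1)]) (use p_le norm_le_max_dist in \<open>blast intro: order_trans\<close>)
      also have "\<dots> \<le> M + \<kappa> * ?L" using lnJ \<kappa>(1) by (intro add_left_mono mult_left_mono) auto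
      finally have a: "lse \<kappa> ?J (\<lambda>j. p (w n - w j)) \<le> M + \<kappa> * ?L" .
      have "lse \<kappa> ?J' (\<lambda>j. p (w j - w j) / r j) \<le> 0 + \<kappa> * ln (real (card ?J'))"
        by (rule lse_le[OF J' \<kappa>(1)]) (use p_le[of 0] r in \<open>simp add: divide_nonpos_pos\<close>)
      then have b: "lse \<kappa> ?J' (\<lambda>j. p (w j - w j) / r j) \<le> \<kappa> * ?L" by simp
      show ?thesis unfolding H0_def using a b c g0 by (intro add_mono mult_left_mono) auto
    qed
    have 4: "c * M \<le> c * ?g u + e * ?p u"
      unfolding M_def using uS \<rho>1(2) by (intro min) (auto simp: S_def)
    have "c * (?g u - \<kappa>) + e' * (?p u - \<kappa> * ?I) \<le> c * (M + \<kappa> * ?L) + e' * (\<kappa> * ?L) + 2 * s * (\<rho>1 * ?C) + 2 * s"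
      using H0_ge[of u] umin[OF wS] 1 2 3 by linarith
    then have "g0 * ?p u \<le> \<kappa> * K + 2 * s * (\<rho>1 * ?C + 1)"
      using 4 unfolding K_def e'_def by (simp add: algebra_simps)
    also have "\<dots> \<le> g0 * \<rho>1 / 4 + g0 * \<rho>1 / 4" by (intro add_mono s \<kappa>)
    also have "\<dots> < g0 * \<rho>1" using mult_pos_pos[OF g0(1) \<rho>1(1)] by linarith
    finally show ?thesis using g0(1) by (simp only: mult_less_cancel_left_pos)
  qed
  have uV: "u j \<in> V" and wV: "w j \<in> V" and aV: "a k j \<in> V" if "j \<in> ?J'" for j k
    using that uS aS[of k] w by (auto simp: S_def)
  have "\<forall>j. \<exists>y. j \<in> ?J \<longrightarrow> (y \<in> Y \<and> norm y \<le> 1 \<and> norm (u n - u j) - \<kappa> \<le> blinfun_apply y (u n - u j) \<and>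
      (p has_derivative blinfun_apply y) (at (u n - u j) within V))"
  proof
    fix j
    have "j \<in> ?J \<Longrightarrow> u n - u j \<in> V" using JJ' nJ' uV V(2) by (intro subspace_diff) auto
    then show "\<exists>y. j \<in> ?J \<longrightarrow> (y \<in> Y \<and> norm y \<le> 1 \<and> norm (u n - u j) - \<kappa> \<le> blinfun_apply y (u n - u j) \<and>
      (p has_derivative blinfun_apply y) (at (u n - u j) within V))" using p unfolding smooth_norm_def by blast
  qed
  then obtain y where y: "\<And>j. j \<in> ?J \<Longrightarrow> y j \<in> Y" "\<And>j. j \<in> ?J \<Longrightarrow> norm (y j) \<le> 1"
    "\<And>j. j \<in> ?J \<Longrightarrow> norm (u n - u j) - \<kappa> \<le> blinfun_apply (y j) (u n - u j)"
    "\<And>j. j \<in> ?J \<Longrightarrow> (p has_derivative blinfun_apply (y j)) (at (u n - u j) within V)" by metis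
  have "\<forall>j. \<exists>y. j \<in> ?J' \<longrightarrow> (y \<in> Y \<and> norm y \<le> 1 \<and> (p has_derivative blinfun_apply y) (at (u j - w j) within V))"
  proof
    fix j
    have "j \<in> ?J' \<Longrightarrow> u j - w j \<in> V" using uV wV V(2) by (intro subspace_diff) auto
    then show "\<exists>y. j \<in> ?J' \<longrightarrow> (y \<in> Y \<and> norm y \<le> 1 \<and> (p has_derivative blinfun_apply y) (at (u j - w j) within V))"
      using p unfolding smooth_norm_def by blast
  qed
  then obtain y' where y': "\<And>j. j \<in> ?J' \<Longrightarrow> y' j \<in> Y" "\<And>j. j \<in> ?J' \<Longrightarrow> norm (y' j) \<le> 1"
    "\<And>j. j \<in> ?J' \<Longrightarrow> (p has_derivative blinfun_apply (y' j)) (at (u j - w j) within V)" by metis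
  have "\<forall>j k. \<exists>y. j \<in> ?J' \<longrightarrow> (y \<in> Y \<and> norm y \<le> 1 \<and> (pk k has_derivative blinfun_apply y) (at (u j - a k j) within V))"
  proof (intro allI)
    fix j k
    have "j \<in> ?J' \<Longrightarrow> u j - a k j \<in> V" using uV aV V(2) by (intro subspace_diff) auto
    then show "\<exists>y. j \<in> ?J' \<longrightarrow> (y \<in> Y \<and> norm y \<le> 1 \<and> (pk k has_derivative blinfun_apply y) (at (u j - a k j) within V))"
      using pk[of k] unfolding smooth_norm_def by blast
  qed
  then obtain yk where yk: "\<And>j k. j \<in> ?J' \<Longrightarrow> yk j k \<in> Y" "\<And>j k. j \<in> ?J' \<Longrightarrow> norm (yk j k) \<le> 1"
    "\<And>j k. j \<in> ?J' \<Longrightarrow> (pk k has_derivative blinfun_apply (yk j k)) (at (u j - a k j) within V)" by metis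
  define sw where "sw = softmax \<kappa> ?J (\<lambda>j. p (u n - u j))"
  define sw' where "sw' = softmax \<kappa> ?J' (\<lambda>j. p (u j - w j) / r j)"
  have sw: "sw j > 0" "(\<Sum>j\<in>?J. sw j) = 1" and sw': "sw' j > 0" "(\<Sum>j\<in>?J'. sw' j) = 1" for j
    unfolding sw_def sw'_def by (intro softmax_pos sum_softmax J J')+
  define Z where "Z i = (\<Sum>k. (s * (1/2)^k) *\<^sub>R yk i k)" for i
  \<comment> \<open>The part of the perturbation series that depends on coordinate \<open>i\<close>;
    \<open>Z i\<close> is its gradient at \<open>u i\<close>.\<close>
  define P where "P i z = (\<Sum>k. s * (1/2)^k * pk k (z - a k i))" for i z
  have P_summ: "summable (\<lambda>k. s * (1/2)^k * pk k (z - a k i))" if i: "i \<in> ?J'" for i z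
  proof (rule summable_comparison_test'[where g = "\<lambda>k. s * (1/2)^k * (norm (z - w i) + \<rho>1 * r i + 1)" and N = 0])
    show "summable (\<lambda>k. s * (1/2)^k * (norm (z - w i) + \<rho>1 * r i + 1))" by (rule summable_mult2[OF half(1)])
    show "norm (s * (1/2)^k * pk k (z - a k i)) \<le> s * (1/2)^k * (norm (z - w i) + \<rho>1 * r i + 1)" for k
    proof -
      have "(1/2)^k / real n \<le> 1 / 1" using n pow1[of k] by (intro frac_le) auto
      moreover have "norm (z - a k i) \<le> norm (z - w i) + \<rho>1 * r i"
        using norm_triangle_ineq4[of "z - w i" "a k i - w i"] dS[OF aS i, of k] by simp
      ultimately have "\<bar>pk k (z - a k i)\<bar> \<le> norm (z - w i) + \<rho>1 * r i + 1"
        using pk_le[of k "z - a k i"] pk_ge[of "z - a k i" k] norm_ge_zero[of "z - a k i"] by linarith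
      then show ?thesis unfolding real_norm_def abs_mult[of "s * (1/2)^k"] abs_of_nonneg[OF s_nn]
        by (rule mult_left_mono[OF _ s_nn])
    qed
  qed
  have P_der: "(P i has_derivative blinfun_apply (Z i)) (at (u i) within V)"
    and Z_norm: "norm (Z i) \<le> 2 * s" and Z_summ: "summable (\<lambda>k. (s * (1/2)^k) *\<^sub>R yk i k)" if i: "i \<in> ?J'" for i
  proof -
    have der: "((\<lambda>z. pk k (z - a k i)) has_derivative blinfun_apply (yk i k)) (at (u i) within V)" for k
    proof (rule has_derivative_compose_within[where g = "\<lambda>z. z - a k i" and g' = "\<lambda>h. h" and p = "pk k"])
      show "(pk k has_derivative blinfun_apply (yk i k)) (at (u i - a k i) within V)" by (rule yk(3)[OF i])
      show "((\<lambda>z. z - a k i) has_derivative (\<lambda>h. h)) (at (u i) within V)" by (auto intro!: derivative_eq_intros)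
      show "(\<lambda>z. z - a k i) ` V \<subseteq> V" using aV[OF i] V(2) by (auto intro: subspace_diff)
    qed
    have lip: "\<bar>pk k (z - a k i) - pk k (u i - a k i)\<bar> \<le> norm (z - u i)" for k z
      using pk_lip[of k "z - a k i" "u i - a k i"] by simp
    note series = series_has_derivative_within[where f = "\<lambda>k z. pk k (z - a k i)" and y = "yk i",
      OF half(1) s_nn der lip yk(2)[OF i] P_summ[OF i]]
    show "(P i has_derivative blinfun_apply (Z i)) (at (u i) within V)"
      unfolding P_def[abs_def] Z_def by (rule series(1))
    show "norm (Z i) \<le> 2 * s" unfolding Z_def using series(2) half(2) by simp
    show "summable (\<lambda>k. (s * (1/2)^k) *\<^sub>R yk i k)" by (rule series(3))
  qed
  have ZY: "Z i \<in> Y" if i: "i \<in> ?J'" for i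
    unfolding Z_def
  proof (rule closed_sequentially[OF Y(1) _ summable_LIMSEQ[OF Z_summ[OF i]]])
    show "(\<Sum>k<m. (s * (1/2)^k) *\<^sub>R yk i k) \<in> Y" for m
      using yk(1)[OF i] Y(2) by (intro subspace_sum subspace_scale) auto
  qed
  \<comment> \<open>The gradient of the smoothed \<open>max_dist\<close>: the last coordinate occurs
    in every difference with a plus sign, each other coordinate in one difference with a minus sign.
    \<open>E\<close> collects penalty and perturbation.\<close>
  define A where "A i = (if i = n then (\<Sum>j\<in>?J. sw j *\<^sub>R y j) else - (sw i *\<^sub>R y i))" for i
  define E where "E i = (e' * sw' i / r i) *\<^sub>R y' i + Z i" for i
  define B where "B i = c *\<^sub>R A i + E i" for i
  have AY: "A i \<in> Y" if "i \<in> ?J'" for i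
    using that y(1) Y(2) by (auto simp: A_def intro!: subspace_sum subspace_scale subspace_neg)
  have EY: "E i \<in> Y" if "i \<in> ?J'" for i
    unfolding E_def using y'(1) ZY that Y(2) by (intro subspace_add subspace_scale) auto
  have updV: "(u(i := z)) j \<in> V" if "z \<in> V" "j \<in> ?J'" for z i j using that uV by simp
  have H0_der: "((\<lambda>z. H0 (u(i := z)) + P i z) has_derivative blinfun_apply (B i)) (at (u i) within V)" if i: "i \<in> ?J'" for i
  proof -
    have d1: "((\<lambda>z. p ((u(i := z)) n - (u(i := z)) j)) has_derivative
        (\<lambda>h. blinfun_apply (y j) ((if n = i then h else 0) - (if j = i then h else 0)))) (at (u i) within V)" if j: "j \<in> ?J" for j
    proof (rule has_derivative_compose_within[where g = "\<lambda>z. (u(i := z)) n - (u(i := z)) j" and p = p])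
      show "(p has_derivative blinfun_apply (y j)) (at ((u(i := u i)) n - (u(i := u i)) j) within V)" using y(4)[OF j] by simp
      show "((\<lambda>z. (u(i := z)) n - (u(i := z)) j) has_derivative (\<lambda>h. (if n = i then h else 0) - (if j = i then h else 0))) (at (u i) within V)"
        by (intro has_derivative_diff has_derivative_fun_upd)
      show "(\<lambda>z. (u(i := z)) n - (u(i := z)) j) ` V \<subseteq> V"
        using updV[of _ n i] updV[of _ j i] nJ' JJ'[OF j] V(2) by (blast intro: subspace_diff)
    qed
    have d2: "((\<lambda>z. p ((u(i := z)) j - w j) / r j) has_derivative
        (\<lambda>h. blinfun_apply (y' j) (if j = i then h else 0) / r j)) (at (u i) within V)" if j: "j \<in> ?J'" for j
    proof -
      have "((\<lambda>z. p ((u(i := z)) j - w j)) has_derivative (\<lambda>h. blinfun_apply (y' j) (if j = i then h else 0))) (at (u i) within V)"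
      proof (rule has_derivative_compose_within[where g = "\<lambda>z. (u(i := z)) j - w j" and p = p])
        show "(p has_derivative blinfun_apply (y' j)) (at ((u(i := u i)) j - w j) within V)" using y'(3)[OF j] by simp
        have "((\<lambda>z. (u(i := z)) j - w j) has_derivative (\<lambda>h. (if j = i then h else 0) - 0)) (at (u i) within V)"
          by (intro has_derivative_diff has_derivative_fun_upd has_derivative_const)
        then show "((\<lambda>z. (u(i := z)) j - w j) has_derivative (\<lambda>h. if j = i then h else 0)) (at (u i) within V)" by simp
        show "(\<lambda>z. (u(i := z)) j - w j) ` V \<subseteq> V"
          using updV[of _ j i] wV[OF j] j V(2) by (blast intro: subspace_diff)
      qed
      then show ?thesis unfolding divide_inverse by (rule has_derivative_mult_left)
    qed
    have "((\<lambda>z. H0 (u(i := z)) + P i z) has_derivative (\<lambda>h.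
        c * (\<Sum>j\<in>?J. sw j * blinfun_apply (y j) ((if n = i then h else 0) - (if j = i then h else 0))) +
        e' * (\<Sum>j\<in>?J'. sw' j * (blinfun_apply (y' j) (if j = i then h else 0) / r j)) + blinfun_apply (Z i) h)) (at (u i) within V)"
      using lse_has_derivative[where a = "\<lambda>z j. p ((u(i := z)) n - (u(i := z)) j)", OF J \<kappa>(1) d1]
        lse_has_derivative[where a = "\<lambda>z j. p ((u(i := z)) j - w j) / r j", OF J' \<kappa>(1) d2]
      unfolding H0_def fun_upd_triv sw_def[symmetric] sw'_def[symmetric]
      by (intro has_derivative_add has_derivative_mult_right P_der[OF i])
    moreover have "(\<Sum>j\<in>?J. sw j * blinfun_apply (y j) ((if n = i then h else 0) - (if j = i then h else 0))) = blinfun_apply (A i) h" for h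
    proof (cases "i = n")
      case True
      then have "(\<Sum>j\<in>?J. sw j * blinfun_apply (y j) ((if n = i then h else 0) - (if j = i then h else 0))) = (\<Sum>j\<in>?J. sw j * blinfun_apply (y j) h)"
        using JJ' by (intro sum.cong) auto
      then show ?thesis using True by (simp add: A_def blinfun.sum_left blinfun.scaleR_left)
    next
      case False
      then have "(\<Sum>j\<in>?J. sw j * blinfun_apply (y j) ((if n = i then h else 0) - (if j = i then h else 0))) = (\<Sum>j\<in>?J. if j = i then - (sw i * blinfun_apply (y i) h) else 0)"
        by (intro sum.cong) (auto simp: blinfun.minus_right blinfun.zero_right)
      moreover have "i \<in> ?J" using False i by auto
      ultimately show ?thesis using False by (simp add: A_def blinfun.minus_left blinfun.scaleR_left)
    qed
    moreover have "(\<Sum>j\<in>?J'. sw' j * (blinfun_apply (y' j) (if j = i then h else 0) / r j)) = sw' i * blinfun_apply (y' i) h / r i" for h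
    proof -
      have "(\<Sum>j\<in>?J'. sw' j * (blinfun_apply (y' j) (if j = i then h else 0) / r j)) = (\<Sum>j\<in>?J'. if j = i then sw' i * blinfun_apply (y' i) h / r i else 0)"
        by (intro sum.cong) (auto simp: blinfun.zero_right)
      then show ?thesis using i by simp
    qed
    ultimately have "((\<lambda>z. H0 (u(i := z)) + P i z) has_derivative (\<lambda>h.
        c * blinfun_apply (A i) h + e' * (sw' i * blinfun_apply (y' i) h / r i) + blinfun_apply (Z i) h)) (at (u i) within V)"
      by (simp only:)
    moreover have "(\<lambda>h. c * blinfun_apply (A i) h + e' * (sw' i * blinfun_apply (y' i) h / r i) + blinfun_apply (Z i) h)
        = blinfun_apply (B i)"
      by (rule ext) (simp add: B_def E_def blinfun.add_left blinfun.scaleR_left)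
    ultimately show ?thesis by (simp only:)
  qed
  have crit: "(- inverse c) *\<^sub>R B i \<in> frechet_normal_cone (\<Omega> i) (u i)" if i: "i \<in> ?J'" for i
  proof (rule normal)
    show "u i \<in> V" by (rule uV[OF i])
    show "(- inverse c) *\<^sub>R B i \<in> Y" unfolding B_def using AY EY i Y(2) by (intro subspace_scale subspace_add) auto
    fix e2 :: real assume e2: "e2 > 0"
    then have "c * e2 > 0" using c by simp
    then obtain d where d: "d > 0" "\<And>z. z \<in> V \<Longrightarrow> norm (z - u i) < d \<Longrightarrow>
        norm ((H0 (u(i := z)) + P i z) - (H0 (u(i := u i)) + P i (u i)) - blinfun_apply (B i) (z - u i)) \<le> c * e2 * norm (z - u i)"
      using H0_der[OF i] unfolding has_derivative_within_alt by blast
    \<comment> \<open>The second term is positive by \<open>strict\<close> and keeps the modified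
      tuple in \<open>S\<close>, so the minimality of \<open>u\<close> may be tested at it.\<close>
    define d' where "d' = min d (\<rho>1 * r i - norm (u i - w i))"
    have "norm (u i - w i) < \<rho>1 * r i" using strict i unfolding wmax_less_iff[OF n1 r] by blast
    then have d': "d' > 0" using d by (simp add: d'_def)
    show "\<exists>\<delta>>0. \<forall>z\<in>\<Omega> i \<inter> V. norm (z - u i) < \<delta> \<longrightarrow> blinfun_apply ((- inverse c) *\<^sub>R B i) (z - u i) \<le> e2 * norm (z - u i)"
    proof (intro exI[of _ d'] conjI ballI impI d')
      fix z assume z: "z \<in> \<Omega> i \<inter> V" "norm (z - u i) < d'"
      have "norm (z - w i) \<le> \<rho>1 * r i"
        using norm_triangle_ineq[of "z - u i" "u i - w i"] z(2) by (simp add: d'_def)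
      then have zS: "u(i := z) \<in> S"
        using uS z(1) dS[OF uS] unfolding S_def by (auto simp: wmax_le_iff[OF n1 r])
      have Q_upd: "s * (1/2)^k * Q k (u(i := z)) (a k) =
          s * (1/2)^k * Q k u (a k) + (s * (1/2)^k * pk k (z - a k i) - s * (1/2)^k * pk k (u i - a k i))" for k
      proof -
        have "Q k (u(i := z)) (a k) = pk k (z - a k i) + (\<Sum>j\<in>?J' - {i}. pk k (u j - a k j))"
          unfolding Q_def using i by (subst sum.remove[of _ i]) auto
        moreover have "Q k u (a k) = pk k (u i - a k i) + (\<Sum>j\<in>?J' - {i}. pk k (u j - a k j))"
          unfolding Q_def using i by (subst sum.remove[of _ i]) auto
        ultimately have "Q k (u(i := z)) (a k) = Q k u (a k) + (pk k (z - a k i) - pk k (u i - a k i))" by simp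
        then show ?thesis by (simp only: distrib_left right_diff_distrib)
      qed
      have "(\<Sum>k. s * (1/2)^k * Q k (u(i := z)) (a k)) = (\<Sum>k. s * (1/2)^k * Q k u (a k)) + (P i z - P i (u i))"
        unfolding Q_upd P_def
        by (simp add: suminf_add[symmetric] suminf_diff[symmetric] Q_summ[OF uS] P_summ[OF i] summable_diff)
      then have "H0 u + P i (u i) \<le> H0 (u(i := z)) + P i z" using umin[OF zS] by linarith
      moreover have "\<bar>(H0 (u(i := z)) + P i z) - (H0 u + P i (u i)) - blinfun_apply (B i) (z - u i)\<bar> \<le> c * e2 * norm (z - u i)"
        using d(2)[of z] z by (simp add: d'_def)
      ultimately have "- blinfun_apply (B i) (z - u i) \<le> c * (e2 * norm (z - u i))"
        unfolding abs_le_iff by (simp add: mult.assoc)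
      then have "inverse c * (- blinfun_apply (B i) (z - u i)) \<le> inverse c * (c * (e2 * norm (z - u i)))"
        using c by (intro mult_left_mono) auto
      then show "blinfun_apply ((- inverse c) *\<^sub>R B i) (z - u i) \<le> e2 * norm (z - u i)"
      proof -
        have "inverse c * (c * (e2 * norm (z - u i))) = e2 * norm (z - u i)" using c by simp
        moreover have "blinfun_apply ((- inverse c) *\<^sub>R B i) (z - u i) = inverse c * (- blinfun_apply (B i) (z - u i))"
          by (simp add: blinfun.scaleR_left blinfun.minus_left)
        ultimately show ?thesis using \<open>inverse c * (- blinfun_apply (B i) (z - u i)) \<le> inverse c * (c * (e2 * norm (z - u i)))\<close>
          by linarith
      qed
    qed
  qed
  define v where "v i = sw i *\<^sub>R y i" for i
  define yo where "yo i = inverse c *\<^sub>R E i" for i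
  have crit': "- A i - yo i \<in> frechet_normal_cone (\<Omega> i) (u i)" if i: "i \<in> ?J'" for i
  proof -
    have "(- inverse c) *\<^sub>R B i = - A i - yo i" using c by (simp add: B_def yo_def scaleR_add_right)
    then show ?thesis using crit[OF i] by simp
  qed
  show ?thesis
  proof (rule that[of u v yo])
    show "u i \<in> \<Omega> i" if "i \<in> ?J'" for i using uS that by (simp add: S_def)
    show "?p u \<le> \<rho>" using strict \<rho>1 by linarith
    have nv: "norm (v i) \<le> sw i" if "i \<in> ?J" for i
      using y(2)[OF that] sw(1)[of i] by (simp add: v_def mult_left_le)
    then have "(\<Sum>i\<in>?J. norm (v i)) \<le> (\<Sum>i\<in>?J. sw i)" by (intro sum_mono)
    then show "(\<Sum>i=1..n-1. norm (v i)) \<le> 1" using sw(2) by simp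
    show "\<tau> * ?g u \<le> (\<Sum>i=1..n-1. blinfun_apply (v i) (u n - u i))"
    proof -
      let ?T = "\<Sum>i=1..n-1. blinfun_apply (v i) (u n - u i)"
      have "(\<Sum>j\<in>?J. sw j * p (u n - u j) - sw j * \<kappa>) \<le> ?T"
      proof (rule sum_mono)
        fix j assume j: "j \<in> ?J"
        have "p (u n - u j) - \<kappa> \<le> blinfun_apply (y j) (u n - u j)" using y(3)[OF j] p_le[of "u n - u j"] by linarith
        then have "sw j * (p (u n - u j) - \<kappa>) \<le> sw j * blinfun_apply (y j) (u n - u j)"
          using sw(1)[of j] by (intro mult_left_mono) auto
        then show "sw j * p (u n - u j) - sw j * \<kappa> \<le> blinfun_apply (v j) (u n - u j)"
          by (simp add: v_def blinfun.scaleR_left right_diff_distrib)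
      qed
      moreover have "(\<Sum>j\<in>?J. sw j * p (u n - u j) - sw j * \<kappa>) = (\<Sum>j\<in>?J. sw j * p (u n - u j)) - \<kappa>"
        unfolding sum_subtractf sum_distrib_right[symmetric] sw(2) by simp
      ultimately have T: "(\<Sum>j\<in>?J. sw j * p (u n - u j)) - \<kappa> \<le> ?T" by linarith
      \<comment> \<open>One \<open>\<kappa>\<close> is lost in passing from \<open>p\<close> to the
        gradients, one from norms to \<open>p\<close>, and \<open>\<kappa> * ?L\<close> through the
        entropy of the softmax weights.\<close>
      have "?g u \<le> ?T + \<kappa> * (2 + ?L)"
        unfolding max_dist_le_iff[OF n]
      proof
        fix i assume i: "i \<in> ?J"
        have "p (u n - u i) - \<kappa> * ln (real (card ?J)) \<le> (\<Sum>j\<in>?J. sw j * p (u n - u j))"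
          unfolding sw_def by (rule softmax_average_ge[where a = "\<lambda>j. p (u n - u j)", OF J(1) i \<kappa>(1)])
        moreover have "\<kappa> * ln (real (card ?J)) \<le> \<kappa> * ?L" using lnJ \<kappa>(1) by (intro mult_left_mono) auto
        ultimately show "norm (u n - u i) \<le> ?T + \<kappa> * (2 + ?L)"
          using T p_ge[of "u n - u i"] by (simp add: algebra_simps)
      qed
      moreover have "M / 2 \<le> ?g u"
      proof -
        have "\<bar>?g u - M\<bar> \<le> ?C * ?p u" unfolding M_def by (rule max_dist_lipschitz_abs[OF n r])
        also have "\<dots> \<le> ?C * \<rho>1" using strict C0 by (intro mult_left_mono) auto
        finally show ?thesis using \<rho>1(3) by linarith
      qed
      then have "(1 - \<tau>) * (M / 2) \<le> (1 - \<tau>) * ?g u" using \<tau> by (intro mult_left_mono) auto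
      moreover have "(1 - \<tau>) * ?g u = ?g u - \<tau> * ?g u" by (simp add: left_diff_distrib)
      ultimately show ?thesis using \<kappa>(2) by linarith
    qed
    show "c * (\<Sum>i=1..n. r i * norm (yo i)) \<le> e1"
    proof -
      have "c * (\<Sum>i=1..n. r i * norm (yo i)) = (\<Sum>i=1..n. r i * norm (E i))"
        unfolding sum_distrib_left using c by (intro sum.cong) (simp_all add: yo_def field_simps)
      also have "\<dots> \<le> (\<Sum>i=1..n. e' * sw' i + 2 * s * r i)"
      proof (rule sum_mono)
        fix i assume i: "i \<in> ?J'"
        have ri: "r i > 0" using r by simp
        have k: "e' * sw' i / r i \<ge> 0" using g0 sw'(1)[of i] ri by simp
        have "norm (E i) \<le> norm ((e' * sw' i / r i) *\<^sub>R y' i) + norm (Z i)" unfolding E_def by (rule norm_triangle_ineq)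
        also have "\<dots> \<le> e' * sw' i / r i + 2 * s"
          using mult_left_mono[OF y'(2)[OF i] k] Z_norm[OF i]
          unfolding norm_scaleR abs_of_nonneg[OF k] mult_1_right by (rule add_mono)
        finally have "r i * norm (E i) \<le> r i * (e' * sw' i / r i + 2 * s)" using ri by (intro mult_left_mono) auto
        also have "\<dots> = e' * sw' i + 2 * s * r i" using ri by (simp add: distrib_left)
        finally show "r i * norm (E i) \<le> e' * sw' i + 2 * s * r i" .
      qed
      \<comment> \<open>The softmax weights sum to 1, so the penalty gradients cost exactly
        \<open>e'\<close> and not \<open>n\<close> times as much.\<close>
      also have "\<dots> = e' + 2 * s * ?C"
        unfolding sum.distrib sum_distrib_left[symmetric] sw'(2) by simp
      also have "\<dots> \<le> e1" using s(2) g0(2) by linarith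
      finally show ?thesis .
    qed
    show "v i - yo i \<in> frechet_normal_cone (\<Omega> i) (u i)" if "i \<in> ?J" for i
      using crit'[of i] JJ'[OF that] by (simp add: A_def v_def)
    show "- (\<Sum>i=1..n-1. v i) - yo n \<in> frechet_normal_cone (\<Omega> n) (u n)"
      using crit'[OF nJ'] by (simp add: A_def v_def)
  qed
qed


subsection \<open>Multipliers for extremal tuples\<close>

lemma frechet_normal_coneD:
  assumes f: "f \<in> frechet_normal_cone \<Omega> x" and e: "e > 0"
  shows "\<exists>\<delta>>0. \<forall>z\<in>\<Omega>. norm (z - x) < \<delta> \<longrightarrow> blinfun_apply f (z - x) \<le> e * norm (z - x)"
proof -
  have "0 < ereal e" using e by simp
  then have "\<forall>\<^sub>F z in at x within \<Omega>. ereal (blinfun_apply f (z - x) / norm (z - x)) < ereal e"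
    using f unfolding frechet_normal_cone_def mem_Collect_eq Limsup_le_iff by blast
  then obtain \<delta> where \<delta>: "\<delta> > 0" "\<And>z. z \<in> \<Omega> \<Longrightarrow> z \<noteq> x \<Longrightarrow> dist z x < \<delta> \<Longrightarrow>
      blinfun_apply f (z - x) / norm (z - x) < e"
    unfolding eventually_at by auto
  have "blinfun_apply f (z - x) \<le> e * norm (z - x)" if "z \<in> \<Omega>" "norm (z - x) < \<delta>" for z
  proof (cases "z = x")
    case False
    then show ?thesis using \<delta>(2)[OF that(1) False] that(2) by (simp add: dist_norm pos_divide_less_eq less_imp_le)
  qed (simp add: blinfun.zero_right)
  then show ?thesis using \<delta>(1) by blast
qed

lemma frechet_normal_cone_scale:
  assumes f: "f \<in> frechet_normal_cone \<Omega> x" and t: "t > 0"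
  shows "t *\<^sub>R f \<in> frechet_normal_cone \<Omega> x"
proof (rule frechet_normal_coneI)
  fix e :: real assume "e > 0"
  then have "e / t > 0" using t by simp
  then obtain \<delta> where \<delta>: "\<delta> > 0" "\<And>z. z \<in> \<Omega> \<Longrightarrow> norm (z - x) < \<delta> \<Longrightarrow> blinfun_apply f (z - x) \<le> e / t * norm (z - x)"
    using frechet_normal_coneD[OF f] by blast
  have "blinfun_apply (t *\<^sub>R f) (z - x) \<le> e * norm (z - x)" if "z \<in> \<Omega>" "norm (z - x) < \<delta>" for z
    using mult_left_mono[OF \<delta>(2)[OF that], of t] t by (simp add: blinfun.scaleR_left)
  then show "\<exists>\<delta>>0. \<forall>z\<in>\<Omega>. norm (z - x) < \<delta> \<longrightarrow> blinfun_apply (t *\<^sub>R f) (z - x) \<le> e * norm (z - x)"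
    using \<delta>(1) by blast
qed

theorem proposition4p4:
  fixes n :: nat
    and \<Omega> :: "nat \<Rightarrow> 'a::banach set"
    and \<omega> :: "nat \<Rightarrow> 'a"
    and \<phi> :: "real \<Rightarrow> real"
    and \<epsilon> lam \<eta> :: real
  assumes "n \<ge> 2"
    and "\<forall>i\<in>{1..n}. closed (\<Omega> i)"
    and "\<forall>i\<in>{1..n}. \<omega> i \<in> \<Omega> i"
    and "\<epsilon> > 0"
    and "\<phi> \<in> class_C1"
    and "(\<Inter>i\<in>{1..n}. \<Omega> i) = {}"
    and "\<phi> (max_dist n \<omega>) < \<phi> (sets_dist n \<Omega>) + \<epsilon>"
    and "lam > 0"
    and "\<eta> > 0"
  shows "(\<exists>(\<omega>' :: nat \<Rightarrow> 'a) (xs :: nat \<Rightarrow> 'a \<Rightarrow>\<^sub>L real).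
            (\<forall>i\<in>{1..n - 1}. \<omega>' i \<in> \<Omega> i \<inter> ball (\<omega> i) lam) \<and>
            \<omega>' n \<in> \<Omega> n \<inter> ball (\<omega> n) \<eta> \<and>
            0 < max_dist n \<omega>' \<and> max_dist n \<omega>' \<le> max_dist n \<omega> \<and>
            (\<Sum>i=1..n. xs i) = 0 \<and> (\<Sum>i=1..n - 1. norm (xs i)) = 1 \<and>
            deriv \<phi> (max_dist n \<omega>') *
              (lam * (\<Sum>i=1..n - 1. infdist (xs i) (clarke_normal_cone (\<Omega> i) (\<omega>' i))) +
               \<eta> * infdist (xs n) (clarke_normal_cone (\<Omega> n) (\<omega>' n))) < \<epsilon> \<and>
            (\<Sum>i=1..n - 1. blinfun_apply (xs i) (\<omega>' n - \<omega>' i)) = max_dist n \<omega>')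
       \<and> (asplund TYPE('a) \<longrightarrow> (\<forall>\<tau>\<in>{0<..<1}.
          (\<exists>(\<omega>' :: nat \<Rightarrow> 'a) (xs :: nat \<Rightarrow> 'a \<Rightarrow>\<^sub>L real).
            (\<forall>i\<in>{1..n - 1}. \<omega>' i \<in> \<Omega> i \<inter> ball (\<omega> i) lam) \<and>
            \<omega>' n \<in> \<Omega> n \<inter> ball (\<omega> n) \<eta> \<and>
            0 < max_dist n \<omega>' \<and>
            max_dist n \<omega>' < inv_into {0..} \<phi> (\<phi> (sets_dist n \<Omega>) + \<epsilon>) \<and>
            (\<Sum>i=1..n. xs i) = 0 \<and> (\<Sum>i=1..n - 1. norm (xs i)) = 1 \<and>
            deriv \<phi> (max_dist n \<omega>') *
              (lam * (\<Sum>i=1..n - 1. infdist (xs i) (frechet_normal_cone (\<Omega> i) (\<omega>' i))) +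
               \<eta> * infdist (xs n) (frechet_normal_cone (\<Omega> n) (\<omega>' n))) < \<epsilon> \<and>
            (\<Sum>i=1..n - 1. blinfun_apply (xs i) (\<omega>' n - \<omega>' i)) > \<tau> * max_dist n \<omega>')))"
proof -
  note n = assms(1) and \<epsilon> = assms(4) and \<phi> = assms(5)
  let ?g = "max_dist n"
  let ?d = "sets_dist n \<Omega>"
  define r where "r i = (if i = n then \<eta> else lam)" for i
  have r: "\<forall>i. r i > 0" using assms(8,9) by (simp add: r_def)
  have n1: "n \<ge> 1" and nn: "n \<in> {1..n}" and sub: "\<And>i. i \<in> {1..n-1} \<Longrightarrow> i \<in> {1..n} \<and> i \<noteq> n" using n by auto
  have split: "{1..n} = insert n {1..n-1}" "n \<notin> {1..n-1}" using n by auto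
  have d_le: "?d \<le> ?g u" if "\<And>i. i \<in> {1..n} \<Longrightarrow> u i \<in> \<Omega> i" for u
    unfolding sets_dist_def
    by (rule cINF_lower) (use that max_dist_nonneg[OF n] in \<open>auto intro!: bdd_belowI2[of _ 0]\<close>)
  have d0: "0 \<le> ?d"
    unfolding sets_dist_def
    by (rule cINF_greatest) (use assms(3) max_dist_nonneg[OF n] in auto)
  have mono: "\<phi> s < \<phi> t" if "0 \<le> s" "s < t" for s t
    using \<phi> that by (auto simp: class_C1_def strict_mono_on_def)
  have balls: "(\<forall>i\<in>{1..n - 1}. u i \<in> \<Omega> i \<inter> ball (\<omega> i) lam) \<and> u n \<in> \<Omega> n \<inter> ball (\<omega> n) \<eta>"
    if u: "\<And>i. i \<in> {1..n} \<Longrightarrow> u i \<in> \<Omega> i" and near: "wmax n r (\<lambda>i. u i - \<omega> i) < 1" for u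
  proof -
    have "norm (u i - \<omega> i) < r i" if "i \<in> {1..n}" for i
      using near that unfolding wmax_less_iff[OF n1 r] by simp
    then have "dist (\<omega> i) (u i) < r i" if "i \<in> {1..n}" for i using that by (simp add: dist_norm norm_minus_commute)
    then show ?thesis using u sub nn by (fastforce simp: r_def)
  qed
  \<comment> \<open>\<open>x i - y i\<close> is a point of the cone at distance
    \<open>norm (y i)\<close> from \<open>x i\<close>. It also shows that the cone is nonempty, so
    \<open>infdist\<close> does not take its default value 0.\<close>
  have infdist_bound: "lam * (\<Sum>i=1..n - 1. infdist (x i) (N i)) + \<eta> * infdist (x n) (N n) \<le> (\<Sum>i=1..n. r i * norm (y i))"
    if mem: "\<And>i. i \<in> {1..n} \<Longrightarrow> x i - y i \<in> N i" for x y :: "nat \<Rightarrow> 'a \<Rightarrow>\<^sub>L real" and N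
  proof -
    have le: "infdist (x i) (N i) \<le> norm (y i)" if i: "i \<in> {1..n}" for i
      using infdist_le[OF mem[OF i], of "x i"] by (simp add: dist_norm)
    have "(\<Sum>i=1..n. r i * norm (y i)) = \<eta> * norm (y n) + (\<Sum>i=1..n-1. lam * norm (y i))"
      unfolding split(1) using split(2) sub by (simp add: r_def)
    moreover have "lam * (\<Sum>i=1..n - 1. infdist (x i) (N i)) \<le> (\<Sum>i=1..n-1. lam * norm (y i))"
      unfolding sum_distrib_left using le sub assms(8) by (intro sum_mono mult_left_mono) auto
    moreover have "\<eta> * infdist (x n) (N n) \<le> \<eta> * norm (y n)"
      using le[OF nn] assms(9) by (intro mult_left_mono) auto
    ultimately show ?thesis by linarith
  qed
  have total: "(\<Sum>i=1..n. x i) = 0" if "x n = - (\<Sum>i=1..n-1. x i)" for x :: "nat \<Rightarrow> 'a \<Rightarrow>\<^sub>L real"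
    unfolding split(1) using split(2) that by simp
  show ?thesis
  proof (intro conjI impI ballI, goal_cases)
    case 1
    obtain w e \<rho> where w: "\<And>i. i \<in> {1..n} \<Longrightarrow> w i \<in> \<Omega> i" "wmax n r (\<lambda>i. w i - \<omega> i) < 1"
      "?g w \<le> ?g \<omega>" "0 < ?g w" "0 < e" "e < \<epsilon>" "0 < \<rho>"
      and lin: "\<And>u. (\<And>i. i \<in> {1..n} \<Longrightarrow> u i \<in> \<Omega> i) \<Longrightarrow> wmax n r (\<lambda>i. u i - w i) \<le> \<rho> \<Longrightarrow>
        deriv \<phi> (?g w) * ?g w \<le> deriv \<phi> (?g w) * ?g u + e * wmax n r (\<lambda>i. u i - w i)"
      using extremal_pair_exists[OF n, of \<Omega> \<omega> \<phi> ?d \<epsilon> r] assms(2,3,6,7) \<phi> d0 d_le r by blast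
    have c: "deriv \<phi> (?g w) > 0" using \<phi> w(4) by (simp add: class_C1_def)
    obtain v y :: "nat \<Rightarrow> 'a \<Rightarrow>\<^sub>L real" where v: "(\<Sum>i=1..n-1. norm (v i)) = 1"
      "(\<Sum>i=1..n-1. blinfun_apply (v i) (w n - w i)) = ?g w"
      "deriv \<phi> (?g w) * (\<Sum>i=1..n. r i * norm (y i)) \<le> e"
      "\<And>i. i \<in> {1..n-1} \<Longrightarrow> v i - y i \<in> clarke_normal_cone (\<Omega> i) (w i)"
      "- (\<Sum>i=1..n-1. v i) - y n \<in> clarke_normal_cone (\<Omega> n) (w n)"
      using clarke_multipliers[OF n r c w(5,7), of w \<Omega>] w(1,4) lin by blast
    define x where "x i = (if i = n then - (\<Sum>i=1..n-1. v i) else v i)" for i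
    have xv: "x i = v i" if "i \<in> {1..n-1}" for i using sub[OF that] by (simp add: x_def)
    have "x i - y i \<in> clarke_normal_cone (\<Omega> i) (w i)" if "i \<in> {1..n}" for i
      using v(4)[of i] v(5) that n by (cases "i = n") (auto simp: x_def)
    then have "lam * (\<Sum>i=1..n - 1. infdist (x i) (clarke_normal_cone (\<Omega> i) (w i))) + \<eta> * infdist (x n) (clarke_normal_cone (\<Omega> n) (w n))
       \<le> (\<Sum>i=1..n. r i * norm (y i))" by (rule infdist_bound)
    from mult_left_mono[OF this, of "deriv \<phi> (?g w)"]
    have est: "deriv \<phi> (?g w) * (lam * (\<Sum>i=1..n - 1. infdist (x i) (clarke_normal_cone (\<Omega> i) (w i))) +
       \<eta> * infdist (x n) (clarke_normal_cone (\<Omega> n) (w n))) < \<epsilon>" using v(3) w(6) c by linarith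
    have "(\<Sum>i=1..n-1. x i) = (\<Sum>i=1..n-1. v i)" by (intro sum.cong refl xv)
    then have sums: "(\<Sum>i=1..n. x i) = 0" by (intro total) (simp add: x_def[of n])
    have bl: "(\<forall>i\<in>{1..n - 1}. w i \<in> \<Omega> i \<inter> ball (\<omega> i) lam) \<and> w n \<in> \<Omega> n \<inter> ball (\<omega> n) \<eta>"
      by (rule balls[OF _ w(2)]) (rule w(1))
    have eqs: "(\<Sum>i=1..n-1. norm (x i)) = 1" "(\<Sum>i=1..n-1. blinfun_apply (x i) (w n - w i)) = ?g w"
      using v(1,2) by (simp_all only: xv cong: sum.cong)
    show ?case
      by (intro exI[of _ w] exI[of _ x] conjI bl[THEN conjunct1] bl[THEN conjunct2] w(3,4) est sums eqs)
  next
    case (2 \<tau>)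
    note asp = 2(1) and \<tau> = 2(2)
    have cnt: "countable (\<omega> ` {1..n})" by simp
    obtain V :: "'a set" and Y :: "('a \<Rightarrow>\<^sub>L real) set" and ys :: "nat \<Rightarrow> 'a \<Rightarrow> real" where
      V: "closed V" "subspace V" "\<omega> ` {1..n} \<subseteq> V" and Y: "closed Y" "subspace Y"
      and ys: "\<And>k. ys k \<in> dual_ball"
        "\<And>f e. f \<in> dual_ball \<Longrightarrow> e > 0 \<Longrightarrow> \<exists>k. \<forall>x\<in>V. \<bar>f x - ys k x\<bar> \<le> e * norm x"
      and lift: "\<And>f. f \<in> dual_ball \<Longrightarrow> \<exists>y\<in>Y. norm y \<le> 1 \<and> (\<forall>x\<in>V. blinfun_apply y x = f x)"
      and normal: "\<And>i x y. x \<in> V \<Longrightarrow> y \<in> Y \<Longrightarrow>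
      (\<And>e. e > 0 \<Longrightarrow> \<exists>\<delta>>0. \<forall>z\<in>\<Omega> i \<inter> V. norm (z - x) < \<delta> \<longrightarrow> blinfun_apply y (z - x) \<le> e * norm (z - x)) \<Longrightarrow>
      y \<in> frechet_normal_cone (\<Omega> i) x"
    proof (rule asplund_separable_reduction[OF asp cnt, where \<Omega> = \<Omega>], goal_cases)
      case (1 V Y ys)
      show ?case by (rule that[of V Y ys]) (fact 1)+
    qed
    obtain \<psi> where \<psi>: "smooth_norm V Y 1 \<psi>"
    proof (rule smooth_norm_approximation[of V ys Y])
      show "0 \<in> V" "\<And>c x. x \<in> V \<Longrightarrow> c *\<^sub>R x \<in> V" "\<And>x y. x \<in> V \<Longrightarrow> y \<in> V \<Longrightarrow> x - y \<in> V"
        using V(2) by (auto intro: subspace_0 subspace_scale subspace_diff)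
      fix \<psi> assume "\<And>x. norm x - 1 \<le> \<psi> x" "\<And>x. \<psi> x \<le> norm x" "\<And>x y. \<bar>\<psi> x - \<psi> y\<bar> \<le> norm (x - y)"
        "\<And>x. x \<in> V \<Longrightarrow> \<exists>y\<in>Y. norm y \<le> 1 \<and> norm x - 1 \<le> blinfun_apply y x \<and> (\<psi> has_derivative blinfun_apply y) (at x within V)"
      then show thesis by (intro that[of \<psi>]) (simp add: smooth_norm_def)
    qed (use ys lift in blast)+
    have smooth: "\<exists>p. smooth_norm V Y \<kappa> p" if "\<kappa> > 0" for \<kappa>
      using smooth_norm_scale[OF \<psi> _ that] V(2) by (blast intro: subspace_scale)
    have \<omega>V: "\<omega> i \<in> \<Omega> i \<inter> V" if "i \<in> {1..n}" for i using that assms(3) V(3) by blast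
    \<comment> \<open>Ekeland's principle for the sets cut down to \<open>V\<close>, which contains
      every \<open>\<omega> i\<close>, with the distance of the original sets as lower
      bound.\<close>
    obtain w e \<rho> where w: "\<And>i. i \<in> {1..n} \<Longrightarrow> w i \<in> \<Omega> i \<inter> V" "wmax n r (\<lambda>i. w i - \<omega> i) < 1"
      "?g w \<le> ?g \<omega>" "0 < ?g w" "0 < e" "e < \<epsilon>" "0 < \<rho>"
      and lin: "\<And>u. (\<And>i. i \<in> {1..n} \<Longrightarrow> u i \<in> \<Omega> i \<inter> V) \<Longrightarrow> wmax n r (\<lambda>i. u i - w i) \<le> \<rho> \<Longrightarrow>
        deriv \<phi> (?g w) * ?g w \<le> deriv \<phi> (?g w) * ?g u + e * wmax n r (\<lambda>i. u i - w i)"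
    proof (rule extremal_pair_exists[OF n, of "\<lambda>i. \<Omega> i \<inter> V" \<omega> \<phi> ?d \<epsilon> r], goal_cases)
      case (1 i)
      then show ?case using assms(2) V(1) by (auto intro: closed_Int)
    next
      case (2 i)
      show ?case by (rule \<omega>V[OF 2(2)])
    next
      case 3
      show ?case by (rule \<phi>)
    next
      case 4
      show ?case using assms(6) by blast
    next
      case (6 u)
      show ?case by (rule d_le) (use 6(2) in blast)
    next
      case 5
      show ?case by (rule d0)
    next
      case 7
      show ?case by (rule assms(7))
    next
      case 8
      show ?case by (rule r)
    next
      case (9 w e \<rho>)
      show ?case by (rule that[of w e \<rho>]) (fact 9)+
    qed
    define M where "M = ?g w"
    define c where "c = deriv \<phi> M"
    have M0: "M > 0" using w(4) by (simp add: M_def)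
    have c: "c > 0" using \<phi> M0 by (simp add: class_C1_def c_def)
    define e1 where "e1 = (e + \<epsilon>) / 2"
    have e1: "e < e1" "e1 < \<epsilon>" "e1 > 0" using w(5,6) by (auto simp: e1_def)
    have "max \<tau> (e1 / \<epsilon>) < 1" using e1 \<epsilon> \<tau> by simp
    \<comment> \<open>\<open>\<sigma>\<close> will bound the sum \<open>W\<close> of the norms from
      below: exceeding \<open>\<tau>\<close> gives the pairing, and exceeding
      \<open>e1 / \<epsilon>\<close> lets the estimate survive the division by
      \<open>W\<close>.\<close>
    then obtain \<sigma> where "max \<tau> (e1 / \<epsilon>) < \<sigma>" "\<sigma> < 1" using dense by blast
    then have \<sigma>: "\<tau> < \<sigma>" "e1 / \<epsilon> < \<sigma>" "\<sigma> < 1" by simp_all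
    then have \<sigma>e: "e1 < \<sigma> * \<epsilon>" and \<sigma>0: "\<sigma> > 0" using \<epsilon> \<tau> by (auto simp: field_simps)
    define T where "T = inv_into {0..} \<phi> (\<phi> ?d + \<epsilon>)"
    \<comment> \<open>Growth of \<open>\<phi>\<close> to infinity and the intermediate value theorem
      place the argument in the range of \<open>\<phi>\<close>; only then does
      \<open>inv_into\<close> denote a true preimage.\<close>
    have T: "T \<ge> 0" "\<phi> T = \<phi> ?d + \<epsilon>"
    proof -
      have "\<forall>\<^sub>F t in at_top. \<phi> t \<ge> \<phi> ?d + \<epsilon>" using \<phi> by (simp add: class_C1_def filterlim_at_top)
      then obtain t where t: "t \<ge> ?d" "\<phi> t \<ge> \<phi> ?d + \<epsilon>" unfolding eventually_at_top_linorder by (meson linorder_linear)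
      have "continuous_on {0..} \<phi>" using \<phi> by (simp add: class_C1_def)
      then have "continuous_on {?d..t} \<phi>" by (rule continuous_on_subset) (use d0 in auto)
      then obtain z where z: "?d \<le> z" "\<phi> z = \<phi> ?d + \<epsilon>" using IVT'[of \<phi> ?d "\<phi> ?d + \<epsilon>" t] t \<epsilon> by auto
      then have im: "\<phi> ?d + \<epsilon> \<in> \<phi> ` {0..}" using d0 by (intro image_eqI[of _ _ z]) auto
      show "T \<ge> 0" using inv_into_into[OF im] by (simp add: T_def)
      show "\<phi> T = \<phi> ?d + \<epsilon>" unfolding T_def by (rule f_inv_into_f[OF im])
    qed
    have MT: "M < T"
    proof (rule ccontr)
      assume "\<not> M < T"
      then have "\<phi> T \<le> \<phi> (?g \<omega>)" using mono[of T "?g \<omega>"] T(1) w(3) by (cases "T = ?g \<omega>") (auto simp: M_def)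
      then show False using T(2) assms(7) by linarith
    qed
    have "continuous_on {0<..} (deriv \<phi>)" using \<phi> by (simp add: class_C1_def)
    then have "isCont (deriv \<phi>) M" using M0 by (simp add: continuous_on_eq_continuous_at)
    then have "(\<lambda>t. deriv \<phi> t * e1) \<midarrow>M\<rightarrow> c * e1" unfolding c_def isCont_def by (intro tendsto_intros)
    moreover have "c * e1 < c * (\<sigma> * \<epsilon>)" using c \<sigma>e by simp
    \<comment> \<open>The multipliers carry the slope \<open>c\<close> taken at \<open>M\<close>,
      whereas the claim asks for the slope at the new point. Continuity of the derivative closes the
      difference, inside the margin \<open>\<sigma> * \<epsilon> - e1\<close>.\<close>
    ultimately have "\<forall>\<^sub>F t in at M. deriv \<phi> t * e1 < c * (\<sigma> * \<epsilon>)" by (rule order_tendstoD)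
    then obtain \<delta> where \<delta>: "\<delta> > 0" "\<And>t. t \<noteq> M \<Longrightarrow> dist t M < \<delta> \<Longrightarrow> deriv \<phi> t * e1 < c * (\<sigma> * \<epsilon>)"
      unfolding eventually_at by blast
    have \<delta>': "deriv \<phi> t * e1 < c * (\<sigma> * \<epsilon>)" if "dist t M < \<delta>" for t
      using \<delta>(2)[of t] that \<open>c * e1 < c * (\<sigma> * \<epsilon>)\<close> by (cases "t = M") (auto simp: c_def)
    let ?C = "\<Sum>i=1..n. r i"
    have C0: "?C > 0" using r n by (intro sum_pos) auto
    \<comment> \<open>The admissible change of \<open>max_dist\<close>: within
      \<open>\<delta>\<close> for the slope, below \<open>M\<close> for positivity, below
      \<open>T - M\<close> for the upper bound. Halving makes all three strict.\<close>
    define m where "m = Min {\<delta>, M, T - M} / 2"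
    have m: "m > 0" "m < \<delta>" "m < M" "m < T - M" using \<delta>(1) M0 MT by (auto simp: m_def min_def)
    define p0 where "p0 = wmax n r (\<lambda>i. w i - \<omega> i)"
    define \<rho>' where "\<rho>' = Min {\<rho>, (1 - p0) / 2, m / ?C}"
    have \<rho>': "\<rho>' > 0" "\<rho>' \<le> \<rho>" "\<rho>' \<le> (1 - p0) / 2" "?C * \<rho>' \<le> m"
    proof -
      show "\<rho>' \<le> \<rho>" "\<rho>' \<le> (1 - p0) / 2" unfolding \<rho>'_def by (rule Min_le, simp, blast)+
      have "\<rho>' \<le> m / ?C" by (simp add: \<rho>'_def)
      then show "?C * \<rho>' \<le> m" using C0 by (simp add: pos_le_divide_eq mult.commute)
      have "(1 - p0) / 2 > 0" using w(2) by (simp add: p0_def)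
      moreover have "m / ?C > 0" using m C0 by simp
      ultimately show "\<rho>' > 0" using w(7) by (simp add: \<rho>'_def)
    qed
    obtain u and v y :: "nat \<Rightarrow> 'a \<Rightarrow>\<^sub>L real" where
      u: "\<And>i. i \<in> {1..n} \<Longrightarrow> u i \<in> \<Omega> i" "wmax n r (\<lambda>i. u i - w i) \<le> \<rho>'" and
      v: "(\<Sum>i=1..n-1. norm (v i)) \<le> 1"
      "\<sigma> * ?g u \<le> (\<Sum>i=1..n-1. blinfun_apply (v i) (u n - u i))"
      "c * (\<Sum>i=1..n. r i * norm (y i)) \<le> e1"
      "\<And>i. i \<in> {1..n-1} \<Longrightarrow> v i - y i \<in> frechet_normal_cone (\<Omega> i) (u i)"
      "- (\<Sum>i=1..n-1. v i) - y n \<in> frechet_normal_cone (\<Omega> n) (u n)"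
    proof (rule smooth_multipliers[OF n r c w(5) e1(1) \<rho>'(1) \<sigma>(3) V(1,2) Y, of \<Omega> w], goal_cases)
      case (1 i)
      show ?case using assms(2) 1(2) by blast
    next
      case (2 \<kappa>)
      show ?case by (rule smooth[OF 2(2)])
    next
      case (3 x y i)
      show ?case by (rule normal[OF 3(2-4)])
    next
      case (4 i)
      show ?case by (rule w(1)[OF 4(2)])
    next
      case (5 u)
      have "wmax n r (\<lambda>i. u i - w i) \<le> \<rho>" using 5(3) \<rho>'(2) by linarith
      then show ?case unfolding c_def M_def using 5(2) by (intro lin)
    next
      case 6
      show ?case by (rule w(4))
    next
      case (7 u v y)
      show ?case by (rule that[of u v y]) (fact 7)+
    qed
    have gu: "\<bar>?g u - M\<bar> \<le> m"
    proof -
      have "\<bar>?g u - M\<bar> \<le> ?C * wmax n r (\<lambda>i. u i - w i)" unfolding M_def by (rule max_dist_lipschitz_abs[OF n r])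
      also have "\<dots> \<le> ?C * \<rho>'" using u(2) C0 by (intro mult_left_mono) auto
      finally show ?thesis using \<rho>'(4) by linarith
    qed
    then have gu0: "0 < ?g u" and guT: "?g u < T" using m by linarith+
    have "dist (?g u) M < \<delta>" using gu m by (simp add: dist_real_def)
    then have du: "deriv \<phi> (?g u) * e1 < c * (\<sigma> * \<epsilon>)" by (rule \<delta>')
    have du0: "deriv \<phi> (?g u) > 0" using \<phi> gu0 by (simp add: class_C1_def)
    have near: "wmax n r (\<lambda>i. u i - \<omega> i) < 1"
    proof -
      have "wmax n r (\<lambda>i. u i - \<omega> i) \<le> wmax n r (\<lambda>i. u i - w i) + p0"
        unfolding p0_def using wmax_triangle[OF n1 r, of "\<lambda>i. u i - w i" "\<lambda>i. w i - \<omega> i"] by simp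
      then show ?thesis using u(2) \<rho>'(3) w(2) by (simp add: p0_def)
    qed
    define W where "W = (\<Sum>i=1..n-1. norm (v i))"
    let ?S = "\<Sum>i=1..n-1. blinfun_apply (v i) (u n - u i)"
    have "?S \<le> (\<Sum>i=1..n-1. norm (v i) * ?g u)"
    proof (rule sum_mono)
      fix i assume i: "i \<in> {1..n-1}"
      have "blinfun_apply (v i) (u n - u i) \<le> norm (v i) * norm (u n - u i)"
        using norm_blinfun[of "v i" "u n - u i"] by simp
      also have "\<dots> \<le> norm (v i) * ?g u" using norm_le_max_dist[OF i] by (intro mult_left_mono) auto
      finally show "blinfun_apply (v i) (u n - u i) \<le> norm (v i) * ?g u" .
    qed
    then have "\<sigma> * ?g u \<le> W * ?g u" using v(2) by (simp add: W_def sum_distrib_right)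
    then have W\<sigma>: "\<sigma> \<le> W" using gu0 by (simp only: mult_le_cancel_right_pos)
    then have W0: "W > 0" using \<sigma>0 by linarith
    have W1: "W \<le> 1" using v(1) by (simp add: W_def)
    \<comment> \<open>Dividing by \<open>W\<close> normalises the sum of the norms to 1. As
      \<open>\<sigma> \<le> W \<le> 1\<close>, the pairing does not decrease and the distances to
      the cones grow at most by the factor \<open>inverse \<sigma>\<close>.\<close>
    define x where "x i = inverse W *\<^sub>R (if i = n then - (\<Sum>i=1..n-1. v i) else v i)" for i
    define z where "z i = inverse W *\<^sub>R y i" for i
    have xv: "x i = inverse W *\<^sub>R v i" if "i \<in> {1..n-1}" for i using sub[OF that] by (simp add: x_def)
    have xz: "x i - z i \<in> frechet_normal_cone (\<Omega> i) (u i)" if i: "i \<in> {1..n}" for i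
    proof -
      have iW: "inverse W > 0" using W0 by simp
      show ?thesis
      proof (cases "i = n")
        case True
        then show ?thesis using frechet_normal_cone_scale[OF v(5) iW] by (simp add: x_def z_def scaleR_diff_right)
      next
        case False
        then have "i \<in> {1..n-1}" using i by auto
        from frechet_normal_cone_scale[OF v(4)[OF this] iW]
        show ?thesis using False by (simp add: x_def z_def scaleR_diff_right)
      qed
    qed
    have "lam * (\<Sum>i=1..n - 1. infdist (x i) (frechet_normal_cone (\<Omega> i) (u i))) + \<eta> * infdist (x n) (frechet_normal_cone (\<Omega> n) (u n))
       \<le> (\<Sum>i=1..n. r i * norm (z i))" by (rule infdist_bound[OF xz])
    also have "\<dots> = inverse W * (\<Sum>i=1..n. r i * norm (y i))"
      using W0 by (simp add: z_def sum_distrib_left mult.left_commute)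
    also have "\<dots> \<le> inverse W * (e1 / c)"
      using v(3) W0 c by (intro mult_left_mono) (auto simp: pos_le_divide_eq mult.commute)
    also have "\<dots> \<le> inverse \<sigma> * (e1 / c)"
      using W\<sigma> \<sigma>0 e1(3) c by (intro mult_right_mono le_imp_inverse_le) auto
    finally have "deriv \<phi> (?g u) * (lam * (\<Sum>i=1..n - 1. infdist (x i) (frechet_normal_cone (\<Omega> i) (u i))) + \<eta> * infdist (x n) (frechet_normal_cone (\<Omega> n) (u n)))
       \<le> deriv \<phi> (?g u) * (inverse \<sigma> * (e1 / c))" using du0 by (intro mult_left_mono) auto
    also have "\<dots> = (deriv \<phi> (?g u) * e1) / (c * \<sigma>)" by (simp add: divide_inverse)
    also have "\<dots> < \<epsilon>" using du c \<sigma>0 by (simp add: pos_divide_less_eq mult.commute mult.left_commute)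
    finally have est: "deriv \<phi> (?g u) * (lam * (\<Sum>i=1..n - 1. infdist (x i) (frechet_normal_cone (\<Omega> i) (u i))) +
       \<eta> * infdist (x n) (frechet_normal_cone (\<Omega> n) (u n))) < \<epsilon>" .
    have "(\<Sum>i=1..n-1. x i) = (\<Sum>i=1..n-1. inverse W *\<^sub>R v i)" by (intro sum.cong refl xv)
    then have sums: "(\<Sum>i=1..n. x i) = 0"
      by (intro total) (simp add: x_def[of n] scaleR_sum_right)
    have bl: "(\<forall>i\<in>{1..n - 1}. u i \<in> \<Omega> i \<inter> ball (\<omega> i) lam) \<and> u n \<in> \<Omega> n \<inter> ball (\<omega> n) \<eta>"
      by (rule balls[OF _ near]) (rule u(1))
    have norms: "(\<Sum>i=1..n-1. norm (x i)) = 1"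
    proof -
      have "(\<Sum>i=1..n-1. norm (x i)) = inverse W * W"
        using W0 by (simp add: xv W_def sum_distrib_left)
      then show ?thesis using W0 by simp
    qed
    have pair: "\<tau> * ?g u < (\<Sum>i=1..n-1. blinfun_apply (x i) (u n - u i))"
    proof -
      have "(\<Sum>i=1..n-1. blinfun_apply (x i) (u n - u i)) = inverse W * ?S"
        by (simp add: xv blinfun.scaleR_left sum_distrib_left)
      moreover have S0: "0 \<le> ?S" using v(2) mult_pos_pos[OF \<sigma>0 gu0] by linarith
      moreover have "1 * ?S \<le> inverse W * ?S" using W0 W1 S0 by (intro mult_right_mono) (auto simp: one_le_inverse_iff)
      moreover have "\<tau> * ?g u < \<sigma> * ?g u" using \<sigma>(1) gu0 by simp
      ultimately show ?thesis using v(2) by linarith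
    qed
    show ?case
      by (intro exI[of _ u] exI[of _ x] conjI bl[THEN conjunct1] bl[THEN conjunct2] gu0 guT[unfolded T_def] est sums norms pair)
  qed
qed

end
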